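(* The formulas $!^{\mathrm{T}}P\rightarrow\, !^{\mathrm{L}}P$ and $!^{\mathrm{L}}P\rightarrow\, !^{\mathrm{T}}P$ (with $P$ an atom) are uniformly valid. That is, there is an EPM that wins $!^{\mathrm{T}}A\rightarrow\, !^{\mathrm{L}}A$ for every static game $A$, and there is an EPM that wins $!^{\mathrm{L}}A\rightarrow\, !^{\mathrm{T}}A$ for every static game $A$.
   Context: Framework of computability logic (games between a machine $\top$ and an environment $\bot$). A move is a finite string; a labmove is a move labeled $\top$ or $\bot$; a run is a finite or infinite sequence of labmoves; a position is a finite run. A constant game $A$ consists of a set $\mathrm{Lr}^A$ of legal runs (containing the empty run, and such that a run is legal iff all its finite initial segments are) and a winner function $\mathrm{Wn}^A$ on runs; an illegal run is $\wp$-illegal if its shortest illegal initial segment ends with a $\wp$-labeled move, and is won by $\top$ iff it is $\bot$-illegal. A run $\Delta$ is a $\wp$-delay of $\Gamma$ if both players' subsequences of labmoves coincide in $\Gamma$ and $\Delta$, and whenever the $n$th $\wp$-labeled move comes after the $k$th $\neg\wp$-labeled move in $\Gamma$, the same holds in $\Delta$. $A$ is static if any $\wp$-delay of a $\wp$-won run is $\wp$-won. General games are functions from valuations (of variables) to constant games; operations act pointwise; such a game is static iff all its instances are. Operations: $\neg\Gamma$ interchanges labels in $\Gamma$; $\neg A$ has legal runs $\neg\Gamma$ for $\Gamma\in\mathrm{Lr}^A$ and $\Gamma$ is $\top$-won in $\neg A$ iff $\neg\Gamma$ is $\bot$-won in $A$. Parallel disjunction $A_1\vee A_2$: legal runs are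 the $\Gamma$ whose every move has the form $1.\alpha$ or $2.\alpha$ and with $\Gamma^{i.}\in\mathrm{Lr}^{A_i}$ ($i=1,2$), where $\Gamma^{i.}$ is the result of keeping only the labmoves with prefix "$i.$" and deleting that prefix; a legal run is $\top$-won iff $\Gamma^{1.}$ is $\top$-won in $A_1$ or $\Gamma^{2.}$ is $\top$-won in $A_2$. $A\rightarrow B$ means $\neg A\vee B$. For a run $\Theta$ and a bitstring $x$, $\Theta^{\preceq x}$ is obtained by deleting from $\Theta$ all labmoves except those with moves of the form $u.\beta$ with $u$ a finite initial segment of $x$, and then deleting the prefix "$u.$" from those. Loose branching recurrence $!^{\mathrm{L}}A$ (constant $A$): legal runs are the $\Gamma$ in which every move has the form $w.\alpha$ for a finite bitstring $w$ and $\Gamma^{\preceq v}\in\mathrm{Lr}^A$ for every infinite bitstring $v$; a legal run is $\top$-won iff $\Gamma^{\preceq v}$ is $\top$-won in $A$ for every infinite bitstring $v$. Tight branching recurrence $!^{\mathrm{T}}A$ (constant $A$): given a position $\Phi$, a node of the underlying BT-structure of $\Phi$ is a finite bitstring $w$ that is either empty or of the form $u0$ or $u1$ where $\Phi$ contains the move $u{:}$ ($u$ followed by a colon); a leaf is a node that is not a proper prefix of another node. A position is legal iff each of its labmoves $\wp\gamma$ is legal in the position $\Phi$ preceding it, where: a replicative move $w{:}$ is legal only for $\wp=\bot$ and only when $w$ is a leaf for $\Phi$; a non-replicative move $w.\alpha$ (by either player $\wp$) is legal iff $w$ is a node for $\Phi$ and for every infinite bitstring $v$ extending $w$, $\alpha$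 is a legal move by $\wp$ in the position $\Phi^{\preceq v}$ of $A$ (i.e. $\langle\Phi^{\preceq v},\wp\alpha\rangle\in\mathrm{Lr}^A$). An infinite run is legal iff all its finite initial segments are. A legal run $\Gamma$ is $\top$-won iff $\Gamma^{\preceq v}$ is $\top$-won in $A$ for every infinite bitstring $v$. Machines and validity: an EPM (easy-play machine) is a Turing-machine-style interactive algorithm that makes moves on its own and can grant permission to the environment, which may then make (at most) one move; an EPM wins (computes) a game $A$ iff in every possible play (against any environment behavior) the resulting run is won by $\top$ in $A$ and the machine is fair, i.e. grants permission infinitely often in infinite plays unless it does so only finitely often because... (standard notion; equivalently one may use hard-play machines, yielding the same computable static games). A formula built from an atom $P$ is uniformly valid iff there is a single EPM that wins the game obtained by substituting $A$ for $P$, for every static game $A$. *)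

theory Defs
  imports Main "HOL-Library.Infinite_Set" "HOL-Library.Sublist"
begin

datatype (set_seq: 'a) seq = Fin "'a list" | Inf "nat \<Rightarrow> 'a"
  for map: map_seq

fun seq_at :: "'a seq \<Rightarrow> nat \<Rightarrow> 'a option" where
  "seq_at (Fin xs) i = (if i < length xs then Some (xs ! i) else None)"
| "seq_at (Inf s) i = Some (s i)"

fun initial_segment :: "'a list \<Rightarrow> 'a seq \<Rightarrow> bool" where
  "initial_segment ys (Fin xs) \<longleftrightarrow> prefix ys xs"
| "initial_segment ys (Inf s) \<longleftrightarrow> ys = map s [0..<length ys]"

text \<open>Deleting entries from an infinite sequence may leave a finite one.\<close>

fun filter_seq :: "('a \<Rightarrow> bool) \<Rightarrow> 'a seq \<Rightarrow> 'a seq" where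
  "filter_seq P (Fin xs) = Fin (filter P xs)"
| "filter_seq P (Inf s) =
     (if finite {n. P (s n)} then Fin (map s (sorted_list_of_set {n. P (s n)}))
      else Inf (\<lambda>k. s (enumerate {n. P (s n)} k)))"

text \<open>Only meaningful on finite sequences; an infinite one is left unchanged.\<close>

fun snoc_seq :: "'a seq \<Rightarrow> 'a \<Rightarrow> 'a seq" where
  "snoc_seq (Fin xs) x = Fin (xs @ [x])"
| "snoc_seq (Inf s) x = Inf s"

text \<open>\<open>Top\<close> is the machine, \<open>Bot\<close> its environment.\<close>

datatype player = Top | Bot

fun opp :: "player \<Rightarrow> player" where
  "opp Top = Bot"
| "opp Bot = Top"

text \<open>The type \<^typ>\<open>char\<close> plays the role of the (finite) keyboard alphabet.\<close>

type_synonym move = string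
type_synonym labmove = "player \<times> move"
type_synonym run = "labmove seq"
type_synonym position = "labmove list"

record cgame =
  Lr :: "run set"
  Wn :: "run \<Rightarrow> player"

definition illegal_by :: "player \<Rightarrow> run set \<Rightarrow> run \<Rightarrow> bool" where
  "illegal_by p L \<Gamma> \<longleftrightarrow>
     (\<exists>\<Phi> \<alpha>. initial_segment (\<Phi> @ [(p, \<alpha>)]) \<Gamma> \<and> Fin (\<Phi> @ [(p, \<alpha>)]) \<notin> L \<and>
        (\<forall>\<Psi>. strict_prefix \<Psi> (\<Phi> @ [(p, \<alpha>)]) \<longrightarrow> Fin \<Psi> \<in> L))"

definition constant_game :: "cgame \<Rightarrow> bool" where
  "constant_game A \<longleftrightarrow>
     Fin [] \<in> Lr A \<and>
     (\<forall>\<Gamma>. \<Gamma> \<in> Lr A \<longleftrightarrow> (\<forall>\<Phi>. initial_segment \<Phi> \<Gamma> \<longrightarrow> Fin \<Phi> \<in> Lr A)) \<and>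
     (\<forall>\<Gamma>. \<Gamma> \<notin> Lr A \<longrightarrow> (Wn A \<Gamma> = Top \<longleftrightarrow> illegal_by Bot (Lr A) \<Gamma>))"

definition nth_labeled :: "player \<Rightarrow> nat \<Rightarrow> run \<Rightarrow> nat \<Rightarrow> bool" where
  "nth_labeled p n \<Gamma> i \<longleftrightarrow>
     (\<exists>\<alpha>. seq_at \<Gamma> i = Some (p, \<alpha>)) \<and>
     card {j. j < i \<and> (\<exists>\<beta>. seq_at \<Gamma> j = Some (p, \<beta>))} = n"

text \<open>\<open>\<Delta>\<close> is a \<open>p\<close>-delay of \<open>\<Gamma>\<close>. Moves are counted from 0, which makes no difference since
  \<open>n\<close> and \<open>k\<close> are arbitrary.\<close>

definition is_delay :: "player \<Rightarrow> run \<Rightarrow> run \<Rightarrow> bool" where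
  "is_delay p \<Delta> \<Gamma> \<longleftrightarrow>
     (\<forall>q. filter_seq (\<lambda>m. fst m = q) \<Delta> = filter_seq (\<lambda>m. fst m = q) \<Gamma>) \<and>
     (\<forall>n k i j i' j'.
        nth_labeled p n \<Gamma> i \<and> nth_labeled (opp p) k \<Gamma> j \<and> j < i \<and>
        nth_labeled p n \<Delta> i' \<and> nth_labeled (opp p) k \<Delta> j' \<longrightarrow> j' < i')"

definition static_cgame :: "cgame \<Rightarrow> bool" where
  "static_cgame A \<longleftrightarrow>
     (\<forall>p \<Gamma> \<Delta>. is_delay p \<Delta> \<Gamma> \<and> Wn A \<Gamma> = p \<longrightarrow> Wn A \<Delta> = p)"

definition mk_cgame :: "run set \<Rightarrow> (run \<Rightarrow> bool) \<Rightarrow> cgame" where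
  "mk_cgame L W =
     \<lparr>Lr = L,
      Wn = (\<lambda>\<Gamma>. if (if \<Gamma> \<in> L then W \<Gamma> else illegal_by Bot L \<Gamma>) then Top else Bot)\<rparr>"

definition neg_run :: "run \<Rightarrow> run" where
  "neg_run = map_seq (\<lambda>(p, \<alpha>). (opp p, \<alpha>))"

definition neg_cgame :: "cgame \<Rightarrow> cgame" where
  "neg_cgame A = \<lparr>Lr = neg_run ` Lr A, Wn = (\<lambda>\<Gamma>. opp (Wn A (neg_run \<Gamma>)))\<rparr>"

text \<open>\<open>component i \<Gamma>\<close> keeps the labmoves with the prefix \<open>i.\<close> and deletes that prefix;
  here \<open>i\<close> is the character \<open>1\<close> or \<open>2\<close>, so the prefix has length 2.\<close>

definition component :: "char \<Rightarrow> run \<Rightarrow> run" where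
  "component i \<Gamma> =
     map_seq (\<lambda>(p, \<alpha>). (p, drop 2 \<alpha>)) (filter_seq (\<lambda>(p, \<alpha>). prefix [i, CHR ''.''] \<alpha>) \<Gamma>)"

definition pdisj_cgame :: "cgame \<Rightarrow> cgame \<Rightarrow> cgame" where
  "pdisj_cgame A B = mk_cgame
     {\<Gamma>. (\<forall>(p, \<gamma>) \<in> set_seq \<Gamma>. \<exists>\<alpha>. \<gamma> = ''1.'' @ \<alpha> \<or> \<gamma> = ''2.'' @ \<alpha>) \<and>
         component (CHR ''1'') \<Gamma> \<in> Lr A \<and> component (CHR ''2'') \<Gamma> \<in> Lr B}
     (\<lambda>\<Gamma>. Wn A (component (CHR ''1'') \<Gamma>) = Top \<or> Wn B (component (CHR ''2'') \<Gamma>) = Top)"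

definition bitstring :: "string \<Rightarrow> bool" where
  "bitstring w \<longleftrightarrow> set w \<subseteq> {CHR ''0'', CHR ''1''}"

text \<open>Finite bitstrings occur inside moves and are therefore character strings; infinite ones
  are functions to \<^typ>\<open>bool\<close>. \<open>bit_segment u x\<close>: \<open>u\<close> is a finite initial segment of \<open>x\<close>.\<close>

definition bit_segment :: "string \<Rightarrow> (nat \<Rightarrow> bool) \<Rightarrow> bool" where
  "bit_segment u x \<longleftrightarrow> u = map (\<lambda>i. if x i then CHR ''1'' else CHR ''0'') [0..<length u]"

text \<open>A bitstring \<open>u\<close> contains no dot, so deleting everything up to and including the first dot
  deletes exactly the prefix \<open>u.\<close>.\<close>

definition thread :: "(nat \<Rightarrow> bool) \<Rightarrow> run \<Rightarrow> run" where
  "thread x \<Theta> =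
     map_seq (\<lambda>(p, \<alpha>). (p, tl (dropWhile (\<lambda>c. c \<noteq> CHR ''.'') \<alpha>)))
       (filter_seq (\<lambda>(p, \<alpha>). \<exists>u \<beta>. bit_segment u x \<and> \<alpha> = u @ ''.'' @ \<beta>) \<Theta>)"

definition loose_cgame :: "cgame \<Rightarrow> cgame" where
  "loose_cgame A = mk_cgame
     {\<Gamma>. (\<forall>(p, \<gamma>) \<in> set_seq \<Gamma>. \<exists>w \<alpha>. bitstring w \<and> \<gamma> = w @ ''.'' @ \<alpha>) \<and>
         (\<forall>v. thread v \<Gamma> \<in> Lr A)}
     (\<lambda>\<Gamma>. \<forall>v. Wn A (thread v \<Gamma>) = Top)"

definition bt_node :: "position \<Rightarrow> string \<Rightarrow> bool" where
  "bt_node \<Phi> w \<longleftrightarrow>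
     w = [] \<or> (\<exists>u b. bitstring u \<and> b \<in> {CHR ''0'', CHR ''1''} \<and> w = u @ [b] \<and>
                     u @ '':'' \<in> snd ` set \<Phi>)"

definition bt_leaf :: "position \<Rightarrow> string \<Rightarrow> bool" where
  "bt_leaf \<Phi> w \<longleftrightarrow> bt_node \<Phi> w \<and> \<not> (\<exists>w'. bt_node \<Phi> w' \<and> strict_prefix w w')"

definition tight_legal_move :: "cgame \<Rightarrow> position \<Rightarrow> player \<Rightarrow> move \<Rightarrow> bool" where
  "tight_legal_move A \<Phi> p \<gamma> \<longleftrightarrow>
     (\<exists>w. bitstring w \<and> \<gamma> = w @ '':'' \<and> p = Bot \<and> bt_leaf \<Phi> w) \<or>
     (\<exists>w \<alpha>. bitstring w \<and> \<gamma> = w @ ''.'' @ \<alpha> \<and> bt_node \<Phi> w \<and>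
        (\<forall>v. bit_segment w v \<longrightarrow> snoc_seq (thread v (Fin \<Phi>)) (p, \<alpha>) \<in> Lr A))"

definition tight_cgame :: "cgame \<Rightarrow> cgame" where
  "tight_cgame A = mk_cgame
     {\<Gamma>. \<forall>\<Phi> p \<gamma>. initial_segment (\<Phi> @ [(p, \<gamma>)]) \<Gamma> \<longrightarrow> tight_legal_move A \<Phi> p \<gamma>}
     (\<lambda>\<Gamma>. \<forall>v. Wn A (thread v \<Gamma>) = Top)"

text \<open>Variables are indexed by natural numbers, and their values (constants) are natural
  numbers.\<close>

type_synonym valuation = "nat \<Rightarrow> nat"
type_synonym game = "valuation \<Rightarrow> cgame"

definition static_game :: "game \<Rightarrow> bool" where
  "static_game A \<longleftrightarrow> (\<forall>e. constant_game (A e) \<and> static_cgame (A e))"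

datatype formula =
    Atom
  | Neg formula
  | Disj formula formula
  | TightRec formula
  | LooseRec formula

abbreviation Imp :: "formula \<Rightarrow> formula \<Rightarrow> formula" where
  "Imp F G \<equiv> Disj (Neg F) G"

primrec subst_game :: "game \<Rightarrow> formula \<Rightarrow> game" where
  "subst_game A Atom = A"
| "subst_game A (Neg F) = (\<lambda>e. neg_cgame (subst_game A F e))"
| "subst_game A (Disj F G) = (\<lambda>e. pdisj_cgame (subst_game A F e) (subst_game A G e))"
| "subst_game A (TightRec F) = (\<lambda>e. tight_cgame (subst_game A F e))"
| "subst_game A (LooseRec F) = (\<lambda>e. loose_cgame (subst_game A F e))"

text \<open>An easy-play machine is a deterministic Turing machine with a read-only valuation tape, a
  read-only run tape and finitely many read/write work tapes, all infinite to the right only.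
  The run tape always spells the current position.  A step taken from a move state appends, as a
  \<^const>\<open>Top\<close>-labeled move, the string found at the beginning of the first work tape.  A step taken
  from a permission state grants permission: the environment may append one
  \<^const>\<open>Bot\<close>-labeled move.\<close>

datatype symbol = Blank | is_Key: Key (key: char) | Label player | Aux nat

datatype direction = Left | Stay | Right

record epm =
  control_states :: "nat set"
  alphabet :: "symbol set"
  start_state :: nat
  move_states :: "nat set"
  permission_states :: "nat set"
  work_tapes :: nat
  transition :: "nat \<Rightarrow> symbol \<Rightarrow> symbol \<Rightarrow> symbol list
                   \<Rightarrow> nat \<times> direction \<times> direction \<times> (symbol \<times> direction) list"
    \<comment> \<open>Input: state and the symbols scanned on the valuation, run and work tapes. Output: new
      state, movements of the valuation and run heads, and symbols written and movements made on
      the work tapes.\<close>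

definition is_epm :: "epm \<Rightarrow> bool" where
  "is_epm M \<longleftrightarrow>
     finite (control_states M) \<and> finite (alphabet M) \<and>
     {Blank} \<union> range Key \<union> range Label \<subseteq> alphabet M \<and>
     start_state M \<in> control_states M \<and>
     move_states M \<subseteq> control_states M \<and> permission_states M \<subseteq> control_states M \<and>
     move_states M \<inter> permission_states M = {} \<and>
     0 < work_tapes M \<and>
     (\<forall>q \<in> control_states M. \<forall>a \<in> alphabet M. \<forall>b \<in> alphabet M. \<forall>cs.
        length cs = work_tapes M \<and> set cs \<subseteq> alphabet M \<longrightarrow>
        (case transition M q a b cs of (q', dv, dr, acts) \<Rightarrow>
           q' \<in> control_states M \<and> length acts = work_tapes M \<and>
           fst ` set acts \<subseteq> alphabet M))"

record config =
  state :: nat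
  val_head :: nat
  run_head :: nat
  works :: "((nat \<Rightarrow> symbol) \<times> nat) list"  \<comment> \<open>content and head position of each work tape\<close>
  pos :: position

fun decimal :: "nat \<Rightarrow> string" where
  "decimal n = (if n < 10 then [char_of (48 + n)]
                else decimal (n div 10) @ [char_of (48 + n mod 10)])"

text \<open>The valuation tape spells \<open>e 0, e 1, \<dots>\<close> in decimal, each followed by a blank. The first
  \<open>i + 1\<close> blocks cover cell \<open>i\<close>, since no block is empty.\<close>

definition valuation_tape :: "valuation \<Rightarrow> nat \<Rightarrow> symbol" where
  "valuation_tape e i =
     concat (map (\<lambda>j. map Key (decimal (e j)) @ [Blank]) [0..<Suc i]) ! i"

definition run_tape :: "position \<Rightarrow> nat \<Rightarrow> symbol" where
  "run_tape \<Phi> i =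
     (let s = concat (map (\<lambda>(p, \<alpha>). Label p # map Key \<alpha>) \<Phi>)
      in if i < length s then s ! i else Blank)"

text \<open>The string of keyboard characters preceding the first cell that contains none.  Such a cell
  exists because only finitely many cells of a work tape are ever non-blank.\<close>

definition spelled_move :: "(nat \<Rightarrow> symbol) \<Rightarrow> move" where
  "spelled_move t = map (\<lambda>i. key (t i)) [0..<(LEAST n. \<not> is_Key (t n))]"

fun shift_head :: "direction \<Rightarrow> nat \<Rightarrow> nat" where
  "shift_head Left h = h - 1"  \<comment> \<open>a head at the leftmost cell stays there\<close>
| "shift_head Stay h = h"
| "shift_head Right h = Suc h"

definition initial_config :: "epm \<Rightarrow> config" where
  "initial_config M =
     \<lparr>state = start_state M, val_head = 0, run_head = 0,
      works = replicate (work_tapes M) (\<lambda>_. Blank, 0), pos = []\<rparr>"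

definition next_positions :: "epm \<Rightarrow> config \<Rightarrow> position set" where
  "next_positions M c =
     (if state c \<in> move_states M then {pos c @ [(Top, spelled_move (fst (works c ! 0)))]}
      else if state c \<in> permission_states M then insert (pos c) {pos c @ [(Bot, \<alpha>)] | \<alpha>. True}
      else {pos c})"

definition successor :: "epm \<Rightarrow> valuation \<Rightarrow> config \<Rightarrow> config \<Rightarrow> bool" where
  "successor M e c c' \<longleftrightarrow>
     (case transition M (state c) (valuation_tape e (val_head c)) (run_tape (pos c) (run_head c))
             (map (\<lambda>(t, h). t h) (works c)) of
       (q', dv, dr, acts) \<Rightarrow>
         state c' = q' \<and>
         val_head c' = shift_head dv (val_head c) \<and>
         run_head c' = shift_head dr (run_head c) \<and>
         works c' = map2 (\<lambda>(t, h) (s, d). (t(h := s), shift_head d h)) (works c) acts \<and>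
         pos c' \<in> next_positions M c)"

definition computation_branch :: "epm \<Rightarrow> valuation \<Rightarrow> (nat \<Rightarrow> config) \<Rightarrow> bool" where
  "computation_branch M e C \<longleftrightarrow>
     C 0 = initial_config M \<and> (\<forall>n. successor M e (C n) (C (Suc n)))"

definition fair_branch :: "epm \<Rightarrow> (nat \<Rightarrow> config) \<Rightarrow> bool" where
  "fair_branch M C \<longleftrightarrow> infinite {n. state (C n) \<in> permission_states M}"

text \<open>The run spelled by a branch is the limit of its positions.\<close>

definition spells :: "(nat \<Rightarrow> config) \<Rightarrow> run \<Rightarrow> bool" where
  "spells C \<Gamma> \<longleftrightarrow> (\<forall>\<Phi>. initial_segment \<Phi> \<Gamma> \<longleftrightarrow> (\<exists>n. prefix \<Phi> (pos (C n))))"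

definition wins :: "epm \<Rightarrow> valuation \<Rightarrow> cgame \<Rightarrow> bool" where
  "wins M e A \<longleftrightarrow>
     (\<forall>C \<Gamma>. computation_branch M e C \<and> spells C \<Gamma> \<longrightarrow>
        Wn A \<Gamma> = Top \<and> (fair_branch M C \<or> illegal_by Bot (Lr A) \<Gamma>))"

definition computes :: "epm \<Rightarrow> game \<Rightarrow> bool" where
  "computes M A \<longleftrightarrow> (\<forall>e. wins M e (A e))"

definition uniformly_valid :: "formula \<Rightarrow> bool" where
  "uniformly_valid F \<longleftrightarrow>
     (\<exists>M. is_epm M \<and> (\<forall>A. static_game A \<longrightarrow> computes M (subst_game A F)))"

text \<open>Every computation branch spells exactly one run, so \<^const>\<open>wins\<close> is never vacuous.\<close>

lemma successor_prefix:
  assumes "successor M e c c'" shows "prefix (pos c) (pos c')"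
  using assms by (auto simp: successor_def next_positions_def split: prod.splits if_splits)

lemma branch_prefix:
  assumes "computation_branch M e C" "m \<le> n" shows "prefix (pos (C m)) (pos (C n))"
  using assms(2)
proof (induction rule: dec_induct)
  case (step k)
  then show ?case
    using assms(1) successor_prefix prefix_order.trans unfolding computation_branch_def by blast
qed simp

lemma initial_segment_inject:
  assumes "\<And>\<Phi>. initial_segment \<Phi> \<Gamma> \<longleftrightarrow> initial_segment \<Phi> \<Delta>"
  shows "\<Gamma> = \<Delta>"
proof -
  have len: False if "\<And>\<Phi>. prefix \<Phi> xs \<longleftrightarrow> \<Phi> = map s [0..<length \<Phi>]"
    for xs :: "'a list" and s
    using that[of "map s [0..<Suc (length xs)]"] prefix_length_le by fastforce
  have inf: "s = t" if "\<And>\<Phi>. \<Phi> = map s [0..<length \<Phi>] \<longleftrightarrow> \<Phi> = map t [0..<length \<Phi>]"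
    for s t :: "nat \<Rightarrow> 'a"
  proof
    fix i
    have "map s [0..<Suc i] = map t [0..<Suc i]"
      using that[of "map s [0..<Suc i]"] by simp
    then show "s i = t i" by simp
  qed
  show ?thesis
  proof (cases \<Gamma>; cases \<Delta>)
    fix xs ys assume "\<Gamma> = Fin xs" "\<Delta> = Fin ys"
    then show ?thesis using assms[of xs] assms[of ys] by (simp add: prefix_order.antisym)
  next
    fix xs s assume "\<Gamma> = Fin xs" "\<Delta> = Inf s"
    then show ?thesis using assms len[of xs s] by simp
  next
    fix s xs assume "\<Gamma> = Inf s" "\<Delta> = Fin xs"
    then show ?thesis using assms len[of xs s] by simp
  next
    fix s t assume "\<Gamma> = Inf s" "\<Delta> = Inf t"
    then show ?thesis using assms inf[of s t] by simp
  qed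
qed

lemma branch_spells_unique:
  assumes "computation_branch M e C" shows "\<exists>!\<Gamma>. spells C \<Gamma>"
proof -
  have "\<exists>\<Gamma>. spells C \<Gamma>"
  proof (cases "\<exists>N. \<forall>n. length (pos (C n)) \<le> N")
    case True
    then obtain k where k: "\<And>n. length (pos (C n)) \<le> length (pos (C k))"
      using ex_has_greatest_nat[of "\<lambda>_. True" 0 "\<lambda>n. length (pos (C n))"]
      by (metis less_Suc_eq_le)
    have "prefix (pos (C n)) (pos (C k))" for n
      using branch_prefix[OF assms, of n k] branch_prefix[OF assms, of k n] k[of n]
      by (metis le_cases prefix_length_prefix prefix_order.order_refl)
    then have "spells C (Fin (pos (C k)))"
      unfolding spells_def by (auto intro: prefix_order.trans)
    then show ?thesis by blast
  next
    case False
    define f where "f i = (LEAST n. i < length (pos (C n)))" for i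
    have f: "i < length (pos (C (f i)))" for i
      unfolding f_def using False by (metis LeastI_ex not_le)
    have eq: "pos (C m) ! i = pos (C n) ! i"
      if "i < length (pos (C m))" "i < length (pos (C n))" for i m n
      using branch_prefix[OF assms, of m n] branch_prefix[OF assms, of n m] that
      by (metis le_cases nth_append prefix_def)
    define s where "s i = pos (C (f i)) ! i" for i
    have "initial_segment \<Phi> (Inf s) \<longleftrightarrow> (\<exists>n. prefix \<Phi> (pos (C n)))" for \<Phi>
    proof
      assume "initial_segment \<Phi> (Inf s)"
      then have \<Phi>: "\<Phi> = map s [0..<length \<Phi>]" by simp
      have nth: "\<Phi> ! i = s i" if "i < length \<Phi>" for i
        using that by (subst \<Phi>) simp
      have "\<Phi> = take (length \<Phi>) (pos (C (f (length \<Phi>))))"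
        using f[of "length \<Phi>"] nth eq[OF f, of _ "f (length \<Phi>)"]
        by (intro nth_equalityI) (auto simp: s_def)
      then show "\<exists>n. prefix \<Phi> (pos (C n))" by (metis take_is_prefix)
    next
      assume "\<exists>n. prefix \<Phi> (pos (C n))"
      then obtain n ys where n: "pos (C n) = \<Phi> @ ys" by (auto simp: prefix_def)
      have "\<Phi> ! i = s i" if "i < length \<Phi>" for i
        using eq[OF f, of i n] that n by (simp add: s_def nth_append)
      then show "initial_segment \<Phi> (Inf s)" by (auto intro: nth_equalityI)
    qed
    then show ?thesis unfolding spells_def by blast
  qed
  moreover have "\<Gamma> = \<Delta>" if "spells C \<Gamma>" "spells C \<Delta>" for \<Gamma> \<Delta>
    using that by (intro initial_segment_inject) (simp add: spells_def)
  ultimately show ?thesis by blast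
qed

end

(* Both machines grant permission only after every move of the environment has been answered
   completely, so that corresponding threads of the antecedent and of the consequent are equal runs
   at every moment.

   Tight to loose: the tight tree is kept a full binary tree, and each thread is matched with itself.
   A move at w in the consequent is answered by replicating |w| whole levels and then copying the move.

   Loose to tight: each leaf p of the tight tree is simulated by a loose bitstring x, the x of distinct
   leaves being incomparable. Writing N for a number exceeding the length of every bitstring used by
   the environment so far, a move of the environment in the consequent at u is copied to x 0^N for
   every leaf p extending u, a loose move at w is copied to every p such that w is a prefix of x 0^N,
   and when p is replicated its children get x 0^N 0 and x 0^N 1. The thread of an infinite bitstring v
   is thus matched with the limit of the x 0^N of the leaves on v. *)

theory Submission imports Defs "HOL-Library.Countable" begin

text \<open>Replication in a tight game belongs to \<open>Bot\<close>. Negation makes the machine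
  \<open>Bot\<close> in the antecedent, so in the first direction it grows the tree itself, and
  growing by whole levels lets one number describe it. In the second direction the tree is imposed
  by the environment, which may also move at any w in the loose antecedent. The padding answers
  this: once |w| \<le> N, the string w is an initial segment of x 0^N or incomparable with it, so
  all threads through x 0^N receive the same moves and a leaf has one well-defined history. The
  strings x 0^N along v only grow, both when N is raised and when a leaf is split, so their limit
  exists. A win needs no bijection of threads: every thread of the consequent must equal some thread
  of the antecedent, fixed for the whole run; other antecedent threads may remain without a partner.
  Equality of threads also makes the replies legal, since a move legal in one of two equal threads
  is legal in the other. An illegal move of the environment settles the run at once, and as long as
  it moves legally each round of the machine is a terminating computation, which gives
  fairness.\<close>

section \<open>Sequences and their initial segments\<close>

lemma initial_segment_map_seq:
  "initial_segment \<Phi> (map_seq f \<Gamma>) \<longleftrightarrow> (\<exists>\<Psi>. initial_segment \<Psi> \<Gamma> \<and> \<Phi> = map f \<Psi>)"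
proof (cases \<Gamma>)
  case (Fin xs)
  have "prefix \<Phi> (map f xs) \<longleftrightarrow> (\<exists>\<Psi>. prefix \<Psi> xs \<and> \<Phi> = map f \<Psi>)"
    by (metis map_mono_prefix prefix_def append_eq_map_conv)
  with Fin show ?thesis by simp
next
  case (Inf s)
  show ?thesis
  proof
    assume "initial_segment \<Phi> (map_seq f \<Gamma>)"
    then have "\<Phi> = map (\<lambda>i. f (s i)) [0..<length \<Phi>]" unfolding Inf by (simp add: comp_def)
    then have "\<Phi> = map f (map s [0..<length \<Phi>])" unfolding map_map comp_def .
    moreover have "initial_segment (map s [0..<length \<Phi>]) \<Gamma>" unfolding Inf by simp
    ultimately show "\<exists>\<Psi>. initial_segment \<Psi> \<Gamma> \<and> \<Phi> = map f \<Psi>" by blast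
  next
    assume "\<exists>\<Psi>. initial_segment \<Psi> \<Gamma> \<and> \<Phi> = map f \<Psi>"
    then obtain \<Psi> where \<Psi>: "\<Psi> = map s [0..<length \<Psi>]" "\<Phi> = map f \<Psi>" using Inf by auto
    have "map f \<Psi> = map f (map s [0..<length \<Psi>])" by (rule arg_cong[OF \<Psi>(1)])
    then have "\<Phi> = map (\<lambda>i. f (s i)) [0..<length \<Phi>]"
      unfolding \<Psi>(2) by (simp only: map_map comp_def length_map length_upt diff_zero)
    then show "initial_segment \<Phi> (map_seq f \<Gamma>)" unfolding Inf by (simp add: comp_def)
  qed
qed

lemma initial_segment_prefix:
  "initial_segment \<Phi> \<Gamma> \<Longrightarrow> prefix \<Psi> \<Phi> \<Longrightarrow> initial_segment \<Psi> \<Gamma>"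
proof (cases \<Gamma>)
  case (Inf s)
  assume "initial_segment \<Phi> \<Gamma>" "prefix \<Psi> \<Phi>"
  then obtain ys where \<Phi>: "\<Phi> = \<Psi> @ ys" "\<Phi> = map s [0..<length \<Phi>]"
    using Inf by (auto simp: prefix_def)
  then have "\<Psi> = take (length \<Psi>) (map s [0..<length \<Phi>])" by (metis append_eq_conv_conj)
  also have "\<dots> = map s [0..<length \<Psi>]" using \<Phi>(1) by (simp add: take_map)
  finally show ?thesis using Inf by simp
qed auto

lemma sorted_list_of_set_below:
  "finite S \<Longrightarrow> sorted_list_of_set (S \<inter> {..<n}) = filter (\<lambda>k. k \<in> S) [0..<n]"
  for S :: "nat set"
  by (rule sorted_distinct_set_unique) (auto intro: sorted_wrt_filter simp: sorted_wrt_filter)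

lemma card_Int_lessThan_enumerate:
  fixes S :: "nat set"
  assumes "infinite S" shows "card (S \<inter> {..<enumerate S k}) = k"
proof -
  have "S \<inter> {..<enumerate S k} = enumerate S ` {..<k}"
  proof (intro set_eqI iffI)
    fix i assume i: "i \<in> S \<inter> {..<enumerate S k}"
    then obtain j where j: "enumerate S j = i" using enumerate_Ex[OF assms, of i] by blast
    with i have "j < k" using enumerate_mono_iff[OF assms] by force
    with j show "i \<in> enumerate S ` {..<k}" by blast
  next
    fix i assume "i \<in> enumerate S ` {..<k}"
    then show "i \<in> S \<inter> {..<enumerate S k}"
      using enumerate_in_set[OF assms] enumerate_mono[OF _ assms] by auto
  qed
  moreover have "inj_on (enumerate S) {..<k}"
    using assms by (meson inj_enumerate inj_on_subset subset_UNIV)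
  ultimately show ?thesis by (simp add: card_image)
qed

lemma enumerate_card_below:
  fixes S :: "nat set"
  assumes "infinite S" "n \<in> S"
  shows "enumerate S (card (S \<inter> {..<n})) = n"
proof -
  obtain k where "enumerate S k = n" using enumerate_Ex[OF assms] by blast
  then show ?thesis using card_Int_lessThan_enumerate[OF assms(1), of k] by simp
qed

text \<open>Counting the members of \<open>S\<close> below \<open>n\<close> translates a cut in the
  range of indices into a cut in the enumeration of \<open>S\<close>.\<close>

lemma filter_upt_enumerate:
  fixes S :: "nat set"
  assumes "infinite S"
  shows "filter (\<lambda>k. k \<in> S) [0..<n] = map (enumerate S) [0..<card (S \<inter> {..<n})]"
proof (induction n)
  case (Suc n)
  have "S \<inter> {..<Suc n} = (if n \<in> S then insert n (S \<inter> {..<n}) else S \<inter> {..<n})"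
    by (auto simp: less_Suc_eq)
  then have "card (S \<inter> {..<Suc n}) =
      (if n \<in> S then Suc (card (S \<inter> {..<n})) else card (S \<inter> {..<n}))" by auto
  then show ?case using Suc assms by (auto simp: enumerate_card_below)
qed simp

text \<open>This is the only place where filtering an infinite sequence is opened, including the
  case that only finitely many entries survive. From here on threads and components of runs are
  handled through functions on positions.\<close>

lemma initial_segment_filter_seq:
  "initial_segment \<Phi> (filter_seq P \<Gamma>) \<longleftrightarrow> (\<exists>\<Psi>. initial_segment \<Psi> \<Gamma> \<and> \<Phi> = filter P \<Psi>)"
proof (cases \<Gamma>)
  case (Fin xs)
  have "\<exists>\<Psi>. prefix \<Psi> xs \<and> \<Phi> = filter P \<Psi>" if "prefix \<Phi> (filter P xs)"
    using that
  proof (induction xs rule: rev_induct)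
    case (snoc x xs)
    show ?case
    proof (cases "prefix \<Phi> (filter P xs)")
      case True
      then show ?thesis using snoc.IH by (meson prefix_snoc)
    next
      case False
      then have "\<Phi> = filter P (xs @ [x])"
        using snoc.prems by (auto split: if_splits)
      then show ?thesis by blast
    qed
  qed simp
  then show ?thesis using Fin by (auto simp: filter_mono_prefix)
next
  case (Inf s)
  define S where "S = {n. P (s n)}"
  have eq: "filter P (map s [0..<n]) = map s (filter (\<lambda>k. k \<in> S) [0..<n])" for n
    by (simp add: filter_map S_def comp_def)
  have iseg: "(\<exists>\<Psi>. initial_segment \<Psi> \<Gamma> \<and> \<Phi> = filter P \<Psi>) \<longleftrightarrow>
      (\<exists>n. \<Phi> = map s (filter (\<lambda>k. k \<in> S) [0..<n]))"
    unfolding Inf initial_segment.simps eq[symmetric]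
  proof (intro iffI; elim exE conjE)
    fix \<Psi> assume \<Psi>: "\<Psi> = map s [0..<length \<Psi>]" "\<Phi> = filter P \<Psi>"
    have "\<Phi> = filter P (map s [0..<length \<Psi>])" by (subst \<Psi>(1)[symmetric]) (rule \<Psi>(2))
    then show "\<exists>n. \<Phi> = filter P (map s [0..<n])" by (rule exI)
  next
    fix n assume "\<Phi> = filter P (map s [0..<n])"
    then show "\<exists>\<Psi>. \<Psi> = map s [0..<length \<Psi>] \<and> \<Phi> = filter P \<Psi>"
      by (intro exI[of _ "map s [0..<n]"]) (simp only: length_map length_upt, simp)
  qed
  show ?thesis
  proof (cases "finite S")
    case True
    obtain m where m: "S \<subseteq> {..<m}" using True by (metis bounded_nat_set_is_finite finite_nat_iff_bounded)
    have full: "sorted_list_of_set S = filter (\<lambda>k. k \<in> S) [0..<m]"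
      using sorted_list_of_set_below[OF True, of m] m by (simp add: Int_absorb2)
    have "prefix \<Phi> (map s (filter (\<lambda>k. k \<in> S) [0..<m])) \<longleftrightarrow>
        (\<exists>n. \<Phi> = map s (filter (\<lambda>k. k \<in> S) [0..<n]))" (is "?l \<longleftrightarrow> ?r")
    proof
      have *: "\<exists>n. \<Phi> = map s (filter (\<lambda>k. k \<in> S) [0..<n])"
        if "prefix \<Phi> (map s (filter (\<lambda>k. k \<in> S) [0..<m]))" for m
        using that
      proof (induction m)
        case (Suc m)
        show ?case
        proof (cases "prefix \<Phi> (map s (filter (\<lambda>k. k \<in> S) [0..<m]))")
          case False
          then have "\<Phi> = map s (filter (\<lambda>k. k \<in> S) [0..<Suc m])"
            using Suc.prems by (auto split: if_splits)
          then show ?thesis by blast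
        qed (use Suc.IH in blast)
      qed (auto intro: exI[of _ 0])
      show "?l \<Longrightarrow> ?r" by (rule *)
      assume ?r
      then obtain n where n: "\<Phi> = map s (filter (\<lambda>k. k \<in> S) [0..<n])" by blast
      \<comment> \<open>All of \<open>S\<close> lies below \<open>m\<close>, so cutting later than
        \<open>m\<close> adds nothing.\<close>
      have "S \<inter> {..<max m n} = S \<inter> {..<m}" using m by auto
      then have "filter (\<lambda>k. k \<in> S) [0..<max m n] = filter (\<lambda>k. k \<in> S) [0..<m]"
        using sorted_list_of_set_below[OF True] by metis
      moreover have "[0..<max m n] = [0..<n] @ [n..<max m n]" by (metis le0 max.cobounded2 upt_add_eq_append le_add_diff_inverse)
      ultimately show ?l using n by (metis filter_append map_append prefixI)
    qed
    moreover have "filter_seq P \<Gamma> = Fin (map s (filter (\<lambda>k. k \<in> S) [0..<m]))"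
      using Inf True full by (simp add: S_def)
    ultimately show ?thesis unfolding iseg by (simp only: initial_segment.simps)
  next
    case False
    \<comment> \<open>With n = \<open>enumerate S k\<close>, every length occurs as a number of kept
      entries.\<close>
    have "\<exists>n. card (S \<inter> {..<n}) = k" for k
      using card_Int_lessThan_enumerate[OF False, of k] by blast
    note card_surj = this
    have "(\<exists>n. \<Phi> = map s (filter (\<lambda>k. k \<in> S) [0..<n])) \<longleftrightarrow>
        (\<exists>k. \<Phi> = map s (map (enumerate S) [0..<k]))"
      unfolding filter_upt_enumerate[OF False]
    proof (intro iffI; elim exE)
      fix k assume "\<Phi> = map s (map (enumerate S) [0..<k])"
      moreover obtain n where "card (S \<inter> {..<n}) = k"
        using card_surj by blast
      ultimately show "\<exists>n. \<Phi> = map s (map (enumerate S) [0..<card (S \<inter> {..<n})])" by blast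
    qed blast
    also have "\<dots> \<longleftrightarrow> \<Phi> = map (\<lambda>k. s (enumerate S k)) [0..<length \<Phi>]"
    proof (intro iffI; (elim exE)?)
      fix k assume "\<Phi> = map s (map (enumerate S) [0..<k])"
      moreover from this have "length \<Phi> = k" by simp
      ultimately show "\<Phi> = map (\<lambda>k. s (enumerate S k)) [0..<length \<Phi>]"
        by (simp add: comp_def)
    next
      assume "\<Phi> = map (\<lambda>k. s (enumerate S k)) [0..<length \<Phi>]"
      then show "\<exists>k. \<Phi> = map s (map (enumerate S) [0..<k])"
        by (intro exI[of _ "length \<Phi>"]) (simp only: map_map comp_def)
    qed
    finally have *: "(\<exists>n. \<Phi> = map s (filter (\<lambda>k. k \<in> S) [0..<n])) \<longleftrightarrow>
        \<Phi> = map (\<lambda>k. s (enumerate S k)) [0..<length \<Phi>]" .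
    have "filter_seq P \<Gamma> = Inf (\<lambda>k. s (enumerate S k))" using Inf False by (simp add: S_def)
    then show ?thesis unfolding iseg * by (simp only: initial_segment.simps)
  qed
qed

lemma initial_segment_map_filter_seq:
  "initial_segment \<Phi> (map_seq f (filter_seq P \<Gamma>)) \<longleftrightarrow>
     (\<exists>\<Psi>. initial_segment \<Psi> \<Gamma> \<and> \<Phi> = map f (filter P \<Psi>))"
  by (auto simp: initial_segment_map_seq initial_segment_filter_seq)

lemma in_set_seq_iff: "x \<in> set_seq \<Gamma> \<longleftrightarrow> (\<exists>\<Phi>. initial_segment \<Phi> \<Gamma> \<and> x \<in> set \<Phi>)"
proof (cases \<Gamma>)
  case (Fin xs)
  have "x \<in> set xs \<longleftrightarrow> (\<exists>\<Phi>. prefix \<Phi> xs \<and> x \<in> set \<Phi>)"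
    using set_mono_prefix[of _ xs] by blast
  with Fin show ?thesis by simp
next
  case (Inf s)
  have "x \<in> range s \<longleftrightarrow> (\<exists>\<Phi>. \<Phi> = map s [0..<length \<Phi>] \<and> x \<in> set \<Phi>)"
  proof
    assume "x \<in> range s"
    then obtain n where "x = s n" by blast
    then show "\<exists>\<Phi>. \<Phi> = map s [0..<length \<Phi>] \<and> x \<in> set \<Phi>"
      by (intro exI[of _ "map s [0..<Suc n]"]) simp
  next
    assume "\<exists>\<Phi>. \<Phi> = map s [0..<length \<Phi>] \<and> x \<in> set \<Phi>"
    then obtain \<Phi> where "\<Phi> = map s [0..<length \<Phi>]" "x \<in> set \<Phi>" by blast
    then have "x \<in> set (map s [0..<length \<Phi>])" by simp
    then show "x \<in> range s" by auto
  qed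
  with Inf show ?thesis by simp
qed

section \<open>Positions and legality\<close>

definition comp_pos :: "char \<Rightarrow> position \<Rightarrow> position" where
  "comp_pos i \<Phi> = map (\<lambda>(p, \<alpha>). (p, drop 2 \<alpha>)) (filter (\<lambda>(p, \<alpha>). prefix [i, CHR ''.''] \<alpha>) \<Phi>)"

definition thread_pos :: "(nat \<Rightarrow> bool) \<Rightarrow> position \<Rightarrow> position" where
  "thread_pos x \<Theta> =
     map (\<lambda>(p, \<alpha>). (p, tl (dropWhile (\<lambda>c. c \<noteq> CHR ''.'') \<alpha>)))
       (filter (\<lambda>(p, \<alpha>). \<exists>u \<beta>. bit_segment u x \<and> \<alpha> = u @ ''.'' @ \<beta>) \<Theta>)"

definition neg_pos :: "position \<Rightarrow> position" where
  "neg_pos = map (\<lambda>(p, \<alpha>). (opp p, \<alpha>))"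

lemma component_Fin [simp]: "component i (Fin \<Phi>) = Fin (comp_pos i \<Phi>)"
  and thread_Fin [simp]: "thread v (Fin \<Phi>) = Fin (thread_pos v \<Phi>)"
  and neg_run_Fin [simp]: "neg_run (Fin \<Phi>) = Fin (neg_pos \<Phi>)"
  by (simp_all add: component_def comp_pos_def thread_def thread_pos_def neg_run_def neg_pos_def)

lemma initial_segment_component:
  "initial_segment \<Phi> (component i \<Gamma>) \<longleftrightarrow> (\<exists>\<Psi>. initial_segment \<Psi> \<Gamma> \<and> \<Phi> = comp_pos i \<Psi>)"
  by (simp add: component_def comp_pos_def initial_segment_map_filter_seq)

lemma initial_segment_thread:
  "initial_segment \<Phi> (thread v \<Gamma>) \<longleftrightarrow> (\<exists>\<Psi>. initial_segment \<Psi> \<Gamma> \<and> \<Phi> = thread_pos v \<Psi>)"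
  by (simp add: thread_def thread_pos_def initial_segment_map_filter_seq)

lemma initial_segment_neg_run:
  "initial_segment \<Phi> (neg_run \<Gamma>) \<longleftrightarrow> (\<exists>\<Psi>. initial_segment \<Psi> \<Gamma> \<and> \<Phi> = neg_pos \<Psi>)"
  by (simp add: neg_run_def neg_pos_def initial_segment_map_seq)

lemma opp_opp [simp]: "opp (opp p) = p"
  by (cases p) auto

lemma neg_run_neg_run [simp]: "neg_run (neg_run \<Gamma>) = \<Gamma>"
  by (cases \<Gamma>) (auto simp: neg_run_def comp_def case_prod_beta)

lemma mem_Lr_neg [simp]: "\<Gamma> \<in> Lr (neg_cgame A) \<longleftrightarrow> neg_run \<Gamma> \<in> Lr A"
  by (auto simp: neg_cgame_def image_iff) (metis neg_run_neg_run)

text \<open>The clause of \<open>constant_game\<close> about legality, separated from the winner so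
  that it can be passed on through the game operations.\<close>

definition limit_closed :: "run set \<Rightarrow> bool" where
  "limit_closed L \<longleftrightarrow> (\<forall>\<Gamma>. \<Gamma> \<in> L \<longleftrightarrow> (\<forall>\<Phi>. initial_segment \<Phi> \<Gamma> \<longrightarrow> Fin \<Phi> \<in> L))"

lemma limit_closedI:
  assumes "\<And>\<Gamma> \<Phi>. \<Gamma> \<in> L \<Longrightarrow> initial_segment \<Phi> \<Gamma> \<Longrightarrow> Fin \<Phi> \<in> L"
    and "\<And>\<Gamma>. (\<And>\<Phi>. initial_segment \<Phi> \<Gamma> \<Longrightarrow> Fin \<Phi> \<in> L) \<Longrightarrow> \<Gamma> \<in> L"
  shows "limit_closed L"
  unfolding limit_closed_def
proof (rule allI, rule iffI)
  fix \<Gamma> assume "\<Gamma> \<in> L"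
  from assms(1)[OF this] show "\<forall>\<Phi>. initial_segment \<Phi> \<Gamma> \<longrightarrow> Fin \<Phi> \<in> L" by (intro allI impI)
next
  fix \<Gamma> assume "\<forall>\<Phi>. initial_segment \<Phi> \<Gamma> \<longrightarrow> Fin \<Phi> \<in> L"
  then show "\<Gamma> \<in> L" using assms(2)[of \<Gamma>] by metis
qed

lemma limit_closedD1:
  assumes "limit_closed L" "\<Gamma> \<in> L" "initial_segment \<Phi> \<Gamma>" shows "Fin \<Phi> \<in> L"
proof -
  have "\<forall>\<Phi>. initial_segment \<Phi> \<Gamma> \<longrightarrow> Fin \<Phi> \<in> L"
    using assms(1)[unfolded limit_closed_def, THEN spec, THEN iffD1, OF assms(2)] .
  then show ?thesis using assms(3) by metis
qed

lemma limit_closedD2: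
  assumes "limit_closed L" "\<And>\<Phi>. initial_segment \<Phi> \<Gamma> \<Longrightarrow> Fin \<Phi> \<in> L" shows "\<Gamma> \<in> L"
proof -
  have "\<forall>\<Phi>. initial_segment \<Phi> \<Gamma> \<longrightarrow> Fin \<Phi> \<in> L" using assms(2) by (intro allI impI)
  then show ?thesis by (rule assms(1)[unfolded limit_closed_def, THEN spec, THEN iffD2])
qed

lemma limit_closed_Int:
  assumes "limit_closed L" "limit_closed L'" shows "limit_closed (L \<inter> L')"
proof (rule limit_closedI)
  fix \<Gamma> \<Phi> assume *: "\<Gamma> \<in> L \<inter> L'" "initial_segment \<Phi> \<Gamma>"
  show "Fin \<Phi> \<in> L \<inter> L'"
    using limit_closedD1[OF assms(1) IntD1[OF *(1)] *(2)]
      limit_closedD1[OF assms(2) IntD2[OF *(1)] *(2)] by (rule IntI)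
next
  fix \<Gamma> assume *: "\<And>\<Phi>. initial_segment \<Phi> \<Gamma> \<Longrightarrow> Fin \<Phi> \<in> L \<inter> L'"
  show "\<Gamma> \<in> L \<inter> L'"
    using limit_closedD2[OF assms(1) IntD1[OF *]] limit_closedD2[OF assms(2) IntD2[OF *]]
    by (rule IntI)
qed

lemma limit_closed_INT:
  assumes "\<And>v. limit_closed (L v)" shows "limit_closed (\<Inter>v. L v)"
proof (rule limit_closedI)
  fix \<Gamma> \<Phi> assume *: "\<Gamma> \<in> (\<Inter>v. L v)" "initial_segment \<Phi> \<Gamma>"
  show "Fin \<Phi> \<in> (\<Inter>v. L v)"
    by (rule INT_I) (rule limit_closedD1[OF assms INT_D[OF *(1) UNIV_I] *(2)])
next
  fix \<Gamma> assume *: "\<And>\<Phi>. initial_segment \<Phi> \<Gamma> \<Longrightarrow> Fin \<Phi> \<in> (\<Inter>v. L v)"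
  show "\<Gamma> \<in> (\<Inter>v. L v)"
    by (rule INT_I) (rule limit_closedD2[OF assms INT_D[OF * UNIV_I]])
qed

text \<open>The first two hypotheses say that \<open>h\<close> extends the map \<open>g\<close> on
  positions continuously to all runs. Threads, components and the change of labels are all of this
  kind.\<close>

lemma limit_closed_vimage:
  assumes "\<And>\<Phi> \<Gamma>. initial_segment \<Phi> (h \<Gamma>) \<longleftrightarrow> (\<exists>\<Psi>. initial_segment \<Psi> \<Gamma> \<and> \<Phi> = g \<Psi>)"
    and "\<And>\<Psi>. h (Fin \<Psi>) = Fin (g \<Psi>)" and "limit_closed L"
  shows "limit_closed (h -` L)"
proof (rule limit_closedI; unfold vimage_eq assms(2))
  fix \<Gamma> \<Psi> assume *: "h \<Gamma> \<in> L" "initial_segment \<Psi> \<Gamma>"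
  then have "initial_segment (g \<Psi>) (h \<Gamma>)" using assms(1) by blast
  with * show "Fin (g \<Psi>) \<in> L" by (intro limit_closedD1[OF assms(3)])
next
  fix \<Gamma> assume *: "\<And>\<Psi>. initial_segment \<Psi> \<Gamma> \<Longrightarrow> Fin (g \<Psi>) \<in> L"
  show "h \<Gamma> \<in> L"
  proof (rule limit_closedD2[OF assms(3)])
    fix \<Phi> assume "initial_segment \<Phi> (h \<Gamma>)"
    then obtain \<Psi> where "initial_segment \<Psi> \<Gamma>" "\<Phi> = g \<Psi>" using assms(1) by blast
    with * show "Fin \<Phi> \<in> L" by metis
  qed
qed

lemma limit_closed_all_moves: "limit_closed {\<Gamma>. \<forall>x \<in> set_seq \<Gamma>. Q x}"
proof (rule limit_closedI; unfold mem_Collect_eq)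
  fix \<Gamma> \<Phi> assume "\<forall>x \<in> set_seq \<Gamma>. Q x" "initial_segment \<Phi> \<Gamma>"
  then show "\<forall>x \<in> set_seq (Fin \<Phi>). Q x" using in_set_seq_iff[of _ \<Gamma>] unfolding seq.set by blast
next
  fix \<Gamma> assume *: "\<And>\<Phi>. initial_segment \<Phi> \<Gamma> \<Longrightarrow> \<forall>x \<in> set_seq (Fin \<Phi>). Q x"
  show "\<forall>x \<in> set_seq \<Gamma>. Q x"
  proof
    fix x assume "x \<in> set_seq \<Gamma>"
    then obtain \<Phi> where "initial_segment \<Phi> \<Gamma>" "x \<in> set \<Phi>" using in_set_seq_iff[of _ \<Gamma>] by blast
    with *[of \<Phi>] show "Q x" by simp
  qed
qed

lemma limit_closed_neg: "limit_closed (Lr A) \<Longrightarrow> limit_closed (Lr (neg_cgame A))"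
proof -
  have "Lr (neg_cgame A) = neg_run -` Lr A" using mem_Lr_neg by blast
  then show "limit_closed (Lr A) \<Longrightarrow> ?thesis"
    using limit_closed_vimage[OF initial_segment_neg_run neg_run_Fin] by metis
qed

text \<open>Legality is imposed on each move relative to the position before it, which is already a
  condition on initial segments.\<close>

lemma limit_closed_tight: "limit_closed (Lr (tight_cgame A))"
proof (rule limit_closedI; unfold tight_cgame_def mk_cgame_def cgame.simps mem_Collect_eq)
  fix \<Gamma> \<Phi>
  assume *: "\<forall>\<Phi> p \<gamma>. initial_segment (\<Phi> @ [(p, \<gamma>)]) \<Gamma> \<longrightarrow> tight_legal_move A \<Phi> p \<gamma>"
    and "initial_segment \<Phi> \<Gamma>"
  then have "initial_segment \<Psi> \<Gamma>" if "initial_segment \<Psi> (Fin \<Phi>)" for \<Psi>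
    using initial_segment_prefix that by auto
  with * show "\<forall>\<Psi> p \<gamma>. initial_segment (\<Psi> @ [(p, \<gamma>)]) (Fin \<Phi>) \<longrightarrow> tight_legal_move A \<Psi> p \<gamma>"
    by blast
next
  fix \<Gamma>
  assume *: "\<And>\<Phi>. initial_segment \<Phi> \<Gamma> \<Longrightarrow> \<forall>\<Psi> p \<gamma>. initial_segment (\<Psi> @ [(p, \<gamma>)]) (Fin \<Phi>) \<longrightarrow>
    tight_legal_move A \<Psi> p \<gamma>"
  show "\<forall>\<Phi> p \<gamma>. initial_segment (\<Phi> @ [(p, \<gamma>)]) \<Gamma> \<longrightarrow> tight_legal_move A \<Phi> p \<gamma>"
    using * by (intro allI impI) (meson initial_segment.simps(1) prefix_order.refl)
qed

text \<open>The form of an intersection of inverse images is the one to which the closure lemmas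
  apply.\<close>

lemma Lr_loose:
  "Lr (loose_cgame A) =
     {\<Gamma>. \<forall>x \<in> set_seq \<Gamma>. \<exists>w \<alpha>. bitstring w \<and> snd x = w @ ''.'' @ \<alpha>} \<inter> (\<Inter>v. thread v -` Lr A)"
  by (fastforce simp: loose_cgame_def mk_cgame_def)

lemma limit_closed_loose: "limit_closed (Lr A) \<Longrightarrow> limit_closed (Lr (loose_cgame A))"
  unfolding Lr_loose
  by (intro limit_closed_Int limit_closed_all_moves limit_closed_INT
      limit_closed_vimage[OF initial_segment_thread thread_Fin])

lemma Lr_pdisj:
  "Lr (pdisj_cgame A B) =
     {\<Gamma>. \<forall>x \<in> set_seq \<Gamma>. \<exists>\<alpha>. snd x = ''1.'' @ \<alpha> \<or> snd x = ''2.'' @ \<alpha>} \<inter>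
     (component (CHR ''1'') -` Lr A \<inter> component (CHR ''2'') -` Lr B)"
  by (fastforce simp: pdisj_cgame_def mk_cgame_def)

lemma limit_closed_pdisj:
  "limit_closed (Lr A) \<Longrightarrow> limit_closed (Lr B) \<Longrightarrow> limit_closed (Lr (pdisj_cgame A B))"
  unfolding Lr_pdisj
  by (intro limit_closed_Int limit_closed_all_moves
      limit_closed_vimage[OF initial_segment_component component_Fin])

lemma constant_game_limit_closed: "constant_game A \<Longrightarrow> limit_closed (Lr A)"
  unfolding constant_game_def limit_closed_def by (elim conjE)

section \<open>Bitstrings and threads\<close>

text \<open>With the length as an argument, lying on \<open>v\<close> becomes the equation
  \<open>u = bits v (length u)\<close>.\<close>

definition bits :: "(nat \<Rightarrow> bool) \<Rightarrow> nat \<Rightarrow> string" where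
  "bits v n = map (\<lambda>i. if v i then CHR ''1'' else CHR ''0'') [0..<n]"

lemma length_bits [simp]: "length (bits v n) = n"
  by (simp add: bits_def)

lemma bit_segment_iff: "bit_segment u v \<longleftrightarrow> (\<exists>n. u = bits v n)"
  unfolding bit_segment_def bits_def[symmetric] by (metis length_bits)

lemma bit_segment_eq: "bit_segment u v \<Longrightarrow> u = bits v (length u)"
  by (auto simp: bit_segment_iff)

lemma bit_segment_bits [simp]: "bit_segment (bits v n) v"
  by (auto simp: bit_segment_iff)

lemma bit_segment_Nil [simp]: "bit_segment [] v"
  by (simp add: bit_segment_def)

lemma bitstring_bits [simp]: "bitstring (bits v n)"
  by (auto simp: bitstring_def bits_def)

lemma bit_segment_bitstring: "bit_segment u v \<Longrightarrow> bitstring u"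
  by (auto simp: bit_segment_iff)

lemma prefix_bits: "m \<le> n \<Longrightarrow> prefix (bits v m) (bits v n)"
proof -
  assume "m \<le> n"
  then obtain k where "[0..<n] = [0..<m] @ [m..<m + k]"
    using upt_add_eq_append[of 0 m] by (auto simp: le_iff_add)
  then show ?thesis by (simp add: bits_def)
qed

lemma bit_segment_prefix: "prefix w u \<Longrightarrow> bit_segment u v \<Longrightarrow> bit_segment w v"
proof -
  assume w: "prefix w u" and u: "bit_segment u v"
  have "prefix (bits v (length w)) u"
    using bit_segment_eq[OF u] prefix_bits prefix_length_le[OF w] by metis
  with w have "w = bits v (length w)"
    by (metis length_bits order_refl prefix_length_prefix prefix_order.antisym)
  then show ?thesis by (metis bit_segment_bits)
qed

lemma bit_segments_comparable:
  "bit_segment u v \<Longrightarrow> bit_segment w v \<Longrightarrow> length u \<le> length w \<Longrightarrow> prefix u w"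
  by (metis bit_segment_eq prefix_bits)

lemma bitstring_append [simp]: "bitstring (u @ w) \<longleftrightarrow> bitstring u \<and> bitstring w"
  by (auto simp: bitstring_def)

lemma bitstring_Cons [simp]:
  "bitstring (c # w) \<longleftrightarrow> (c = CHR ''0'' \<or> c = CHR ''1'') \<and> bitstring w"
  by (auto simp: bitstring_def)

lemma bitstring_Nil [simp]: "bitstring []"
  by (simp add: bitstring_def)

lemma bitstring_replicate [simp]: "bitstring (replicate n CHR ''0'')"
  by (auto simp: bitstring_def)

lemma ex_bit_segment: "bitstring w \<Longrightarrow> \<exists>v. bit_segment w v"
proof -
  assume w: "bitstring w"
  have "w = bits (\<lambda>i. w ! i = CHR ''1'') (length w)"
  proof (rule nth_equalityI)
    fix i assume "i < length w"
    then have "w ! i \<in> {CHR ''0'', CHR ''1''}" using w nth_mem[of i w] unfolding bitstring_def by blast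
    with \<open>i < length w\<close> show "w ! i = bits (\<lambda>i. w ! i = CHR ''1'') (length w) ! i"
      by (auto simp: bits_def)
  qed simp
  then show ?thesis by (metis bit_segment_bits)
qed

lemma bitstring_no_dot: "bitstring w \<Longrightarrow> CHR ''.'' \<notin> set w"
  by (auto simp: bitstring_def)

lemma append_delimiter_inject:
  "c \<notin> set u \<Longrightarrow> c \<notin> set w \<Longrightarrow> u @ c # \<alpha> = w @ c # \<beta> \<longleftrightarrow> u = w \<and> \<alpha> = \<beta>"
proof (induction u arbitrary: w)
  case Nil
  then show ?case by (cases w) auto
next
  case (Cons a u)
  then show ?case by (cases w) auto
qed

lemma dot_inject:
  "bitstring u \<Longrightarrow> bitstring w \<Longrightarrow> u @ CHR ''.'' # \<alpha> = w @ CHR ''.'' # \<beta> \<longleftrightarrow> u = w \<and> \<alpha> = \<beta>"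
  by (simp add: append_delimiter_inject bitstring_no_dot)

lemma dot_neq_colon:
  "bitstring w \<Longrightarrow> u @ CHR ''.'' # \<alpha> \<noteq> w @ '':''"
proof
  assume "bitstring w" and eq: "u @ CHR ''.'' # \<alpha> = w @ '':''"
  have "CHR ''.'' \<in> set (w @ '':'')" unfolding eq[symmetric] by simp
  with \<open>bitstring w\<close> show False by (auto simp: bitstring_def)
qed

section \<open>Threads of positions\<close>

lemma thread_pos_Nil [simp]: "thread_pos v [] = []"
  and comp_pos_Nil [simp]: "comp_pos i [] = []"
  and neg_pos_Nil [simp]: "neg_pos [] = []"
  by (simp_all add: thread_pos_def comp_pos_def neg_pos_def)

lemma thread_pos_append: "thread_pos v (\<Phi> @ \<Psi>) = thread_pos v \<Phi> @ thread_pos v \<Psi>"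
  and comp_pos_append: "comp_pos i (\<Phi> @ \<Psi>) = comp_pos i \<Phi> @ comp_pos i \<Psi>"
  and neg_pos_append: "neg_pos (\<Phi> @ \<Psi>) = neg_pos \<Phi> @ neg_pos \<Psi>"
  by (simp_all add: thread_pos_def comp_pos_def neg_pos_def)

lemma thread_pos_dot:
  assumes "bitstring w"
  shows "thread_pos v [(p, w @ CHR ''.'' # \<alpha>)] = (if bit_segment w v then [(p, \<alpha>)] else [])"
proof -
  have "(\<exists>u \<beta>. bit_segment u v \<and> w @ CHR ''.'' # \<alpha> = u @ CHR ''.'' # \<beta>) \<longleftrightarrow> bit_segment w v"
    using dot_inject[OF assms bit_segment_bitstring] by blast
  moreover have "dropWhile (\<lambda>c. c \<noteq> CHR ''.'') (w @ CHR ''.'' # \<alpha>) = CHR ''.'' # \<alpha>"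
    using bitstring_no_dot[OF assms] by (subst dropWhile_append2) auto
  ultimately show ?thesis by (simp add: thread_pos_def)
qed

lemma thread_pos_Cons_dot:
  "bitstring w \<Longrightarrow> thread_pos v ((p, w @ CHR ''.'' # \<alpha>) # \<Phi>) =
    (if bit_segment w v then (p, \<alpha>) # thread_pos v \<Phi> else thread_pos v \<Phi>)"
  using thread_pos_append[of v "[(p, w @ CHR ''.'' # \<alpha>)]" \<Phi>] by (simp add: thread_pos_dot)

lemma thread_pos_colon: "bitstring w \<Longrightarrow> thread_pos v [(p, w @ '':'')] = []"
  using dot_neq_colon[of w] by (auto simp: thread_pos_def) metis

text \<open>Two incomparable strings never lie on the same infinite bitstring, so a batch of copies
  of one move enters each thread at most once. This is why both the leaves and their codes have to
  form antichains.\<close>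

lemma thread_pos_antichain:
  assumes "distinct ws" "\<forall>w \<in> set ws. bitstring w"
    and "\<And>w w'. w \<in> set ws \<Longrightarrow> w' \<in> set ws \<Longrightarrow> prefix w w' \<Longrightarrow> w = w'"
  shows "thread_pos v (map (\<lambda>w. (p, w @ CHR ''.'' # \<alpha>)) ws) =
    (if \<exists>w \<in> set ws. bit_segment w v then [(p, \<alpha>)] else [])"
  using assms
proof (induction ws)
  case (Cons w ws)
  have IH: "thread_pos v (map (\<lambda>w. (p, w @ CHR ''.'' # \<alpha>)) ws) =
    (if \<exists>w \<in> set ws. bit_segment w v then [(p, \<alpha>)] else [])"
    using Cons.prems by (intro Cons.IH) auto
  have "\<not> (bit_segment w v \<and> bit_segment w' v)" if w': "w' \<in> set ws" for w'
  proof
    assume "bit_segment w v \<and> bit_segment w' v"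
    then have "prefix w w' \<or> prefix w' w" using bit_segments_comparable by (meson nle_le)
    then have "w = w'" using Cons.prems(3)[of w w'] Cons.prems(3)[of w' w] w' by auto
    with w' Cons.prems(1) show False by simp
  qed
  then show ?case using Cons.prems(2) IH by (auto simp: thread_pos_Cons_dot)
qed simp

section \<open>Extending legal positions\<close>

text \<open>With the labels switched this is a position of the antecedent itself rather than of its
  negation. The machine appears in it as \<open>Bot\<close>.\<close>

definition ante :: "position \<Rightarrow> position" where
  "ante \<Phi> = neg_pos (comp_pos (CHR ''1'') \<Phi>)"

definition cons :: "position \<Rightarrow> position" where
  "cons \<Phi> = comp_pos (CHR ''2'') \<Phi>"

lemma ante_simps [simp]:
  "ante [] = []" "ante (\<Phi> @ \<Psi>) = ante \<Phi> @ ante \<Psi>"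
  "ante ((p, CHR ''1'' # CHR ''.'' # \<alpha>) # \<Phi>) = (opp p, \<alpha>) # ante \<Phi>"
  "ante ((p, CHR ''2'' # \<beta>) # \<Phi>) = ante \<Phi>"
  by (simp_all add: ante_def neg_pos_def comp_pos_def)

lemma cons_simps [simp]:
  "cons [] = []" "cons (\<Phi> @ \<Psi>) = cons \<Phi> @ cons \<Psi>"
  "cons ((p, CHR ''2'' # CHR ''.'' # \<alpha>) # \<Phi>) = (p, \<alpha>) # cons \<Phi>"
  "cons ((p, CHR ''1'' # \<beta>) # \<Phi>) = cons \<Phi>"
  by (simp_all add: cons_def comp_pos_def)

definition imp_cgame :: "cgame \<Rightarrow> cgame \<Rightarrow> cgame" where
  "imp_cgame X Y = pdisj_cgame (neg_cgame X) Y"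

lemma legal_imp:
  "Fin \<Phi> \<in> Lr (imp_cgame X Y) \<longleftrightarrow>
    (\<forall>x \<in> set \<Phi>. \<exists>\<alpha>. snd x = ''1.'' @ \<alpha> \<or> snd x = ''2.'' @ \<alpha>) \<and>
    Fin (ante \<Phi>) \<in> Lr X \<and> Fin (cons \<Phi>) \<in> Lr Y"
  by (simp add: imp_cgame_def Lr_pdisj ante_def cons_def)

text \<open>Threads that receive nothing from \<open>M\<close> keep their old legality; only the
  others need a check.\<close>

lemma legal_loose_append:
  assumes "Fin L \<in> Lr (loose_cgame A)" "\<forall>x \<in> set M. \<exists>w \<alpha>. bitstring w \<and> snd x = w @ ''.'' @ \<alpha>"
    and "\<And>v. thread_pos v M \<noteq> [] \<Longrightarrow> Fin (thread_pos v L @ thread_pos v M) \<in> Lr A"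
  shows "Fin (L @ M) \<in> Lr (loose_cgame A)"
proof -
  have "Fin (thread_pos v L @ thread_pos v M) \<in> Lr A" for v
    using assms(1) assms(3)[of v] by (cases "thread_pos v M = []") (auto simp: Lr_loose)
  then show ?thesis using assms(1,2) by (auto simp: Lr_loose thread_pos_append)
qed

lemma legal_loose_snocD:
  assumes "Fin (L @ [(p, \<gamma>)]) \<in> Lr (loose_cgame A)"
  obtains w \<alpha> where "bitstring w" "\<gamma> = w @ CHR ''.'' # \<alpha>"
    "\<And>v. bit_segment w v \<Longrightarrow> Fin (thread_pos v L @ [(p, \<alpha>)]) \<in> Lr A"
proof -
  obtain w \<alpha> where w: "bitstring w" "\<gamma> = w @ CHR ''.'' # \<alpha>"
    using assms by (auto simp: Lr_loose)
  moreover have "Fin (thread_pos v (L @ [(p, \<gamma>)])) \<in> Lr A" for v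
    using assms by (auto simp: Lr_loose)
  ultimately show thesis using that[of w \<alpha>] by (simp add: thread_pos_append thread_pos_dot)
    (metis (full_types))
qed

lemma legal_tight_snoc:
  "Fin (T @ [(p, \<gamma>)]) \<in> Lr (tight_cgame A) \<longleftrightarrow>
    Fin T \<in> Lr (tight_cgame A) \<and> tight_legal_move A T p \<gamma>"
  by (auto simp: tight_cgame_def mk_cgame_def)

section \<open>Nodes and leaves of tight positions\<close>

lemma bt_node_iff:
  "bt_node \<Phi> w \<longleftrightarrow> w = [] \<or> bitstring w \<and> butlast w @ '':'' \<in> snd ` set \<Phi>"
  by (cases w rule: rev_cases) (auto simp: bt_node_def)

lemma bt_node_snoc_dot:
  "bitstring w \<Longrightarrow> bt_node (T @ [(p, w @ CHR ''.'' # \<alpha>)]) x \<longleftrightarrow> bt_node T x"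
proof -
  have "butlast x @ '':'' \<in> snd ` set (T @ [(p, w @ CHR ''.'' # \<alpha>)]) \<longleftrightarrow>
      butlast x @ '':'' \<in> snd ` set T" if "bitstring x"
    using dot_neq_colon[of "butlast x" w \<alpha>] that unfolding set_append image_Un
    by (cases x rule: rev_cases) force+
  then show ?thesis unfolding bt_node_iff by (cases "bitstring x") simp_all
qed

lemma bt_node_snoc_colon:
  "bitstring w \<Longrightarrow> bt_node (T @ [(p, w @ '':'')]) x \<longleftrightarrow>
     bt_node T x \<or> x = w @ ''0'' \<or> x = w @ ''1''"
  by (cases x rule: rev_cases) (auto simp: bt_node_iff)

lemma bt_node_append_dot:
  "\<forall>w \<in> set ws. bitstring w \<Longrightarrow>
    bt_node (T @ map (\<lambda>w. (p, w @ CHR ''.'' # \<alpha>)) ws) x \<longleftrightarrow> bt_node T x"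
proof (induction ws arbitrary: T)
  case (Cons w ws)
  then have "bt_node ((T @ [(p, w @ CHR ''.'' # \<alpha>)]) @ map (\<lambda>w. (p, w @ CHR ''.'' # \<alpha>)) ws) x
      \<longleftrightarrow> bt_node T x" by (subst Cons.IH) (auto simp: bt_node_snoc_dot)
  then show ?case by simp
qed simp

lemma bt_leaf_append_dot:
  "\<forall>w \<in> set ws. bitstring w \<Longrightarrow>
    bt_leaf (T @ map (\<lambda>w. (p, w @ CHR ''.'' # \<alpha>)) ws) x \<longleftrightarrow> bt_leaf T x"
  by (simp add: bt_leaf_def bt_node_append_dot)

text \<open>Each copy is judged at a position that already contains the previous copies. These do
  not disturb it: dotted moves create no nodes, and by incomparability none of them lies on a thread
  through the next address.\<close>

lemma legal_tight_append:
  assumes "Fin T \<in> Lr (tight_cgame A)" "\<forall>w \<in> set ws. bitstring w \<and> bt_node T w" "distinct ws"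
    and "\<And>w w'. w \<in> set ws \<Longrightarrow> w' \<in> set ws \<Longrightarrow> prefix w w' \<Longrightarrow> w = w'"
    and "\<And>w v. w \<in> set ws \<Longrightarrow> bit_segment w v \<Longrightarrow> Fin (thread_pos v T @ [(p, \<alpha>)]) \<in> Lr A"
  shows "Fin (T @ map (\<lambda>w. (p, w @ CHR ''.'' # \<alpha>)) ws) \<in> Lr (tight_cgame A)"
  using assms
proof (induction ws rule: rev_induct)
  case (snoc w ws)
  let ?T = "T @ map (\<lambda>w. (p, w @ CHR ''.'' # \<alpha>)) ws"
  have "Fin ?T \<in> Lr (tight_cgame A)" using snoc.prems by (intro snoc.IH) auto
  moreover have "tight_legal_move A ?T p (w @ CHR ''.'' # \<alpha>)"
  proof -
    have "Fin (thread_pos v ?T @ [(p, \<alpha>)]) \<in> Lr A" if v: "bit_segment w v" for v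
    proof -
      have "\<not> bit_segment w' v" if w': "w' \<in> set ws" for w'
      proof
        assume "bit_segment w' v"
        with v have "prefix w w' \<or> prefix w' w" using bit_segments_comparable by (meson nle_le)
        then have "w = w'" using snoc.prems(4)[of w w'] snoc.prems(4)[of w' w] w' by auto
        with w' snoc.prems(3) show False by simp
      qed
      moreover have "thread_pos v (map (\<lambda>w. (p, w @ CHR ''.'' # \<alpha>)) ws) =
          (if \<exists>w \<in> set ws. bit_segment w v then [(p, \<alpha>)] else [])"
        using snoc.prems by (intro thread_pos_antichain) auto
      ultimately have "thread_pos v ?T = thread_pos v T" by (simp add: thread_pos_append)
      then show ?thesis using snoc.prems(5)[of w v] v by simp
    qed
    then show ?thesis
      unfolding tight_legal_move_def using snoc.prems(2) by (auto simp: bt_node_append_dot)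
  qed
  ultimately show ?case using legal_tight_snoc[of ?T] by simp
qed simp

section \<open>Winning in the limit\<close>

lemma prefix_thread_ante: "prefix \<Phi> \<Psi> \<Longrightarrow> prefix (thread_pos v (ante \<Phi>)) (thread_pos v (ante \<Psi>))"
  and prefix_thread_cons: "prefix \<Phi> \<Psi> \<Longrightarrow> prefix (thread_pos v (cons \<Phi>)) (thread_pos v (cons \<Psi>))"
  by (auto simp: prefix_def thread_pos_append)

lemma initial_segment_thread_ante:
  "initial_segment \<Phi> (thread v (neg_run (component (CHR ''1'') \<Gamma>))) \<longleftrightarrow>
    (\<exists>\<Psi>. initial_segment \<Psi> \<Gamma> \<and> \<Phi> = thread_pos v (ante \<Psi>))"
  unfolding ante_def initial_segment_thread initial_segment_neg_run initial_segment_component by blast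

lemma initial_segment_thread_cons:
  "initial_segment \<Phi> (thread v (component (CHR ''2'') \<Gamma>)) \<longleftrightarrow>
    (\<exists>\<Psi>. initial_segment \<Psi> \<Gamma> \<and> \<Phi> = thread_pos v (cons \<Psi>))"
  unfolding cons_def initial_segment_thread initial_segment_component by blast

text \<open>The \<open>F k\<close> will be the positions at which the machine rests. A finite run is
  included, with \<open>F\<close> eventually constant.\<close>

definition approximates :: "(nat \<Rightarrow> position) \<Rightarrow> run \<Rightarrow> bool" where
  "approximates F \<Gamma> \<longleftrightarrow> (\<forall>\<Phi>. initial_segment \<Phi> \<Gamma> \<longleftrightarrow> (\<exists>k. prefix \<Phi> (F k)))"

text \<open>Comparing at the \<open>F k\<close> suffices: an initial segment of either thread lies
  below the thread of some \<open>F k\<close>, and there the two agree. In between, while a reply is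
  being given, they may differ.\<close>

lemma threads_eq_in_limit:
  assumes F: "approximates F \<Gamma>"
    and eq: "\<And>k. thread_pos v' (ante (F k)) = thread_pos v (cons (F k))"
  shows "thread v' (neg_run (component (CHR ''1'') \<Gamma>)) = thread v (component (CHR ''2'') \<Gamma>)"
proof (rule initial_segment_inject)
  have iseg: "initial_segment (F k) \<Gamma>" for k
    using F unfolding approximates_def by blast
  fix \<Phi>
  have "initial_segment \<Phi> (thread v' (neg_run (component (CHR ''1'') \<Gamma>))) \<longleftrightarrow>
      (\<exists>k. prefix \<Phi> (thread_pos v' (ante (F k))))"
  proof
    assume "initial_segment \<Phi> (thread v' (neg_run (component (CHR ''1'') \<Gamma>)))"
    then obtain \<Psi> where "initial_segment \<Psi> \<Gamma>" "\<Phi> = thread_pos v' (ante \<Psi>)"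
      unfolding initial_segment_thread_ante by blast
    then show "\<exists>k. prefix \<Phi> (thread_pos v' (ante (F k)))"
      using F prefix_thread_ante unfolding approximates_def by blast
  next
    assume "\<exists>k. prefix \<Phi> (thread_pos v' (ante (F k)))"
    then obtain k where "prefix \<Phi> (thread_pos v' (ante (F k)))" ..
    moreover have "initial_segment (thread_pos v' (ante (F k)))
        (thread v' (neg_run (component (CHR ''1'') \<Gamma>)))"
      unfolding initial_segment_thread_ante using iseg by blast
    ultimately show "initial_segment \<Phi> (thread v' (neg_run (component (CHR ''1'') \<Gamma>)))"
      using initial_segment_prefix by blast
  qed
  moreover have "initial_segment \<Phi> (thread v (component (CHR ''2'') \<Gamma>)) \<longleftrightarrow>
      (\<exists>k. prefix \<Phi> (thread_pos v (cons (F k))))"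
  proof
    assume "initial_segment \<Phi> (thread v (component (CHR ''2'') \<Gamma>))"
    then obtain \<Psi> where "initial_segment \<Psi> \<Gamma>" "\<Phi> = thread_pos v (cons \<Psi>)"
      unfolding initial_segment_thread_cons by blast
    then show "\<exists>k. prefix \<Phi> (thread_pos v (cons (F k)))"
      using F prefix_thread_cons unfolding approximates_def by blast
  next
    assume "\<exists>k. prefix \<Phi> (thread_pos v (cons (F k)))"
    then obtain k where "prefix \<Phi> (thread_pos v (cons (F k)))" ..
    moreover have "initial_segment (thread_pos v (cons (F k))) (thread v (component (CHR ''2'') \<Gamma>))"
      unfolding initial_segment_thread_cons using iseg by blast
    ultimately show "initial_segment \<Phi> (thread v (component (CHR ''2'') \<Gamma>))"
      using initial_segment_prefix by blast
  qed
  ultimately show "initial_segment \<Phi> (thread v' (neg_run (component (CHR ''1'') \<Gamma>))) \<longleftrightarrow>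
      initial_segment \<Phi> (thread v (component (CHR ''2'') \<Gamma>))"
    unfolding eq by (rule trans[OF _ sym])
qed

text \<open>On legal runs both recurrences share this winning condition, so one argument about the
  limit serves both directions.\<close>

definition branching_winner :: "cgame \<Rightarrow> cgame \<Rightarrow> bool" where
  "branching_winner A X \<longleftrightarrow>
    (\<forall>\<Gamma> \<in> Lr X. Wn X \<Gamma> = Top \<longleftrightarrow> (\<forall>v. Wn A (thread v \<Gamma>) = Top))"

lemma branching_winner_tight: "branching_winner A (tight_cgame A)"
  and branching_winner_loose: "branching_winner A (loose_cgame A)"
  by (auto simp: branching_winner_def tight_cgame_def loose_cgame_def mk_cgame_def)

text \<open>If every antecedent thread is won by \<open>Top\<close>, then so is each consequent
  thread, being equal to one of them; otherwise the negated antecedent is won. For the equality to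
  survive the limit, \<open>v'\<close> must not depend on \<open>k\<close>.\<close>

lemma imp_won:
  assumes closed: "limit_closed (Lr X)" "limit_closed (Lr Y)"
    and winner: "branching_winner A X" "branching_winner A Y"
    and F: "approximates F \<Gamma>" "\<And>k. Fin (F k) \<in> Lr (imp_cgame X Y)"
    and eq: "\<And>v. \<exists>v'. \<forall>k. thread_pos v' (ante (F k)) = thread_pos v (cons (F k))"
  shows "Wn (imp_cgame X Y) \<Gamma> = Top"
proof -
  let ?\<Gamma>1 = "component (CHR ''1'') \<Gamma>" and ?\<Gamma>2 = "component (CHR ''2'') \<Gamma>"
  have imp_closed: "limit_closed (Lr (imp_cgame X Y))"
    unfolding imp_cgame_def by (intro limit_closed_pdisj limit_closed_neg closed)
  have legal: "\<Gamma> \<in> Lr (imp_cgame X Y)"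
  proof (rule limit_closedD2[OF imp_closed])
    fix \<Phi> assume "initial_segment \<Phi> \<Gamma>"
    then obtain k where "prefix \<Phi> (F k)" using F(1) unfolding approximates_def by blast
    then show "Fin \<Phi> \<in> Lr (imp_cgame X Y)" using limit_closedD1[OF imp_closed F(2)] by simp
  qed
  then have parts: "neg_run ?\<Gamma>1 \<in> Lr X" "?\<Gamma>2 \<in> Lr Y"
    by (auto simp: imp_cgame_def Lr_pdisj)
  have "Wn (neg_cgame X) ?\<Gamma>1 = Top \<or> Wn Y ?\<Gamma>2 = Top"
  proof (cases "Wn X (neg_run ?\<Gamma>1) = Top")
    case True
    then have won: "Wn A (thread v (neg_run ?\<Gamma>1)) = Top" for v
      using winner(1) parts(1) by (auto simp: branching_winner_def)
    have "Wn A (thread v ?\<Gamma>2) = Top" for v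
      using eq[of v] threads_eq_in_limit[OF F(1)] won by metis
    then show ?thesis using winner(2) parts(2) by (auto simp: branching_winner_def)
  next
    case False
    then have "Wn X (neg_run ?\<Gamma>1) = Bot" using player.exhaust by metis
    then show ?thesis by (simp add: neg_cgame_def)
  qed
  with legal show ?thesis by (simp add: imp_cgame_def pdisj_cgame_def mk_cgame_def)
qed

lemma imp_closed: "limit_closed (Lr X) \<Longrightarrow> limit_closed (Lr Y) \<Longrightarrow> limit_closed (Lr (imp_cgame X Y))"
  unfolding imp_cgame_def by (intro limit_closed_pdisj limit_closed_neg)

lemma constant_game_Nil: "constant_game A \<Longrightarrow> Fin [] \<in> Lr A"
  unfolding constant_game_def by (elim conjE)

lemma imp_move:
  assumes "Fin (\<Phi> @ [(p, m)]) \<in> Lr (imp_cgame X Y)"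
  obtains g where "m = CHR ''1'' # CHR ''.'' # g" | g where "m = CHR ''2'' # CHR ''.'' # g"
  using assms by (auto simp: legal_imp)

lemma bt_node_tail:
  "bt_node (T @ map (\<lambda>c. (p, c @ '':'')) cs) x \<longleftrightarrow>
    bt_node T x \<or> x \<noteq> [] \<and> bitstring x \<and> butlast x \<in> set cs"
  by (auto simp: bt_node_iff image_Un image_image)

section \<open>From tight to loose: replicating whole levels\<close>

text \<open>The order is that of a binary counter starting at zero, which is the order in which the
  machine produces a level.\<close>

primrec words :: "nat \<Rightarrow> string list" where
  "words 0 = [[]]"
| "words (Suc n) = map ((#) CHR ''0'') (words n) @ map ((#) CHR ''1'') (words n)"

lemma set_words: "set (words n) = {w. bitstring w \<and> length w = n}"
proof (induction n)
  case (Suc n)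
  have "w \<in> set (words (Suc n)) \<longleftrightarrow> bitstring w \<and> length w = Suc n" for w
    using Suc by (cases w) auto
  then show ?case by blast
qed auto

lemma distinct_words: "distinct (words n)"
  by (induction n) (auto simp: distinct_map)

definition full_tree :: "position \<Rightarrow> nat \<Rightarrow> bool" where
  "full_tree T n \<longleftrightarrow> (\<forall>x. bt_node T x \<longleftrightarrow> bitstring x \<and> length x \<le> n)"

lemma full_tree_level:
  assumes "full_tree T n" "set cs = set (words n)"
  shows "full_tree (T @ map (\<lambda>c. (p, c @ '':'')) cs) (Suc n)"
  unfolding full_tree_def
proof
  fix x
  show "bt_node (T @ map (\<lambda>c. (p, c @ '':'')) cs) x \<longleftrightarrow> bitstring x \<and> length x \<le> Suc n"
    using assms by (cases x rule: rev_cases) (auto simp: full_tree_def bt_node_tail set_words)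
qed

text \<open>Replicating a word of length \<open>n\<close> only adds nodes of length
  \<open>n + 1\<close> below that word, so the other words of the level stay leaves until their
  turn.\<close>

lemma legal_level:
  assumes "full_tree T n" "Fin T \<in> Lr (tight_cgame A)" "distinct cs" "set cs \<subseteq> set (words n)"
  shows "Fin (T @ map (\<lambda>c. (Bot, c @ '':'')) cs) \<in> Lr (tight_cgame A)"
  using assms(3,4)
proof (induction cs rule: rev_induct)
  case (snoc c cs)
  let ?T = "T @ map (\<lambda>c. (Bot, c @ '':'')) cs"
  have c: "bitstring c" "length c = n" "c \<notin> set cs" using snoc.prems by (auto simp: set_words)
  have len: "length y = n" if "y \<in> set cs" for y using snoc.prems that by (auto simp: set_words)
  have node: "bt_node ?T c" using assms(1) c by (simp add: bt_node_tail full_tree_def)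
  have leaf: "\<not> bt_node ?T x" if ext: "strict_prefix c x" for x
  proof
    assume x: "bt_node ?T x"
    obtain z zs where "x = c @ z # zs" by (rule strict_prefixE'[OF ext])
    then obtain ys where ys: "x = c @ ys" "ys \<noteq> []" by blast
    then have "\<not> bt_node T x" using assms(1) c by (cases ys) (auto simp: full_tree_def)
    then have bl: "butlast x \<in> set cs" using x by (simp add: bt_node_tail)
    then have "length (butlast x) = n" by (rule len)
    with ys c have "length ys = 1" by (cases ys) auto
    with ys have "butlast x = c" by (cases ys) (auto simp: butlast_append)
    with bl c show False by simp
  qed
  then have "tight_legal_move A ?T Bot (c @ '':'')"
    using c node unfolding tight_legal_move_def bt_leaf_def by blast
  then show ?case using snoc legal_tight_snoc[of ?T] by simp
qed (use assms(2) in simp)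

lemma thread_pos_level:
  "\<forall>c \<in> set cs. bitstring c \<Longrightarrow> thread_pos v (map (\<lambda>c. (p, c @ '':'')) cs) = []"
proof (induction cs)
  case (Cons c cs)
  then show ?case
    using thread_pos_append[of v "[(p, c @ '':'')]"] thread_pos_colon[of c v p] by simp
qed simp

primrec replications :: "nat \<Rightarrow> nat \<Rightarrow> string list" where
  "replications n 0 = []"
| "replications n (Suc k) = words n @ replications (Suc n) k"

lemma bitstring_replications: "c \<in> set (replications n k) \<Longrightarrow> bitstring c"
  by (induction k arbitrary: n) (auto simp: set_words)

lemma replicate_levels:
  assumes "full_tree T n" "Fin T \<in> Lr (tight_cgame A)"
  shows "full_tree (T @ map (\<lambda>c. (Bot, c @ '':'')) (replications n k)) (n + k) \<and>
    Fin (T @ map (\<lambda>c. (Bot, c @ '':'')) (replications n k)) \<in> Lr (tight_cgame A)"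
  using assms
proof (induction k arbitrary: n T)
  case (Suc k)
  let ?T = "T @ map (\<lambda>c. (Bot, c @ '':'')) (words n)"
  have "full_tree ?T (Suc n)" "Fin ?T \<in> Lr (tight_cgame A)"
    using Suc.prems distinct_words by (auto intro!: full_tree_level legal_level)
  from Suc.IH[OF this] show ?case by simp
qed simp

text \<open>The number \<open>n\<close> is the depth of the tree and the content of the machine's
  unary counter.\<close>

definition tl_inv :: "cgame \<Rightarrow> nat \<Rightarrow> position \<Rightarrow> bool" where
  "tl_inv A n \<Phi> \<longleftrightarrow> Fin \<Phi> \<in> Lr (imp_cgame (tight_cgame A) (loose_cgame A)) \<and>
     full_tree (ante \<Phi>) n \<and> (\<forall>v. thread_pos v (ante \<Phi>) = thread_pos v (cons \<Phi>))"

lemma tl_inv_init: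
  assumes "constant_game A" shows "tl_inv A 0 []"
  using constant_game_Nil[OF assms]
  by (auto simp: tl_inv_def legal_imp full_tree_def bt_node_iff Lr_loose tight_cgame_def mk_cgame_def)

lemma tl_step:
  assumes A: "constant_game A" and inv: "tl_inv A n \<Phi>"
    and legal: "Fin (\<Phi> @ [(Bot, m)]) \<in> Lr (imp_cgame (tight_cgame A) (loose_cgame A))"
  obtains (copy) g where "m = CHR ''1'' # CHR ''.'' # g"
      "tl_inv A n (\<Phi> @ (Bot, m) # [(Top, CHR ''2'' # CHR ''.'' # g)])"
  | (deepen) w \<alpha> where "bitstring w" "m = CHR ''2'' # CHR ''.'' # w @ CHR ''.'' # \<alpha>"
      "tl_inv A (n + length w) (\<Phi> @ (Bot, m) #
        map (\<lambda>c. (Top, CHR ''1'' # CHR ''.'' # c @ '':'')) (replications n (length w)) @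
        [(Top, CHR ''1'' # CHR ''.'' # w @ CHR ''.'' # \<alpha>)])"
proof -
  let ?T = "ante \<Phi>" and ?L = "cons \<Phi>"
  have tree: "full_tree ?T n" and eq: "\<And>v. thread_pos v ?T = thread_pos v ?L"
    and legT: "Fin ?T \<in> Lr (tight_cgame A)" and legL: "Fin ?L \<in> Lr (loose_cgame A)"
    and moves: "\<forall>x \<in> set \<Phi>. \<exists>\<alpha>. snd x = ''1.'' @ \<alpha> \<or> snd x = ''2.'' @ \<alpha>"
    using inv unfolding tl_inv_def legal_imp by auto
  from imp_move[OF legal] consider g where "m = CHR ''1'' # CHR ''.'' # g"
    | g where "m = CHR ''2'' # CHR ''.'' # g" by blast
  then show thesis
  proof cases
    case (1 g)
    have legT': "Fin (?T @ [(Top, g)]) \<in> Lr (tight_cgame A)" using legal 1 by (simp add: legal_imp)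
    \<comment> \<open>The environment is \<open>Top\<close> in the antecedent, and
      \<open>Top\<close> may not replicate; only a dotted move is left.\<close>
    then obtain w \<alpha> where w: "bitstring w" "g = w @ CHR ''.'' # \<alpha>"
      and ext: "\<And>v. bit_segment w v \<Longrightarrow> Fin (thread_pos v ?T @ [(Top, \<alpha>)]) \<in> Lr A"
      by (auto simp: legal_tight_snoc tight_legal_move_def)
    have "Fin (?L @ [(Top, g)]) \<in> Lr (loose_cgame A)"
      using w ext eq by (intro legal_loose_append[OF legL]) (auto simp: thread_pos_dot split: if_splits)
    moreover have "full_tree (?T @ [(Top, g)]) n"
      using tree w by (simp add: full_tree_def bt_node_snoc_dot)
    ultimately have "tl_inv A n (\<Phi> @ (Bot, m) # [(Top, CHR ''2'' # CHR ''.'' # g)])"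
      using 1 legT' moves eq by (auto simp: tl_inv_def legal_imp thread_pos_append)
    with 1 show thesis by (rule copy)
  next
    case (2 g)
    have legL': "Fin (?L @ [(Bot, g)]) \<in> Lr (loose_cgame A)" using legal 2 by (simp add: legal_imp)
    then obtain w \<alpha> where w: "bitstring w" "g = w @ CHR ''.'' # \<alpha>"
      and ext: "\<And>v. bit_segment w v \<Longrightarrow> Fin (thread_pos v ?L @ [(Bot, \<alpha>)]) \<in> Lr A"
      by (rule legal_loose_snocD) blast
    let ?R = "map (\<lambda>c. (Bot, c @ '':'')) (replications n (length w))"
    let ?os = "map (\<lambda>c. (Top, CHR ''1'' # CHR ''.'' # c @ '':'')) (replications n (length w))"
    have proj: "ante ?os = ?R" "cons ?os = []"
      by (auto simp: ante_def cons_def neg_pos_def comp_pos_def comp_def filter_map)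
    \<comment> \<open>Fewer levels might do, but adding as many as w has bits always makes w a node
      and spares the machine a comparison of its length with the depth.\<close>
    have R: "full_tree (?T @ ?R) (n + length w)" "Fin (?T @ ?R) \<in> Lr (tight_cgame A)"
      using replicate_levels[OF tree legT] by auto
    have thr: "thread_pos v ?R = []" for v
      by (intro thread_pos_level) (simp add: bitstring_replications)
    have "tight_legal_move A (?T @ ?R) Bot g"
      using w R(1) ext eq thr
      by (auto simp: tight_legal_move_def full_tree_def thread_pos_append)
    then have "Fin (?T @ ?R @ [(Bot, g)]) \<in> Lr (tight_cgame A)"
      using R(2) legal_tight_snoc[of "?T @ ?R"] by simp
    moreover have "full_tree (?T @ ?R @ [(Bot, g)]) (n + length w)"
      using R(1) w bt_node_snoc_dot[of w "?T @ ?R"] by (simp add: full_tree_def)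
    ultimately have "tl_inv A (n + length w) (\<Phi> @ (Bot, m) # ?os @ [(Top, CHR ''1'' # CHR ''.'' # g)])"
      using 2 legL' moves eq proj thr by (auto simp: tl_inv_def legal_imp thread_pos_append)
    with w 2 show thesis by (intro deepen[of w \<alpha>]) auto
  qed
qed

section \<open>From loose to tight: a table of leaves\<close>

text \<open>A record is a sequence of bits (as keys) and fillers (as \<open>Aux 2\<close>). Its bits form a leaf of the
  tight tree; reading the fillers as zeros gives the loose bitstring at which that leaf is simulated.
  A table entry carries a flag telling whether the record is still a leaf.\<close>

type_synonym table = "(bool \<times> symbol list) list"

abbreviation Filler :: symbol where "Filler \<equiv> Aux 2"

definition is_record :: "symbol list \<Rightarrow> bool" where
  "is_record r \<longleftrightarrow> set r \<subseteq> {Filler, Key (CHR ''0''), Key (CHR ''1'')}"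

definition leaf_of :: "symbol list \<Rightarrow> string" where
  "leaf_of r = map key (filter (\<lambda>s. s \<noteq> Filler) r)"

definition code_of :: "symbol list \<Rightarrow> string" where
  "code_of r = map (\<lambda>s. if s = Filler then CHR ''0'' else key s) r"

abbreviation zeros :: "nat \<Rightarrow> string" where "zeros n \<equiv> replicate n (CHR ''0'')"

definition live :: "table \<Rightarrow> symbol list list" where
  "live tab = map snd (filter fst tab)"

lemma leaf_of_simps [simp]:
  "leaf_of [] = []" "leaf_of (r @ r') = leaf_of r @ leaf_of r'"
  "leaf_of (Filler # r) = leaf_of r" "leaf_of (Key c # r) = c # leaf_of r"
  "leaf_of (replicate n Filler) = []"
  by (auto simp: leaf_of_def)

lemma code_of_simps [simp]:
  "code_of [] = []" "code_of (r @ r') = code_of r @ code_of r'"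
  "code_of (Filler # r) = CHR ''0'' # code_of r" "code_of (Key c # r) = c # code_of r"
  "code_of (replicate n Filler) = zeros n"
  by (auto simp: code_of_def)

lemma is_record_simps [simp]:
  "is_record []" "is_record (r @ r') \<longleftrightarrow> is_record r \<and> is_record r'"
  "is_record (s # r) \<longleftrightarrow> (s = Filler \<or> s = Key (CHR ''0'') \<or> s = Key (CHR ''1'')) \<and> is_record r"
  "is_record (replicate n Filler)"
  by (auto simp: is_record_def)

lemma is_record_bitstrings [simp]:
  "is_record r \<Longrightarrow> bitstring (leaf_of r)" "is_record r \<Longrightarrow> bitstring (code_of r)"
  by (induction r) auto

lemma live_append [simp]: "live (t @ t') = live t @ live t'"
  and live_Nil [simp]: "live [] = []"
  and live_Cons [simp]: "live ((b, r) # t) = (if b then [r] else []) @ live t"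
  by (auto simp: live_def)

text \<open>A record that is no longer a leaf keeps its place: on the tape only its flag is
  overwritten, and nothing has to be moved.\<close>

definition kill :: "string \<Rightarrow> table \<Rightarrow> table" where
  "kill u = map (\<lambda>(b, r). (b \<and> leaf_of r \<noteq> u, r))"

lemma live_kill: "live (kill u tab) = filter (\<lambda>r. leaf_of r \<noteq> u) (live tab)"
  by (induction tab) (auto simp: kill_def)

text \<open>The leaves have to cover every \<open>v\<close>, whereas the codes are only an
  antichain, since antecedent threads off the codes need no partner. The last clause holds for all
  \<open>v\<close> and \<open>v'\<close> through the leaf and the padded code, so each leaf has a
  single history on both sides.\<close>

definition lt_inv :: "cgame \<Rightarrow> table \<Rightarrow> nat \<Rightarrow> position \<Rightarrow> bool" where
  "lt_inv A tab N \<Phi> \<longleftrightarrow> Fin \<Phi> \<in> Lr (imp_cgame (loose_cgame A) (tight_cgame A)) \<and>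
     (\<forall>x \<in> set tab. is_record (snd x)) \<and>
     (\<forall>r \<in> set (live tab). bt_leaf (cons \<Phi>) (leaf_of r)) \<and>
     (\<forall>v. \<exists>r \<in> set (live tab). bit_segment (leaf_of r) v) \<and>
     distinct (map leaf_of (live tab)) \<and>
     (\<forall>r \<in> set (live tab). \<forall>r' \<in> set (live tab). prefix (code_of r) (code_of r') \<longrightarrow> r = r') \<and>
     (\<forall>r \<in> set (live tab). \<forall>v v'. bit_segment (leaf_of r) v \<longrightarrow>
        bit_segment (code_of r @ zeros N) v' \<longrightarrow>
        thread_pos v' (ante \<Phi>) = thread_pos v (cons \<Phi>))"

lemma bt_leaf_antichain:
  "bt_leaf T p \<Longrightarrow> bt_node T q \<Longrightarrow> prefix p q \<Longrightarrow> p = q"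
  by (auto simp: bt_leaf_def strict_prefix_def)

lemma lt_inv_init:
  assumes "constant_game A" shows "lt_inv A [(True, [])] 0 []"
proof -
  have "\<not> bt_node [] w" if "strict_prefix [] w" for w
    using that by (auto simp: bt_node_iff)
  then show ?thesis
    using constant_game_Nil[OF assms]
    by (auto simp: lt_inv_def legal_imp Lr_loose tight_cgame_def mk_cgame_def bt_leaf_def bt_node_iff)
qed

context
  fixes A tab N \<Phi>
  assumes inv: "lt_inv A tab N \<Phi>"
begin

lemma lt_legal: "Fin (ante \<Phi>) \<in> Lr (loose_cgame A)" "Fin (cons \<Phi>) \<in> Lr (tight_cgame A)"
    "\<forall>x \<in> set \<Phi>. \<exists>\<alpha>. snd x = ''1.'' @ \<alpha> \<or> snd x = ''2.'' @ \<alpha>"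
  and lt_records: "\<forall>x \<in> set tab. is_record (snd x)"
  and lt_leaf: "r \<in> set (live tab) \<Longrightarrow> bt_leaf (cons \<Phi>) (leaf_of r)"
  and lt_cover: "\<exists>r \<in> set (live tab). bit_segment (leaf_of r) v"
  and lt_distinct: "distinct (map leaf_of (live tab))"
  and lt_code_antichain:
    "r \<in> set (live tab) \<Longrightarrow> r' \<in> set (live tab) \<Longrightarrow> prefix (code_of r) (code_of r') \<Longrightarrow> r = r'"
  and lt_threads: "r \<in> set (live tab) \<Longrightarrow> bit_segment (leaf_of r) v \<Longrightarrow>
    bit_segment (code_of r @ zeros N) v' \<Longrightarrow> thread_pos v' (ante \<Phi>) = thread_pos v (cons \<Phi>)"
  using inv by (auto simp: lt_inv_def legal_imp)

lemma lt_record: "r \<in> set (live tab) \<Longrightarrow> is_record r"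
  using lt_records by (auto simp: live_def)

lemma lt_leaf_antichain:
  "r \<in> set (live tab) \<Longrightarrow> r' \<in> set (live tab) \<Longrightarrow> prefix (leaf_of r) (leaf_of r') \<Longrightarrow> r = r'"
  using lt_leaf[of r] lt_leaf[of r'] bt_leaf_antichain lt_distinct
  unfolding distinct_map inj_on_def by (metis bt_leaf_def)

lemma lt_leaf_unique:
  "r \<in> set (live tab) \<Longrightarrow> r' \<in> set (live tab) \<Longrightarrow> bit_segment (leaf_of r) v \<Longrightarrow>
    bit_segment (leaf_of r') v \<Longrightarrow> r = r'"
  using lt_leaf_antichain[of r r'] lt_leaf_antichain[of r' r] bit_segments_comparable
  by (metis nle_le)

lemma lt_code_unique:
  "r \<in> set (live tab) \<Longrightarrow> r' \<in> set (live tab) \<Longrightarrow> bit_segment (code_of r @ zeros k) v \<Longrightarrow>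
    bit_segment (code_of r' @ zeros k') v \<Longrightarrow> r = r'"
  using lt_code_antichain[of r r'] lt_code_antichain[of r' r]
    bit_segments_comparable[of "code_of r" v "code_of r'"]
    bit_segments_comparable[of "code_of r'" v "code_of r"] bit_segment_prefix
  by (metis nle_le prefixI)

text \<open>Longer padding leaves fewer \<open>v'\<close> in the clause about threads. This permits
  raising \<open>N\<close> before a move is answered.\<close>

lemma lt_mono:
  assumes "N \<le> N'" shows "lt_inv A tab N' \<Phi>"
proof -
  have "prefix (code_of r @ zeros N) (code_of r @ zeros N')" for r
    using assms by (auto simp: le_iff_add replicate_add)
  then show ?thesis
    using inv bit_segment_prefix unfolding lt_inv_def by blast
qed

end

text \<open>Along a fixed \<open>v\<close> this makes the padded codes a chain, whose limit is the
  antecedent thread matched with \<open>v\<close>.\<close>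

definition refines :: "table \<Rightarrow> nat \<Rightarrow> table \<Rightarrow> nat \<Rightarrow> bool" where
  "refines tab N tab' N' \<longleftrightarrow>
    (\<forall>v. \<forall>r \<in> set (live tab). \<forall>r' \<in> set (live tab').
      bit_segment (leaf_of r) v \<longrightarrow> bit_segment (leaf_of r') v \<longrightarrow>
      prefix (code_of r @ zeros N) (code_of r' @ zeros N'))"

lemma refines_mono: "lt_inv A tab N \<Phi> \<Longrightarrow> N \<le> N' \<Longrightarrow> refines tab N tab N'"
  unfolding refines_def using lt_leaf_unique by (auto simp: le_iff_add replicate_add dest: lt_leaf_unique)

text \<open>Fillers lengthen the code without touching the leaf; the final key is a bit of
  both.\<close>

definition split_table :: "string \<Rightarrow> symbol list \<Rightarrow> nat \<Rightarrow> table \<Rightarrow> table" where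
  "split_table u r N tab = kill u tab @
    [(True, r @ replicate N Filler @ [Key (CHR ''0'')]),
     (True, r @ replicate N Filler @ [Key (CHR ''1'')])]"

text \<open>As \<open>length w \<le> N\<close>, the string \<open>w\<close> cannot properly extend a
  padded code. The move therefore enters all threads through the padded code or none of them, and
  the same is done at the leaf.\<close>

lemma lt_copy:
  assumes inv: "lt_inv A tab N \<Phi>" and w: "bitstring w" "length w \<le> N"
    and m: "m = CHR ''1'' # CHR ''.'' # w @ CHR ''.'' # \<alpha>"
    and legal: "Fin (\<Phi> @ [(Bot, m)]) \<in> Lr (imp_cgame (loose_cgame A) (tight_cgame A))"
  shows "lt_inv A tab N (\<Phi> @ (Bot, m) #
    map (\<lambda>r. (Top, CHR ''2'' # CHR ''.'' # leaf_of r @ CHR ''.'' # \<alpha>))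
      (filter (\<lambda>r. prefix w (code_of r @ zeros N)) (live tab)))"
proof -
  let ?T = "cons \<Phi>" and ?L = "ante \<Phi>"
  let ?rs = "filter (\<lambda>r. prefix w (code_of r @ zeros N)) (live tab)"
  let ?ps = "map leaf_of ?rs"
  let ?M = "map (\<lambda>p. (Top, p @ CHR ''.'' # \<alpha>)) ?ps"
  let ?os = "map (\<lambda>r. (Top, CHR ''2'' # CHR ''.'' # leaf_of r @ CHR ''.'' # \<alpha>)) ?rs"
  note inv_facts = lt_legal[OF inv] lt_records[OF inv] lt_leaf[OF inv] lt_cover[OF inv] lt_distinct[OF inv]
    lt_code_antichain[OF inv]
  have proj: "cons ?os = ?M" "ante ?os = []"
    by (simp_all add: cons_def ante_def comp_pos_def neg_pos_def comp_def filter_map)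
  have legL: "Fin (?L @ [(Top, w @ CHR ''.'' # \<alpha>)]) \<in> Lr (loose_cgame A)"
    using legal m by (simp add: legal_imp)
  have ext: "Fin (thread_pos v ?L @ [(Top, \<alpha>)]) \<in> Lr A" if "bit_segment w v" for v
    using legL
  proof (rule legal_loose_snocD)
    fix w' \<alpha>' assume w': "bitstring w'" "w @ CHR ''.'' # \<alpha> = w' @ CHR ''.'' # \<alpha>'"
      and *: "\<And>v. bit_segment w' v \<Longrightarrow> Fin (thread_pos v ?L @ [(Top, \<alpha>')]) \<in> Lr A"
    then have "w' = w \<and> \<alpha>' = \<alpha>" using dot_inject[OF w(1) w'(1)] by simp
    with * that show ?thesis by simp
  qed
  have bs: "\<forall>p \<in> set ?ps. bitstring p" using lt_record[OF inv] by auto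
  have dist: "distinct ?ps" using lt_distinct[OF inv] by (simp add: distinct_map_filter)
  have anti: "p = q" if "p \<in> set ?ps" "q \<in> set ?ps" "prefix p q" for p q
    using that lt_leaf_antichain[OF inv] by auto
  have node: "bt_node ?T p" if "p \<in> set ?ps" for p
    using that lt_leaf[OF inv] by (auto simp: bt_leaf_def)
  have legT: "Fin (?T @ ?M) \<in> Lr (tight_cgame A)"
  proof (rule legal_tight_append)
    fix p v assume p: "p \<in> set ?ps" and v: "bit_segment p v"
    then obtain r where r: "r \<in> set (live tab)" "p = leaf_of r" "prefix w (code_of r @ zeros N)"
      by auto
    \<comment> \<open>Any \<open>v'\<close> through the padded code will do: it lies on
      \<open>w\<close>, so \<open>\<alpha>\<close> is legal in its antecedent thread, which equals
      the consequent thread of \<open>v\<close>.\<close>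
    then obtain v' where v': "bit_segment (code_of r @ zeros N) v'"
      using ex_bit_segment[of "code_of r @ zeros N"] lt_record[OF inv] by auto
    then have "Fin (thread_pos v' ?L @ [(Top, \<alpha>)]) \<in> Lr A"
      using ext bit_segment_prefix r(3) by blast
    then show "Fin (thread_pos v ?T @ [(Top, \<alpha>)]) \<in> Lr A"
      using lt_threads[OF inv r(1) _ v'] v r(2) by simp
  qed (use lt_legal[OF inv] bs node dist anti in auto)
  have thr: "thread_pos v' (?L @ [(Top, w @ CHR ''.'' # \<alpha>)]) = thread_pos v (?T @ ?M)"
    if r: "r \<in> set (live tab)" "bit_segment (leaf_of r) v" "bit_segment (code_of r @ zeros N) v'"
    for r v v'
  proof -
    have "bit_segment w v' \<longleftrightarrow> prefix w (code_of r @ zeros N)"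
      using bit_segment_prefix[OF _ r(3)] bit_segments_comparable[OF _ r(3), of w] w(2)
      by auto
    also have "\<dots> \<longleftrightarrow> (\<exists>p \<in> set ?ps. bit_segment p v)"
    proof
      assume "prefix w (code_of r @ zeros N)"
      then have "leaf_of r \<in> set ?ps" using r(1) by simp
      then show "\<exists>p \<in> set ?ps. bit_segment p v" using r(2) by blast
    next
      assume "\<exists>p \<in> set ?ps. bit_segment p v"
      then obtain r' where r': "r' \<in> set (live tab)" "prefix w (code_of r' @ zeros N)"
        "bit_segment (leaf_of r') v" by auto
      with lt_leaf_unique[OF inv r(1) r'(1) r(2) r'(3)] show "prefix w (code_of r @ zeros N)" by simp
    qed
    finally show ?thesis
      using lt_threads[OF inv r] thread_pos_antichain[OF dist bs anti]
      by (simp add: thread_pos_append thread_pos_dot[OF w(1)])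
  qed
  show ?thesis
    unfolding lt_inv_def
    using legL legT thr inv_facts proj m bt_leaf_append_dot[OF bs]
    by (auto simp: legal_imp)
qed

text \<open>The address \<open>u\<close> is a node, so no leaf is a proper initial segment of it,
  and the move enters all threads through a leaf or none. The copies go to the padded codes because
  only threads through these are known to have the history of the leaf, and hence to admit
  \<open>\<alpha>\<close>.\<close>

lemma lt_answer:
  assumes inv: "lt_inv A tab N \<Phi>" and u: "bitstring u"
    and m: "m = CHR ''2'' # CHR ''.'' # u @ CHR ''.'' # \<alpha>"
    and legal: "Fin (\<Phi> @ [(Bot, m)]) \<in> Lr (imp_cgame (loose_cgame A) (tight_cgame A))"
  shows "lt_inv A tab N (\<Phi> @ (Bot, m) #
    map (\<lambda>r. (Top, CHR ''1'' # CHR ''.'' # (code_of r @ zeros N) @ CHR ''.'' # \<alpha>))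
      (filter (\<lambda>r. prefix u (leaf_of r)) (live tab)))"
proof -
  let ?T = "cons \<Phi>" and ?L = "ante \<Phi>"
  let ?rs = "filter (\<lambda>r. prefix u (leaf_of r)) (live tab)"
  let ?ps = "map (\<lambda>r. code_of r @ zeros N) ?rs"
  let ?M = "map (\<lambda>p. (Bot, p @ CHR ''.'' # \<alpha>)) ?ps"
  let ?os = "map (\<lambda>r. (Top, CHR ''1'' # CHR ''.'' # (code_of r @ zeros N) @ CHR ''.'' # \<alpha>)) ?rs"
  note inv_facts = lt_legal[OF inv] lt_records[OF inv] lt_leaf[OF inv] lt_cover[OF inv] lt_distinct[OF inv]
    lt_code_antichain[OF inv]
  have proj: "cons ?os = []" "ante ?os = ?M"
    by (simp_all add: cons_def ante_def comp_pos_def neg_pos_def comp_def filter_map)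
  have legT: "Fin (?T @ [(Bot, u @ CHR ''.'' # \<alpha>)]) \<in> Lr (tight_cgame A)"
    using legal m by (simp add: legal_imp)
  then have "tight_legal_move A ?T Bot (u @ CHR ''.'' # \<alpha>)" by (simp add: legal_tight_snoc)
  then obtain w \<beta> where "bitstring w" "u @ CHR ''.'' # \<alpha> = w @ CHR ''.'' # \<beta>" "bt_node ?T w"
    "\<forall>v. bit_segment w v \<longrightarrow> Fin (thread_pos v ?T @ [(Bot, \<beta>)]) \<in> Lr A"
    using dot_neq_colon[of _ u \<alpha>] unfolding tight_legal_move_def by auto
  then have node: "bt_node ?T u"
    and ext: "\<And>v. bit_segment u v \<Longrightarrow> Fin (thread_pos v ?T @ [(Bot, \<alpha>)]) \<in> Lr A"
    using dot_inject[OF u] by auto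
  have bs: "\<forall>p \<in> set ?ps. bitstring p" using lt_record[OF inv] by auto
  \<comment> \<open>Padding creates no new comparabilities: if one padded code is a prefix of
    another, both codes are prefixes of the latter and so comparable themselves.\<close>
  have inj: "r = r'" if "r \<in> set (live tab)" "r' \<in> set (live tab)"
    "prefix (code_of r @ zeros N) (code_of r' @ zeros N)" for r r'
  proof -
    have "prefix (code_of r) (code_of r' @ zeros N)" "prefix (code_of r') (code_of r' @ zeros N)"
      using that(3) by (auto dest: append_prefixD)
    then have "prefix (code_of r) (code_of r') \<or> prefix (code_of r') (code_of r)"
      by (rule prefix_same_cases)
    then show ?thesis using lt_code_antichain[OF inv] that by blast
  qed
  have "distinct (live tab)" using lt_distinct[OF inv] by (simp add: distinct_map)
  then have dist: "distinct ?ps"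
    using inj unfolding distinct_map inj_on_def by (auto)
  have anti: "p = q" if "p \<in> set ?ps" "q \<in> set ?ps" "prefix p q" for p q
    using that inj by auto
  have leg_m: "\<forall>x \<in> set ?M. \<exists>w \<alpha>. bitstring w \<and> snd x = w @ ''.'' @ \<alpha>"
  proof
    fix x assume "x \<in> set ?M"
    then obtain r where "r \<in> set (live tab)" "x = (Bot, (code_of r @ zeros N) @ CHR ''.'' # \<alpha>)"
      by auto
    then show "\<exists>w \<alpha>. bitstring w \<and> snd x = w @ ''.'' @ \<alpha>"
      using lt_record[OF inv] by (intro exI[of _ "code_of r @ zeros N"] exI[of _ \<alpha>]) simp
  qed
  have thr_M: "thread_pos v ?M = (if \<exists>p \<in> set ?ps. bit_segment p v then [(Bot, \<alpha>)] else [])" for v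
    by (rule thread_pos_antichain[OF dist bs anti])
  have legL: "Fin (?L @ ?M) \<in> Lr (loose_cgame A)"
  proof (rule legal_loose_append[OF lt_legal(1)[OF inv] leg_m])
    fix v' assume "thread_pos v' ?M \<noteq> []"
    then have "\<exists>p \<in> set ?ps. bit_segment p v'" and M: "thread_pos v' ?M = [(Bot, \<alpha>)]"
      unfolding thr_M by (auto split: if_splits)
    then obtain r where r: "r \<in> set (live tab)" "prefix u (leaf_of r)"
      "bit_segment (code_of r @ zeros N) v'" by auto
    \<comment> \<open>Legality is borrowed from an arbitrary consequent thread through the leaf,
      where the environment has just moved legally.\<close>
    obtain v where v: "bit_segment (leaf_of r) v"
      using ex_bit_segment[of "leaf_of r"] lt_record[OF inv r(1)] by auto
    then have "Fin (thread_pos v ?T @ [(Bot, \<alpha>)]) \<in> Lr A"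
      using ext bit_segment_prefix r(2) by blast
    then show "Fin (thread_pos v' ?L @ thread_pos v' ?M) \<in> Lr A"
      unfolding M using lt_threads[OF inv r(1) v r(3)] by simp
  qed
  have thr: "thread_pos v' (?L @ ?M) = thread_pos v (?T @ [(Bot, u @ CHR ''.'' # \<alpha>)])"
    if r: "r \<in> set (live tab)" "bit_segment (leaf_of r) v" "bit_segment (code_of r @ zeros N) v'"
    for r v v'
  proof -
    have "bit_segment u v \<longleftrightarrow> prefix u (leaf_of r)"
    proof
      assume "bit_segment u v"
      then have "prefix u (leaf_of r) \<or> prefix (leaf_of r) u"
        using bit_segments_comparable[OF _ r(2), of u] bit_segments_comparable[OF r(2), of u]
        by (meson nle_le)
      then show "prefix u (leaf_of r)"
        using bt_leaf_antichain[OF lt_leaf[OF inv r(1)] node] by auto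
    qed (use bit_segment_prefix r(2) in blast)
    also have "\<dots> \<longleftrightarrow> (\<exists>p \<in> set ?ps. bit_segment p v')"
    proof
      assume "prefix u (leaf_of r)"
      then have "code_of r @ zeros N \<in> set ?ps" using r(1) by simp
      then show "\<exists>p \<in> set ?ps. bit_segment p v'" using r(3) by blast
    next
      assume "\<exists>p \<in> set ?ps. bit_segment p v'"
      then obtain r' where r': "r' \<in> set (live tab)" "prefix u (leaf_of r')"
        "bit_segment (code_of r' @ zeros N) v'" by auto
      with lt_code_unique[OF inv r(1) r'(1) r(3) r'(3)] show "prefix u (leaf_of r)" by simp
    qed
    finally have "thread_pos v' ?M = thread_pos v [(Bot, u @ CHR ''.'' # \<alpha>)]"
      unfolding thr_M thread_pos_dot[OF u] by (simp only:)
    then show ?thesis using lt_threads[OF inv r] unfolding thread_pos_append by (simp only:)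
  qed
  have leaf: "bt_leaf (?T @ [(Bot, u @ CHR ''.'' # \<alpha>)]) x = bt_leaf ?T x" for x
    using bt_leaf_append_dot[of "[u]" ?T Bot \<alpha> x] u by simp
  show ?thesis
    unfolding lt_inv_def
    using legL legT thr inv_facts proj m leaf by (auto simp: legal_imp)
qed

text \<open>A replicative move changes no thread, and both the leaves and the codes of the children
  extend those of the parent, so both children inherit its history. The distinct last bits keep
  their codes incomparable.\<close>

lemma lt_split:
  assumes inv: "lt_inv A tab N \<Phi>" and u: "bitstring u"
    and m: "m = CHR ''2'' # CHR ''.'' # u @ '':''"
    and legal: "Fin (\<Phi> @ [(Bot, m)]) \<in> Lr (imp_cgame (loose_cgame A) (tight_cgame A))"
  obtains r where "r \<in> set (live tab)" "leaf_of r = u"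
    "lt_inv A (split_table u r N tab) N (\<Phi> @ [(Bot, m)])"
    "refines tab N (split_table u r N tab) N"
proof -
  let ?T = "cons \<Phi>" and ?L = "ante \<Phi>" and ?T' = "cons \<Phi> @ [(Bot, u @ '':'')]"
  have legT: "Fin ?T' \<in> Lr (tight_cgame A)" using legal m by (simp add: legal_imp)
  then have "tight_legal_move A ?T Bot (u @ '':'')" by (simp add: legal_tight_snoc)
  then have leaf_u: "bt_leaf ?T u"
    using dot_neq_colon[OF u] unfolding tight_legal_move_def by auto (metis dot_neq_colon u)
  \<comment> \<open>Some live leaf lies on a \<open>v0\<close> through \<open>u\<close>; it is
    comparable with \<open>u\<close>, and comparable leaves of one tree coincide.\<close>
  obtain v0 where v0: "bit_segment u v0" using ex_bit_segment[OF u] by blast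
  obtain r where r: "r \<in> set (live tab)" "bit_segment (leaf_of r) v0" using lt_cover[OF inv] by blast
  have "prefix u (leaf_of r) \<or> prefix (leaf_of r) u"
    using bit_segments_comparable[OF v0 r(2)] bit_segments_comparable[OF r(2) v0] by (meson nle_le)
  then have ru: "leaf_of r = u"
    using lt_leaf[OF inv r(1)] leaf_u bt_leaf_antichain unfolding bt_leaf_def
    by (metis bt_leaf_antichain leaf_u lt_leaf[OF inv r(1)])
  define new where "new c = r @ replicate N Filler @ [Key c]" for c
  let ?old = "filter (\<lambda>r. leaf_of r \<noteq> u) (live tab)"
  have live: "live (split_table u r N tab) = ?old @ [new (CHR ''0''), new (CHR ''1'')]"
    by (simp add: split_table_def live_kill new_def)
  have new: "leaf_of (new c) = u @ [c]" "code_of (new c) = code_of r @ zeros N @ [c]" for c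
    by (simp_all add: new_def ru)
  have no_ext: "\<not> bt_node ?T x" if "strict_prefix u x" for x using leaf_u that unfolding bt_leaf_def by blast
  have node': "bt_node ?T' x \<longleftrightarrow> bt_node ?T x \<or> x = u @ ''0'' \<or> x = u @ ''1''" for x
    by (rule bt_node_snoc_colon[OF u])
  have leaf_old: "bt_leaf ?T' (leaf_of r')" if r': "r' \<in> set ?old" for r'
  proof -
    have l: "bt_leaf ?T (leaf_of r')" "leaf_of r' \<noteq> u" using r' lt_leaf[OF inv] by auto
    have "\<not> strict_prefix (leaf_of r') (u @ [c])" for c
    proof
      assume "strict_prefix (leaf_of r') (u @ [c])"
      then have "prefix (leaf_of r') u" by (auto simp: strict_prefix_def)
      then show False using bt_leaf_antichain[OF l(1)] leaf_u l(2) by (auto simp: bt_leaf_def)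
    qed
    then show ?thesis using l(1) unfolding bt_leaf_def node' by blast
  qed
  have leaf_new: "bt_leaf ?T' (u @ [c])" if c: "c \<in> {CHR ''0'', CHR ''1''}" for c
  proof -
    have "\<not> bt_node ?T x" if "strict_prefix (u @ [c]) x" for x
      using no_ext[of x] that by (meson prefixI prefix_order.le_less_trans)
    moreover have "\<not> strict_prefix (u @ [c]) (u @ [d])" for d by (auto simp: strict_prefix_def)
    ultimately show ?thesis using c unfolding bt_leaf_def node' by blast
  qed
  have old_not_new: "leaf_of r' \<noteq> u @ [c]" if "r' \<in> set (live tab)" for r' c
    using lt_leaf[OF inv that] no_ext[of "u @ [c]"] by (auto simp: bt_leaf_def strict_prefix_def)
  have cover: "\<exists>r' \<in> set (live (split_table u r N tab)). bit_segment (leaf_of r') v" for v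
  proof -
    obtain r' where r': "r' \<in> set (live tab)" "bit_segment (leaf_of r') v" using lt_cover[OF inv] by blast
    show ?thesis
    proof (cases "leaf_of r' = u")
      case True
      \<comment> \<open>The bit of \<open>v\<close> following \<open>u\<close> selects the
        child.\<close>
      let ?c = "if v (length u) then CHR ''1'' else CHR ''0''"
      have "u @ [?c] = bits v (Suc (length u))"
        using bit_segment_eq[OF r'(2)] True by (simp add: bits_def)
      then have "bit_segment (leaf_of (new ?c)) v" unfolding new by (metis bit_segment_bits)
      then show ?thesis unfolding live by (auto split: if_splits)
    qed (use r' live in auto)
  qed
  have dist: "distinct (map leaf_of (live (split_table u r N tab)))"
    using lt_distinct[OF inv] old_not_new old_not_new[symmetric] unfolding live
    by (auto simp: new distinct_map_filter)
  have records: "\<forall>x \<in> set (split_table u r N tab). is_record (snd x)"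
    using lt_records[OF inv] lt_record[OF inv r(1)]
    by (auto simp: split_table_def kill_def)
  have cases: thesis' if "r' \<in> set (live (split_table u r N tab))"
    "r' \<in> set (live tab) \<Longrightarrow> leaf_of r' \<noteq> u \<Longrightarrow> thesis'"
    "\<And>c. r' = new c \<Longrightarrow> c \<in> {CHR ''0'', CHR ''1''} \<Longrightarrow> thesis'" for r' thesis'
    using that unfolding live by auto
  have code_anti: "r1 = r2"
    if "r1 \<in> set (live (split_table u r N tab))" "r2 \<in> set (live (split_table u r N tab))"
      and pre: "prefix (code_of r1) (code_of r2)" for r1 r2
    using that(1)
  proof (rule cases)
    assume r1: "r1 \<in> set (live tab)" "leaf_of r1 \<noteq> u"
    show ?thesis using that(2)
    proof (rule cases)
      fix c assume "r2 = new c"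
      then have "prefix (code_of r1) (code_of r @ zeros N @ [c])" using pre new by simp
      \<comment> \<open>Both are initial segments of the child's code, so the old code would have to
        be that of the parent, which is no longer live.\<close>
      then have "prefix (code_of r1) (code_of r) \<or> prefix (code_of r) (code_of r1)"
        by (rule prefix_same_cases) simp
      then have "r1 = r" using lt_code_antichain[OF inv] r1(1) r(1) by blast
      with r1(2) ru show ?thesis by simp
    qed (use lt_code_antichain[OF inv] r1(1) pre in blast)
  next
    fix c assume c: "r1 = new c"
    show ?thesis using that(2)
    proof (rule cases)
      assume r2: "r2 \<in> set (live tab)" "leaf_of r2 \<noteq> u"
      have "prefix (code_of r) (code_of r2)" using pre c new by (auto dest: append_prefixD)
      then have "r = r2" using lt_code_antichain[OF inv] r2(1) r(1) by blast
      with r2(2) ru show ?thesis by simp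
    next
      fix d assume "r2 = new d"
      with c pre show ?thesis by (auto simp: new)
    qed
  qed
  have thr: "thread_pos v' ?L = thread_pos v ?T'"
    if r': "r' \<in> set (live (split_table u r N tab))" "bit_segment (leaf_of r') v"
      "bit_segment (code_of r' @ zeros N) v'" for r' v v'
    using r'(1)
  proof (rule cases)
    assume "r' \<in> set (live tab)"
    then show ?thesis
      using lt_threads[OF inv _ r'(2,3)] by (simp add: thread_pos_append thread_pos_colon[OF u])
  next
    fix c assume c: "r' = new c"
    have "bit_segment (leaf_of r) v"
      using r'(2) unfolding c new ru by (rule bit_segment_prefix[rotated]) simp
    moreover have "bit_segment (code_of r @ zeros N) v'"
      using r'(3) unfolding c new by (rule bit_segment_prefix[rotated]) simp
    ultimately show ?thesis
      using lt_threads[OF inv r(1)] by (simp add: thread_pos_append thread_pos_colon[OF u])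
  qed
  have leafs: "bt_leaf ?T' (leaf_of r')" if "r' \<in> set (live (split_table u r N tab))" for r'
    using that
  proof (rule cases)
    fix c assume "r' = new c" "c \<in> {CHR ''0'', CHR ''1''}"
    then show ?thesis using leaf_new by (simp add: new)
  qed (use leaf_old in simp)
  have proj: "ante (\<Phi> @ [(Bot, m)]) = ?L" "cons (\<Phi> @ [(Bot, m)]) = ?T'" using m by simp_all
  have "lt_inv A (split_table u r N tab) N (\<Phi> @ [(Bot, m)])"
    unfolding lt_inv_def proj using legal records leafs cover dist code_anti thr by blast
  moreover have "refines tab N (split_table u r N tab) N"
    unfolding refines_def
  proof (intro allI ballI impI)
    fix v r1 r2
    assume r1: "r1 \<in> set (live tab)" "bit_segment (leaf_of r1) v"
      and r2: "r2 \<in> set (live (split_table u r N tab))" "bit_segment (leaf_of r2) v"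
    from r2(1) show "prefix (code_of r1 @ zeros N) (code_of r2 @ zeros N)"
    proof (rule cases)
      assume "r2 \<in> set (live tab)"
      then show ?thesis using lt_leaf_unique[OF inv r1(1) _ r1(2) r2(2)] by simp
    next
      fix c assume c: "r2 = new c"
      have "bit_segment (leaf_of r) v"
        using r2(2) unfolding c new ru by (rule bit_segment_prefix[rotated]) simp
      then have "r1 = r" using lt_leaf_unique[OF inv r1(1) r(1) r1(2)] by simp
      then show ?thesis by (simp add: c new)
    qed
  qed
  ultimately show thesis using r(1) ru that by blast
qed

section \<open>Tapes with a head\<close>

text \<open>The cells to the left of the head, in reverse order, and the cells from the head onwards.
  All further cells are blank.\<close>

type_synonym zipper = "symbol list \<times> symbol list"

fun scan :: "zipper \<Rightarrow> symbol" where
  "scan (ls, []) = Blank"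
| "scan (ls, s # rs) = s"

fun shift :: "direction \<Rightarrow> zipper \<Rightarrow> zipper" where
  "shift Left ([], rs) = ([], rs)"
| "shift Left (l # ls, rs) = (ls, l # rs)"
| "shift Stay z = z"
| "shift Right (ls, rs) = (scan (ls, rs) # ls, tl rs)"

text \<open>An action writes a symbol, or leaves the scanned one, and moves.\<close>

type_synonym action = "symbol option \<times> direction"

text \<open>A blank written at the end is dropped, so that an erased tape is \<open>([], [])\<close>.\<close>

fun put :: "symbol option \<Rightarrow> zipper \<Rightarrow> zipper" where
  "put None z = z"
| "put (Some s) (ls, rs) = (ls, if s = Blank \<and> tl rs = [] then [] else s # tl rs)"

definition act :: "action \<Rightarrow> zipper \<Rightarrow> zipper" where
  "act a z = shift (snd a) (put (fst a) z)"

definition cells :: "zipper \<Rightarrow> nat \<Rightarrow> symbol" where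
  "cells z i = (let s = rev (fst z) @ snd z in if i < length s then s ! i else Blank)"

lemma scan_cells: "cells z (length (fst z)) = scan z"
  by (cases z rule: scan.cases) (auto simp: cells_def nth_append)

definition written :: "symbol option \<Rightarrow> symbol \<Rightarrow> symbol" where
  "written w s = (case w of None \<Rightarrow> s | Some x \<Rightarrow> x)"

lemma cells_put: "cells (put w z) = (cells z)(length (fst z) := written w (scan z))"
proof -
  obtain ls rs where z: "z = (ls, rs)" by (cases z)
  show ?thesis
  proof (cases w)
    case None
    then show ?thesis by (simp add: written_def scan_cells[symmetric])
  next
    case (Some s)
    show ?thesis unfolding Some z written_def
      by (cases rs; rule ext; auto simp: cells_def nth_append Let_def nth_Cons split: nat.splits)
  qed
qed

lemma fst_put [simp]: "fst (put w z) = fst z"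
  by (cases "(w, z)" rule: put.cases) auto

lemma cells_shift: "cells (shift d z) = cells z"
  by (cases "(d, z)" rule: shift.cases; cases "snd z"; rule ext)
    (auto simp: cells_def nth_append Let_def nth_Cons split: nat.splits)

lemma length_fst_shift: "length (fst (shift d z)) = shift_head d (length (fst z))"
  by (cases "(d, z)" rule: shift.cases) auto

definition spelled :: "zipper \<Rightarrow> move" where
  "spelled z = map key (takeWhile is_Key (rev (fst z) @ snd z))"

lemma spelled_move_cells: "spelled_move (cells z) = spelled z"
proof -
  define s where "s = rev (fst z) @ snd z"
  let ?k = "length (takeWhile is_Key s)"
  have cells: "cells z i = (if i < length s then s ! i else Blank)" for i
    by (simp add: cells_def s_def)
  have "(LEAST n. \<not> is_Key (cells z n)) = ?k"
  proof (rule Least_equality)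
    show "\<not> is_Key (cells z ?k)" unfolding cells using nth_length_takeWhile[of is_Key s] by auto
    fix n assume no: "\<not> is_Key (cells z n)"
    show "?k \<le> n"
    proof (rule ccontr)
      assume "\<not> ?k \<le> n"
      then have n: "n < ?k" by simp
      then have "n < length s" using length_takeWhile_le[of is_Key s] by simp
      moreover have "is_Key (s ! n)"
        using nth_mem[OF n] takeWhile_nth[OF n] set_takeWhileD by metis
      ultimately show False using no by (simp add: cells)
    qed
  qed
  moreover have "map (\<lambda>i. key (cells z i)) [0..<?k] = map key (takeWhile is_Key s)"
    by (rule nth_equalityI)
      (auto simp: cells takeWhile_nth dest: order_less_le_trans[OF _ length_takeWhile_le])
  ultimately show ?thesis by (simp add: spelled_move_def spelled_def s_def)
qed

section \<open>The machines\<close>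

text \<open>A head at the leftmost cell stays there unnoticed, so loops that run to the left along
  the table or the counter need a mark in the first cell.\<close>

abbreviation Start :: symbol where "Start \<equiv> Aux 3"
abbreviation Live :: symbol where "Live \<equiv> Aux 4"
abbreviation Dead :: symbol where "Dead \<equiv> Aux 5"
abbreviation K :: "char \<Rightarrow> symbol" where "K \<equiv> Key"

text \<open>How the loose-to-tight machine answers a move: \<open>One\<close> copies an antecedent move to the leaves,
  \<open>Two\<close> copies a consequent move to the codes, \<open>Spl\<close> replaces a record by its two children.\<close>

datatype mode = One | Two | Spl

text \<open>The states that finish, emit and erase an output are shared by several tasks; the
  continuation remembers which one to resume once the output tape is empty.\<close>

datatype continuation = Next_Bit | Finish | Next_Record mode | Rewind_Table

datatype control =
    Init1 | Init2 | Permit | Wait | Read_Digit | Skip_Rest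
  | Copy_Rest continuation | Emit continuation | Erase continuation
  | Skip_Dot | Level | Level_Digit | Level_Dot | Level_Zeros0 | Level_Zeros | Level_Count
  | Level_Emit | Level_Colon | Level_Carry | Level_Return bool | Rewind_Level | Reply_Digit
  | Dot mode | Measure mode | Rewind mode | Rewind1 mode | Rewind2 mode
  | Test mode | To_Flag mode | Fail mode | Match mode | To_Front mode
  | Out_Digit mode | Out_Dot mode | Out_Record mode | Out_Pad0 mode | Out_Pad mode | Out_Pad_Back mode
  | Append | Append_Rewind bool | Append_Copy bool | Append_Flag bool | Table_End | Table_Rewind

text \<open>Countability supplies the coding \<open>to_nat\<close> of control states by numbers, as
  \<open>epm\<close> demands.\<close>

instance mode :: countable by countable_datatype
instance continuation :: countable by countable_datatype
instance control :: countable by countable_datatype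

abbreviation (input) nop :: action where "nop \<equiv> (None, Stay)"
abbreviation (input) go :: "direction \<Rightarrow> action" where "go d \<equiv> (None, d)"
abbreviation (input) wr :: "symbol \<Rightarrow> direction \<Rightarrow> action" where "wr s d \<equiv> (Some s, d)"

fun resume :: "continuation \<Rightarrow> control \<times> direction \<times> action \<times> action \<times> action" where
  "resume Next_Bit = (Level, Right, nop, nop, nop)"
| "resume Finish = (Skip_Rest, Stay, nop, nop, nop)"
| "resume (Next_Record m) = (Rewind m, Stay, nop, go Right, nop)"
| "resume Rewind_Table = (Table_End, Stay, nop, nop, nop)"

definition terminator :: "mode \<Rightarrow> symbol" where
  "terminator m = (if m = Spl then K (CHR '':'') else K (CHR ''.''))"

text \<open>The arguments are the symbols scanned on the run tape, the output tape, the table and the unary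
  counter. With \<open>g = True\<close> this is the tight-to-loose machine, with \<open>g = False\<close> the loose-to-tight one.\<close>

fun step :: "bool \<Rightarrow> control \<Rightarrow> symbol \<Rightarrow> symbol \<Rightarrow> symbol \<Rightarrow> symbol \<Rightarrow>
    control \<times> direction \<times> action \<times> action \<times> action" where
  "step g Init1 r a b d = (Init2, Stay, nop, wr Start Right, wr Start Right)"
| "step g Init2 r a b d = (Permit, Stay, nop, wr Live Stay, nop)"
| "step g Permit r a b d = (Wait, Stay, nop, nop, nop)"
| "step g Wait r a b d =
    (if r = Blank then (Permit, Stay, nop, nop, nop) else (Read_Digit, Right, nop, nop, nop))"
| "step g Read_Digit r a b d =
    (if g then
       if r = K (CHR ''1'') then (Copy_Rest Finish, Right, wr (K (CHR ''2'')) Right, nop, nop)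
       else (Skip_Dot, Right, nop, nop, nop)
     else (Dot (if r = K (CHR ''1'') then One else Two), Right, nop, nop, nop))"
| "step g Skip_Rest r a b d =
    (if r = Blank then (Permit, Stay, nop, nop, nop) else (Skip_Rest, Right, nop, nop, nop))"
| "step g (Copy_Rest k) r a b d =
    (if is_Key r then (Copy_Rest k, Right, wr r Right, nop, nop) else (Emit k, Stay, nop, nop, nop))"
| "step g (Emit k) r a b d = (Erase k, Stay, go Left, nop, nop)"
| "step g (Erase k) r a b d =
    (if a = Blank then resume k else (Erase k, Stay, wr Blank Left, nop, nop))"
| "step g Skip_Dot r a b d = (Level, Right, nop, nop, nop)"
| "step g Level r a b d =
    (if r = K (CHR ''.'') then (Rewind_Level, Stay, nop, nop, nop)
     else (Level_Digit, Stay, nop, nop, nop))"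
| "step g Level_Digit r a b d = (Level_Dot, Stay, wr (K (CHR ''1'')) Right, nop, nop)"
| "step g Level_Dot r a b d = (Level_Zeros0, Stay, wr (K (CHR ''.'')) Right, nop, nop)"
| "step g Level_Zeros0 r a b d = (Level_Zeros, Stay, nop, nop, go Left)"
| "step g Level_Zeros r a b d =
    (if d = Filler then (Level_Zeros, Stay, wr (K (CHR ''0'')) Right, nop, go Left)
     else (Level_Count, Stay, wr (K (CHR '':'')) Right, nop, go Right))"
| "step g Level_Count r a b d =
    (if d = Filler then (Level_Count, Stay, nop, nop, go Right)
     else (Level_Emit, Stay, nop, nop, wr Filler Right))"
| "step g Level_Emit r a b d = (Level_Colon, Stay, go Left, nop, nop)"
| "step g Level_Colon r a b d = (Level_Carry, Stay, go Left, nop, nop)"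
| "step g Level_Carry r a b d =
    (if a = K (CHR ''1'') then (Level_Carry, Stay, wr (K (CHR ''0'')) Left, nop, nop)
     else if a = K (CHR ''0'') then (Level_Return True, Stay, wr (K (CHR ''1'')) Stay, nop, nop)
     else (Level_Return False, Stay, nop, nop, nop))"
| "step g (Level_Return c) r a b d =
    (if a = Blank then
       if c then (Level_Emit, Stay, nop, nop, nop) else (Erase Next_Bit, Stay, go Left, nop, nop)
     else (Level_Return c, Stay, go Right, nop, nop))"
| "step g Rewind_Level r a b d =
    (if r = Label Bot then (Reply_Digit, Right, nop, nop, nop)
     else (Rewind_Level, Left, nop, nop, nop))"
| "step g Reply_Digit r a b d = (Copy_Rest Finish, Right, wr (K (CHR ''1'')) Right, nop, nop)"
| "step g (Dot m) r a b d = (Measure m, Right, nop, nop, nop)"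
| "step g (Measure m) r a b d =
    (if r = K (CHR ''.'') then (Rewind m, Stay, nop, nop, wr Filler Right)
     else if r = K (CHR '':'') then (Rewind Spl, Stay, nop, nop, wr Filler Right)
     else (Measure m, Right, nop, nop, wr Filler Right))"
| "step g (Rewind m) r a b d =
    (if r = Label Bot then (Rewind1 m, Right, nop, nop, nop) else (Rewind m, Left, nop, nop, nop))"
| "step g (Rewind1 m) r a b d = (Rewind2 m, Right, nop, nop, nop)"
| "step g (Rewind2 m) r a b d = (Test m, Right, nop, nop, nop)"
| "step g (Test m) r a b d =
    (if b = Blank then (Table_End, Stay, nop, nop, nop)
     else if b = Live then
       if r = terminator m then (Match m, Stay, nop, nop, nop)
       else if m = One \<and> r = K (CHR ''0'') then (Test m, Right, nop, nop, nop)
       else (Fail m, Stay, nop, nop, nop)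
     else if b = Dead then (Fail m, Stay, nop, nop, nop)
     else if b = Filler \<and> m \<noteq> One then (Test m, Stay, nop, go Right, nop)
     else if r = K (CHR ''.'') then (To_Flag m, Stay, nop, nop, nop)
     else if r = (if b = Filler then K (CHR ''0'') else b) then (Test m, Right, nop, go Right, nop)
     else (Fail m, Stay, nop, nop, nop))"
| "step g (To_Flag m) r a b d =
    (if b = Live then (Match m, Stay, nop, nop, nop)
     else if b = Dead then (Fail m, Stay, nop, nop, nop)
     else (To_Flag m, Stay, nop, go Right, nop))"
| "step g (Fail m) r a b d =
    (if b = Live \<or> b = Dead then (Rewind m, Stay, nop, go Right, nop)
     else (Fail m, Stay, nop, go Right, nop))"
| "step g (Match m) r a b d =
    (To_Front m, Stay, nop, (if m = Spl then Some Dead else None, Left), nop)"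
| "step g (To_Front m) r a b d =
    (if b = Live \<or> b = Dead \<or> b = Start then (Out_Digit m, Stay, nop, go Right, nop)
     else (To_Front m, Stay, nop, go Left, nop))"
| "step g (Out_Digit m) r a b d =
    (Out_Dot m, Stay,
     wr (case m of One \<Rightarrow> K (CHR ''2'') | Two \<Rightarrow> K (CHR ''1'') | Spl \<Rightarrow> Start) Right, nop, nop)"
| "step g (Out_Dot m) r a b d =
    (Out_Record m, Stay, if m = Spl then nop else wr (K (CHR ''.'')) Right, nop, nop)"
| "step g (Out_Record m) r a b d =
    (if b = Live \<or> b = Dead then (Out_Pad0 m, Stay, nop, nop, nop)
     else (Out_Record m, Stay,
       if b = Filler then
         case m of One \<Rightarrow> nop | Two \<Rightarrow> wr (K (CHR ''0'')) Right | Spl \<Rightarrow> wr Filler Right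
       else wr b Right, go Right, nop))"
| "step g (Out_Pad0 m) r a b d =
    (if m = One then (Copy_Rest (Next_Record m), Stay, nop, nop, nop)
     else (Out_Pad m, Stay, nop, nop, go Left))"
| "step g (Out_Pad m) r a b d =
    (if d = Filler then
       (Out_Pad m, Stay, wr (if m = Spl then Filler else K (CHR ''0'')) Right, nop, go Left)
     else (Out_Pad_Back m, Stay, nop, nop, go Right))"
| "step g (Out_Pad_Back m) r a b d =
    (if d = Filler then (Out_Pad_Back m, Stay, nop, nop, go Right)
     else (if m = Spl then Append else Copy_Rest (Next_Record m), Stay, nop, nop, nop))"
| "step g Append r a b d =
    (if b = Blank then (Append_Rewind False, Stay, nop, nop, nop)
     else (Append, Stay, nop, go Right, nop))"
| "step g (Append_Rewind c) r a b d =
    (if a = Start then (Append_Copy c, Stay, go Right, nop, nop)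
     else (Append_Rewind c, Stay, go Left, nop, nop))"
| "step g (Append_Copy c) r a b d =
    (if a = Blank then
       (Append_Flag c, Stay, nop, wr (if c then K (CHR ''1'') else K (CHR ''0'')) Right, nop)
     else (Append_Copy c, Stay, go Right, wr a Right, nop))"
| "step g (Append_Flag c) r a b d =
    (if c then (Erase Rewind_Table, Stay, go Left, wr Live Right, nop)
     else (Append_Rewind True, Stay, nop, wr Live Right, nop))"
| "step g Table_End r a b d = (Table_Rewind, Stay, nop, go Left, nop)"
| "step g Table_Rewind r a b d =
    (if b = Start then (Skip_Rest, Stay, nop, go Right, nop)
     else (Table_Rewind, Stay, nop, go Left, nop))"

section \<open>The machines as EPMs: finitely many states and symbols\<close>

definition emitting :: "control \<Rightarrow> bool" where
  "emitting q \<longleftrightarrow> q = Level_Emit \<or> (\<exists>k. q = Emit k)"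

lemma finite_mode: "finite (UNIV :: mode set)"
  by (rule finite_subset[of _ "{One, Two, Spl}"]) (auto intro: mode.exhaust)

lemma finite_continuation: "finite (UNIV :: continuation set)"
proof (rule finite_subset)
  show "UNIV \<subseteq> {Next_Bit, Finish, Rewind_Table} \<union> range Next_Record"
    by (auto intro: continuation.exhaust)
qed (simp add: finite_mode)

lemma finite_control: "finite (UNIV :: control set)"
proof (rule finite_subset)
  let ?modes = "\<Union>f \<in> {Dot, Measure, Rewind, Rewind1, Rewind2, Test, To_Flag, Fail, Match, To_Front,
    Out_Digit, Out_Dot, Out_Record, Out_Pad0, Out_Pad, Out_Pad_Back}. range f"
  let ?conts = "\<Union>f \<in> {Copy_Rest, Emit, Erase}. range f"
  let ?bools = "\<Union>f \<in> {Level_Return, Append_Rewind, Append_Copy, Append_Flag}. range f"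
  let ?single = "{Init1, Init2, Permit, Wait, Read_Digit, Skip_Rest, Skip_Dot, Level, Level_Digit,
    Level_Dot, Level_Zeros0, Level_Zeros, Level_Count, Level_Emit, Level_Colon, Level_Carry,
    Rewind_Level, Reply_Digit, Append, Table_End, Table_Rewind}"
  show "UNIV \<subseteq> ?modes \<union> ?conts \<union> ?bools \<union> ?single"
  proof
    fix q show "q \<in> ?modes \<union> ?conts \<union> ?bools \<union> ?single" by (cases q) simp_all
  qed
  show "finite (?modes \<union> ?conts \<union> ?bools \<union> ?single)"
    by (auto simp: finite_mode finite_continuation)
qed

definition machine_alphabet :: "symbol set" where
  "machine_alphabet = {Blank} \<union> range Key \<union> range Label \<union> {Filler, Start, Live, Dead}"

text \<open>Moves of the run head to the right are suppressed on a blank. The head thus never passes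
  the end of the position, and when it waits there it stands on the first symbol of whatever is
  appended next.\<close>

definition machine :: "bool \<Rightarrow> epm" where
  "machine g = \<lparr>
     control_states = range (to_nat :: control \<Rightarrow> nat),
     alphabet = machine_alphabet,
     start_state = to_nat Init1,
     move_states = to_nat ` Collect emitting,
     permission_states = {to_nat Permit},
     work_tapes = 3,
     transition = (\<lambda>n v r cs.
       case step g (from_nat n) r (cs ! 0) (cs ! 1) (cs ! 2) of (q, dr, (wa, da), (wb, db), (wd, dd)) \<Rightarrow>
         (to_nat q, Stay, if r = Blank \<and> dr = Right then Stay else dr,
          [(written wa (cs ! 0), da), (written wb (cs ! 1), db), (written wd (cs ! 2), dd)]))\<rparr>"

text \<open>Whatever is written is one of the fixed symbols or has just been scanned on some
  tape.\<close>

lemma step_writes: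
  assumes "step g q r a b d = (q', dr, (wa, da), (wb, db), (wd, dd))"
    and "{r, a, b, d} \<subseteq> machine_alphabet"
  shows "{written wa a, written wb b, written wd d} \<subseteq> machine_alphabet"
proof -
  have [simp]: "Blank \<in> machine_alphabet" "K c \<in> machine_alphabet" "Filler \<in> machine_alphabet"
    "Start \<in> machine_alphabet" "Live \<in> machine_alphabet" "Dead \<in> machine_alphabet" for c
    by (auto simp: machine_alphabet_def)
  show ?thesis
  proof (cases q)
    case (Erase k)
    then show ?thesis using assms by (cases k) (auto simp: written_def split: if_splits)
  next
    case (Out_Digit m)
    then show ?thesis using assms by (cases m) (auto simp: written_def)
  next
    case (Out_Record m)
    then show ?thesis using assms by (cases m) (auto simp: written_def split: if_splits)
  qed (use assms in \<open>auto simp: written_def split: if_splits\<close>)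
qed

lemma UNIV_player: "(UNIV :: player set) = {Top, Bot}"
  using player.exhaust by auto

lemma is_epm_machine: "is_epm (machine g)"
proof -
  have fin: "finite machine_alphabet"
    by (simp add: machine_alphabet_def UNIV_player)
  have "case transition (machine g) n v r cs of (q', dv, dr, acts) \<Rightarrow>
      q' \<in> control_states (machine g) \<and> length acts = work_tapes (machine g) \<and>
      fst ` set acts \<subseteq> alphabet (machine g)"
    if alph: "r \<in> alphabet (machine g)" "length cs = work_tapes (machine g)"
      "set cs \<subseteq> alphabet (machine g)" for n v r cs
  proof -
    obtain a b d where cs: "cs = [a, b, d]"
      using alph(2) by (auto simp: machine_def numeral_3_eq_3 length_Suc_conv)
    obtain q dr wa da wb db wd dd where
      s: "step g (from_nat n) r a b d = (q, dr, (wa, da), (wb, db), (wd, dd))"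
      by (metis prod.exhaust)
    have "{written wa a, written wb b, written wd d} \<subseteq> machine_alphabet"
      using step_writes[OF s] alph cs by (simp add: machine_def)
    then show ?thesis using cs s by (simp add: machine_def)
  qed
  moreover have "{Blank} \<union> range Key \<union> range Label \<subseteq> machine_alphabet"
    by (auto simp: machine_alphabet_def)
  ultimately show ?thesis
    unfolding is_epm_def
    by (auto simp: machine_def fin finite_control emitting_def inj_image_mem_iff)
qed

section \<open>Computations\<close>

definition enc :: "position \<Rightarrow> symbol list" where
  "enc \<Phi> = concat (map (\<lambda>(p, \<alpha>). Label p # map Key \<alpha>) \<Phi>)"

lemma enc_simps [simp]:
  "enc [] = []" "enc ((p, \<alpha>) # \<Phi>) = Label p # map Key \<alpha> @ enc \<Phi>"
  "enc (\<Phi> @ \<Psi>) = enc \<Phi> @ enc \<Psi>"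
  by (simp_all add: enc_def)

lemma run_tape_enc: "enc \<Phi> = rev ls @ rs \<Longrightarrow> run_tape \<Phi> (length ls) = scan (ls, rs)"
  unfolding run_tape_def enc_def[symmetric] Let_def
  by (cases rs) (auto simp: nth_append)

type_synonym cfg = "control \<times> position \<times> zipper \<times> zipper \<times> zipper \<times> zipper"

text \<open>An emitted move is read off the output tape before the step acts on that tape, and it
  appears on the run tape at once. Moves of the environment are not modelled here, so
  \<open>reaches\<close> does not continue past \<open>Permit\<close>.\<close>

fun next_cfg :: "bool \<Rightarrow> cfg \<Rightarrow> cfg" where
  "next_cfg g (q, \<Phi>, R, A, B, D) =
    (case step g q (scan R) (scan A) (scan B) (scan D) of (q', dr, aa, ba, da) \<Rightarrow>
      let out = (if emitting q then [(Top, spelled A)] else []);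
        dr' = (if scan R = Blank \<and> dr = Right then Stay else dr) in
      (q', \<Phi> @ out, shift dr' (fst R, snd R @ enc out), act aa A, act ba B, act da D))"

text \<open>The lemmas about loops reduce reaching an arbitrary target from the start of a loop to
  reaching it from the end. In this backward form they chain by resolution, and a computation is
  proved from its last phase to its first.\<close>

inductive reaches :: "bool \<Rightarrow> cfg \<Rightarrow> cfg \<Rightarrow> bool" for g where
  halt: "reaches g c c"
| step: "fst c \<noteq> Permit \<Longrightarrow> reaches g (next_cfg g c) c' \<Longrightarrow> reaches g c c'"

fun represents :: "config \<Rightarrow> cfg \<Rightarrow> bool" where
  "represents c (q, \<Phi>, (ls, rs), A, B, D) \<longleftrightarrow>
    state c = to_nat q \<and> pos c = \<Phi> \<and> run_head c = length ls \<and> enc \<Phi> = rev ls @ rs \<and>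
    works c = map (\<lambda>z. (cells z, length (fst z))) [A, B, D]"

lemma cells_act: "cells (act (w, d) z) = (cells z)(length (fst z) := written w (scan z))"
  by (simp add: act_def cells_shift cells_put)

lemma length_fst_act: "length (fst (act (w, d) z)) = shift_head d (length (fst z))"
  by (simp add: act_def length_fst_shift)

lemma rev_shift:
  "shift d z = (ls', rs') \<Longrightarrow> \<not> (snd z = [] \<and> d = Right) \<Longrightarrow> rev ls' @ rs' = rev (fst z) @ snd z"
  by (cases "(d, z)" rule: shift.cases; cases "snd z") auto

lemma enc_no_Blank: "Blank \<notin> set (enc \<Phi>)"
  by (auto simp: enc_def)

text \<open>The list \<open>out\<close> is what the step has appended, by whichever player, so
  ordinary steps and permission steps are covered together.\<close>

lemma successor_represents:
  assumes rep: "represents c cfg" and succ: "successor (machine g) e c c'"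
    and cfg: "cfg = (q, \<Phi>, (ls, rs), A, B, D)"
    and pos: "pos c' = \<Phi> @ out"
  shows "\<exists>dr' q' aa ba da. step g q (scan (ls, rs)) (scan A) (scan B) (scan D) = (q', dr', aa, ba, da) \<and>
    represents c' (q', \<Phi> @ out,
      shift (if scan (ls, rs) = Blank \<and> dr' = Right then Stay else dr') (ls, rs @ enc out),
      act aa A, act ba B, act da D)"
proof -
  obtain q' dr wa da wb db wd dd where
    s: "step g q (scan (ls, rs)) (scan A) (scan B) (scan D) = (q', dr, (wa, da), (wb, db), (wd, dd))"
    by (metis prod.exhaust)
  have r: "state c = to_nat q" "pos c = \<Phi>" "run_head c = length ls" "enc \<Phi> = rev ls @ rs"
    "works c = [(cells A, length (fst A)), (cells B, length (fst B)), (cells D, length (fst D))]"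
    using rep cfg by auto
  have scans: "map (\<lambda>(t, h). t h) (works c) = [scan A, scan B, scan D]"
    using r by (simp add: scan_cells)
  let ?dr = "if scan (ls, rs) = Blank \<and> dr = Right then Stay else dr"
  have c': "state c' = to_nat q'" "run_head c' = shift_head ?dr (length ls)"
    "works c' = [(cells (act (wa, da) A), length (fst (act (wa, da) A))),
      (cells (act (wb, db) B), length (fst (act (wb, db) B))),
      (cells (act (wd, dd) D), length (fst (act (wd, dd) D)))]"
    using succ unfolding successor_def scans r(1) r(2) r(3) run_tape_enc[OF r(4)]
    by (auto simp: machine_def s r(5) cells_act length_fst_act scan_cells)
  obtain ls' rs' where sh: "shift ?dr (ls, rs @ enc out) = (ls', rs')" by (metis prod.exhaust)
  \<comment> \<open>The suppressed move matters here: with \<open>rs\<close> empty, a move to the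
    right would insert a blank into the encoded position.\<close>
  have "rev ls' @ rs' = rev ls @ rs @ enc out"
    using rev_shift[OF sh] by (cases rs) auto
  moreover have "length ls' = shift_head ?dr (length ls)"
    using length_fst_shift[of ?dr "(ls, rs @ enc out)"] sh by simp
  ultimately have "represents c' (q', \<Phi> @ out, (ls', rs'), act (wa, da) A, act (wb, db) B, act (wd, dd) D)"
    using c' pos r(4) by simp
  then show ?thesis using s sh by auto
qed

lemma to_nat_move_states [simp]: "to_nat q \<in> move_states (machine g) \<longleftrightarrow> emitting q"
  by (auto simp: machine_def inj_image_mem_iff)

lemma to_nat_permission_states [simp]: "to_nat q \<in> permission_states (machine g) \<longleftrightarrow> q = Permit"
  by (auto simp: machine_def)

lemma represents_next:
  assumes "represents c cfg" "fst cfg \<noteq> Permit" "successor (machine g) e c c'"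
  shows "represents c' (next_cfg g cfg)"
proof -
  obtain q \<Phi> ls rs A B D where cfg: "cfg = (q, \<Phi>, (ls, rs), A, B, D)" by (metis prod.exhaust)
  let ?out = "if emitting q then [(Top, spelled A)] else []"
  have r: "state c = to_nat q" "pos c = \<Phi>" "fst (works c ! 0) = cells A" using assms(1) cfg by auto
  have "pos c' \<in> next_positions (machine g) c"
    using assms(3) by (auto simp: successor_def split: prod.splits)
  then have "pos c' = \<Phi> @ ?out"
    using r assms(2) cfg by (auto simp: next_positions_def spelled_move_cells split: if_splits)
  from successor_represents[OF assms(1,3) cfg this] show ?thesis
    by (auto simp: cfg Let_def)
qed

lemma represents_permit:
  assumes rep: "represents c (Permit, \<Phi>, (ls, rs), A, B, D)" and succ: "successor (machine g) e c c'"
  obtains (idle) "represents c' (Wait, \<Phi>, (ls, rs), A, B, D)"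
  | (moved) m where "represents c' (Wait, \<Phi> @ [(Bot, m)], (ls, rs @ enc [(Bot, m)]), A, B, D)"
proof -
  have r: "state c = to_nat Permit" "pos c = \<Phi>" using rep by auto
  have "pos c' \<in> next_positions (machine g) c"
    using succ by (auto simp: successor_def split: prod.splits)
  then consider "pos c' = \<Phi> @ []" | m where "pos c' = \<Phi> @ [(Bot, m)]"
    using r by (auto simp: next_positions_def emitting_def split: if_splits)
  then show thesis
  proof cases
    case 1
    from successor_represents[OF rep succ refl this] show thesis
      by (intro idle) (auto simp: act_def split: if_splits)
  next
    case (2 m)
    from successor_represents[OF rep succ refl this] show thesis
      by (intro moved) (auto simp: act_def split: if_splits)
  qed
qed

text \<open>Away from \<open>Permit\<close> the environment has no choice, so every branch has to
  follow \<open>next_cfg\<close>.\<close>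

lemma reaches_branch:
  assumes "reaches g cfg cfg'" "represents (C n) cfg"
    and C: "\<And>n. successor (machine g) e (C n) (C (Suc n))"
  shows "\<exists>k \<ge> n. represents (C k) cfg'"
  using assms(1,2)
proof (induction arbitrary: n rule: reaches.induct)
  case (step c c')
  from represents_next[OF step.prems step.hyps(1) C] step.IH show ?case by (meson Suc_leD)
qed blast

section \<open>Rounds between grants of permission\<close>

definition encode_table :: "table \<Rightarrow> symbol list" where
  "encode_table tab = concat (map (\<lambda>(b, r). r @ [if b then Live else Dead]) tab)"

text \<open>\<open>\<Phi>\<close> has been processed and \<open>\<Psi>\<close> is not yet read. The
  table head is on the first record and the counter head behind the last filler, so table and
  counter are all that is carried from round to round.\<close>

definition at_rest :: "control \<Rightarrow> position \<Rightarrow> position \<Rightarrow> table \<Rightarrow> nat \<Rightarrow> cfg" where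
  "at_rest q \<Phi> \<Psi> tab N =
    (q, \<Phi> @ \<Psi>, (rev (enc \<Phi>), enc \<Psi>), ([], []), ([Start], encode_table tab),
     (replicate N Filler @ [Start], []))"

lemma reaches_init: "reaches g (Init1, [], ([], []), ([], []), ([], []), ([], [])) (at_rest Permit [] [] [(True, [])] 0)"
  by (rule reaches.step, simp, rule reaches.step)
    (auto intro: reaches.halt simp: act_def at_rest_def encode_table_def emitting_def Let_def)

lemma reaches_idle: "reaches g (at_rest Wait \<Phi> [] tab N) (at_rest Permit \<Phi> [] tab N)"
  by (rule reaches.step) (auto intro: reaches.halt simp: act_def at_rest_def emitting_def Let_def)

text \<open>As long as the environment moves legally, every grant of permission is followed by
  another one. The first illegal move after a rest makes the run \<open>Bot\<close>-illegal, because
  the position before it is legal. The relation \<open>rel\<close> is carried along since the limit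
  argument compares consecutive tables.\<close>

lemma play:
  fixes P :: "table \<Rightarrow> nat \<Rightarrow> position \<Rightarrow> bool"
  assumes branch: "computation_branch (machine g) e C" and spells: "spells C \<Gamma>"
    and closed: "limit_closed L"
    and init: "P [(True, [])] 0 []"
    and legal: "\<And>tab N \<Phi>. P tab N \<Phi> \<Longrightarrow> Fin \<Phi> \<in> L"
    and reply: "\<And>tab N \<Phi> m. P tab N \<Phi> \<Longrightarrow> Fin (\<Phi> @ [(Bot, m)]) \<in> L \<Longrightarrow>
      \<exists>tab' N' \<Phi>'. P tab' N' \<Phi>' \<and> rel tab N tab' N' \<and>
        reaches g (at_rest Wait \<Phi> [(Bot, m)] tab N) (at_rest Permit \<Phi>' [] tab' N')"
    and rel_refl: "\<And>tab N \<Phi>. P tab N \<Phi> \<Longrightarrow> rel tab N tab N"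
  obtains (illegal) "illegal_by Bot L \<Gamma>"
  | (fair) F N tab where "fair_branch (machine g) C" "approximates F \<Gamma>"
      "\<And>k. P (tab k) (N k) (F k)" "\<And>k. rel (tab k) (N k) (tab (Suc k)) (N (Suc k))"
proof -
  have succ: "\<And>n. successor (machine g) e (C n) (C (Suc n))" and C0: "C 0 = initial_config (machine g)"
    using branch by (auto simp: computation_branch_def)
  define rest where "rest = (\<lambda>(tab, N, \<Phi>) t. P tab N \<Phi> \<and> represents (C t) (at_rest Permit \<Phi> [] tab N))"
  show thesis
  proof (cases "\<exists>tab N \<Phi> t m. rest (tab, N, \<Phi>) t \<and> pos (C (Suc t)) = \<Phi> @ [(Bot, m)] \<and>
      Fin (\<Phi> @ [(Bot, m)]) \<notin> L")
    case True
    then obtain tab N \<Phi> t m where *: "P tab N \<Phi>" "pos (C (Suc t)) = \<Phi> @ [(Bot, m)]"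
      "Fin (\<Phi> @ [(Bot, m)]) \<notin> L" by (auto simp: rest_def)
    have "initial_segment (\<Phi> @ [(Bot, m)]) \<Gamma>"
      using spells *(2) unfolding spells_def by (metis prefix_order.refl)
    moreover have "Fin \<Psi> \<in> L" if "strict_prefix \<Psi> (\<Phi> @ [(Bot, m)])" for \<Psi>
    proof -
      have "prefix \<Psi> \<Phi>" using that by (auto simp: strict_prefix_def)
      then show ?thesis using limit_closedD1[OF closed legal[OF *(1)]] by simp
    qed
    ultimately have "illegal_by Bot L \<Gamma>" using *(3) unfolding illegal_by_def by blast
    then show thesis by (rule illegal)
  next
    case False
    have "represents (C 0) (Init1, [], ([], []), ([], []), ([], []), ([], []))"
      by (simp add: C0 initial_config_def machine_def cells_def[abs_def] numeral_3_eq_3)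
    from reaches_branch[where C = C and n = 0, OF reaches_init this succ]
    obtain t0 where "represents (C t0) (at_rest Permit [] [] [(True, [])] 0)" by blast
    then have start: "rest ([(True, [])], 0, []) t0" using init by (simp add: rest_def)
    have next_rest: "\<exists>s' t'. rest s' t' \<and> t < t' \<and>
        (case s of (tab, N, \<Phi>) \<Rightarrow> case s' of (tab', N', \<Phi>') \<Rightarrow> rel tab N tab' N')"
      if rest: "rest s t" for s t
    proof -
      obtain tab N \<Phi> where s: "s = (tab, N, \<Phi>)" by (metis prod.exhaust)
      have inv: "P tab N \<Phi>" and rep: "represents (C t) (at_rest Permit \<Phi> [] tab N)"
        using rest s by (auto simp: rest_def)
      from rep[unfolded at_rest_def] succ[of t] show ?thesis
      proof (rule represents_permit)
        assume "represents (C (Suc t)) (Wait, \<Phi> @ [], (rev (enc \<Phi>), enc []), ([], []),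
          ([Start], encode_table tab), replicate N Filler @ [Start], [])"
        then have "represents (C (Suc t)) (at_rest Wait \<Phi> [] tab N)" by (simp add: at_rest_def)
        from reaches_branch[where C = C and n = "Suc t", OF reaches_idle this succ]
        obtain k where "Suc t \<le> k" "represents (C k) (at_rest Permit \<Phi> [] tab N)" by blast
        then have "rest (tab, N, \<Phi>) k \<and> t < k" using inv by (simp add: rest_def)
        then show ?thesis using rel_refl[OF inv] s by (intro exI[of _ "(tab, N, \<Phi>)"] exI[of _ k]) simp
      next
        fix m
        assume "represents (C (Suc t)) (Wait, (\<Phi> @ []) @ [(Bot, m)],
          (rev (enc \<Phi>), enc [] @ enc [(Bot, m)]), ([], []),
          ([Start], encode_table tab), replicate N Filler @ [Start], [])"
        then have rep': "represents (C (Suc t)) (at_rest Wait \<Phi> [(Bot, m)] tab N)"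
          by (simp add: at_rest_def)
        then have "pos (C (Suc t)) = \<Phi> @ [(Bot, m)]" by (simp add: at_rest_def)
        then have "Fin (\<Phi> @ [(Bot, m)]) \<in> L" using False rest s by blast
        from reply[OF inv this] obtain tab' N' \<Phi>' where *: "P tab' N' \<Phi>'" "rel tab N tab' N'"
          "reaches g (at_rest Wait \<Phi> [(Bot, m)] tab N) (at_rest Permit \<Phi>' [] tab' N')" by blast
        from reaches_branch[where C = C and n = "Suc t", OF *(3) rep' succ]
        obtain k where "Suc t \<le> k" "represents (C k) (at_rest Permit \<Phi>' [] tab' N')" by blast
        then have "rest (tab', N', \<Phi>') k \<and> t < k" using *(1) by (simp add: rest_def)
        then show ?thesis using *(2) s by (intro exI[of _ "(tab', N', \<Phi>')"] exI[of _ k]) simp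
      qed
    qed
    \<comment> \<open>The strictly increasing times give fairness, and their unboundedness makes the
      resting positions cofinal in the run.\<close>
    have "\<exists>f. \<forall>n. (case f n of (s, t) \<Rightarrow> rest s t) \<and>
      (case f n of (s, t) \<Rightarrow> case f (Suc n) of (s', t') \<Rightarrow> t < t' \<and>
        (case s of (tab, N, \<Phi>) \<Rightarrow> case s' of (tab', N', \<Phi>') \<Rightarrow> rel tab N tab' N'))"
      by (rule dependent_nat_choice) (use start next_rest in fastforce)+
    then obtain f where f: "\<And>n. (case f n of (s, t) \<Rightarrow> rest s t) \<and>
      (case f n of (s, t) \<Rightarrow> case f (Suc n) of (s', t') \<Rightarrow> t < t' \<and>
        (case s of (tab, N, \<Phi>) \<Rightarrow> case s' of (tab', N', \<Phi>') \<Rightarrow> rel tab N tab' N'))" by blast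
    define T where "T n = snd (f n)" for n
    define tab where "tab n = fst (fst (f n))" for n
    define N where "N n = fst (snd (fst (f n)))" for n
    define F where "F n = snd (snd (fst (f n)))" for n
    have inv_n: "P (tab n) (N n) (F n)"
      and rep_n: "represents (C (T n)) (at_rest Permit (F n) [] (tab n) (N n))"
      and less: "T n < T (Suc n)" and rel_n: "rel (tab n) (N n) (tab (Suc n)) (N (Suc n))" for n
      using f[of n] by (auto simp: T_def tab_def N_def F_def rest_def case_prod_beta)
    have "strict_mono T" using less by (simp add: strict_mono_Suc_iff)
    have pos: "pos (C (T n)) = F n" and st: "state (C (T n)) = to_nat Permit" for n
      using rep_n[of n] by (simp_all add: at_rest_def)
    have "infinite (range T)"
      using \<open>strict_mono T\<close> by (simp add: range_inj_infinite strict_mono_imp_inj_on)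
    moreover have "range T \<subseteq> {n. state (C n) \<in> permission_states (machine g)}" using st by auto
    ultimately have "fair_branch (machine g) C" unfolding fair_branch_def using finite_subset by blast
    moreover have "approximates F \<Gamma>"
      unfolding approximates_def
    proof
      fix \<Phi>
      have "(\<exists>n. prefix \<Phi> (pos (C n))) \<longleftrightarrow> (\<exists>k. prefix \<Phi> (pos (C (T k))))"
        using branch_prefix[OF branch] strict_mono_imp_increasing[OF \<open>strict_mono T\<close>]
        by (meson prefix_order.trans)
      then show "initial_segment \<Phi> \<Gamma> \<longleftrightarrow> (\<exists>k. prefix \<Phi> (F k))"
        using spells unfolding spells_def pos by simp
    qed
    ultimately show thesis using inv_n rel_n by (rule fair)
  qed
qed

section \<open>Loops shared by the machines\<close>

declare act_def [simp] emitting_def [simp] Let_def [simp]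

lemma reaches_step:
  "q \<noteq> Permit \<Longrightarrow> reaches g (next_cfg g (q, \<Phi>, R, A, B, D)) c \<Longrightarrow> reaches g (q, \<Phi>, R, A, B, D) c"
  by (rule reaches.step) simp_all

lemma skip_rest:
  assumes "Blank \<notin> set rs" "reaches g (Permit, \<Phi>, (rev rs @ ls, []), A, B, D) c"
  shows "reaches g (Skip_Rest, \<Phi>, (ls, rs), A, B, D) c"
  using assms
proof (induction rs arbitrary: ls)
  case Nil
  then show ?case by (intro reaches_step) simp_all
next
  case (Cons s rs)
  then show ?case by (intro reaches_step) auto
qed

lemma copy_rest:
  assumes "\<not> is_Key (scan ([], rs))"
    "reaches g (Emit k, \<Phi>, (rev (map Key \<alpha>) @ ls, rs), (rev (map Key \<alpha>) @ as, []), B, D) c"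
  shows "reaches g (Copy_Rest k, \<Phi>, (ls, map Key \<alpha> @ rs), (as, []), B, D) c"
  using assms(2)
proof (induction \<alpha> arbitrary: ls as)
  case Nil
  have "scan (ls, rs) = scan ([], rs)" by (cases rs) auto
  with Nil assms(1) show ?case by (intro reaches_step) simp_all
next
  case (Cons a \<alpha>)
  then show ?case by (intro reaches_step) simp_all
qed

text \<open>At the first cell the head cannot go further left; it then scans the blank it has just
  written, which ends the loop without any mark.\<close>

lemma erase:
  assumes "Blank \<notin> set as" "x \<noteq> Blank" "reaches g (Erase k, \<Phi>, R, ([], []), B, D) c"
  shows "reaches g (Erase k, \<Phi>, R, (as, [x]), B, D) c"
  using assms
proof (induction as arbitrary: x)
  case Nil
  then show ?case by (intro reaches_step) (cases R, simp_all)
next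
  case (Cons a as)
  then show ?case by (intro reaches_step) (cases R, auto)
qed

lemma spelled_keys: "spelled (rev (map Key \<beta>), []) = \<beta>"
proof -
  have "takeWhile is_Key (map Key \<beta>) = map Key \<beta>" by (simp add: takeWhile_eq_all_conv)
  then show ?thesis
    unfolding spelled_def fst_conv snd_conv append_Nil2 rev_rev_ident by (simp only: map_map comp_def symbol.sel map_ident)
qed

text \<open>\<open>\<beta>\<close> has been composed by the machine and \<open>\<alpha>\<close> is
  copied from the run tape. Copying stops at a label or at the blank after the position, which are
  not keys.\<close>

lemma reply_rest:
  assumes "\<not> is_Key (scan ([], rs))" "\<beta> @ \<alpha> \<noteq> []"
    "reaches g (Erase k, \<Phi> @ [(Top, \<beta> @ \<alpha>)],
      (rev (map Key \<alpha>) @ ls, rs @ enc [(Top, \<beta> @ \<alpha>)]), ([], []), B, D) c"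
  shows "reaches g (Copy_Rest k, \<Phi>, (ls, map Key \<alpha> @ rs), (rev (map Key \<beta>), []), B, D) c"
proof (rule copy_rest[OF assms(1)])
  let ?A = "rev (map Key (\<beta> @ \<alpha>))"
  obtain s as where A: "?A = Key s # as" "Blank \<notin> set as"
  proof (cases "\<beta> @ \<alpha>" rule: rev_cases)
    case (snoc \<gamma> s)
    show thesis by (rule that[of s "rev (map Key \<gamma>)"]) (simp_all add: snoc del: map_append, auto)
  qed (use assms(2) in simp)
  have "reaches g (Erase k, \<Phi> @ [(Top, \<beta> @ \<alpha>)],
      (rev (map Key \<alpha>) @ ls, rs @ enc [(Top, \<beta> @ \<alpha>)]), (as, [Key s]), B, D) c"
    using A(2) assms(3) by (intro erase) simp_all
  moreover have "spelled (Key s # as, []) = \<beta> @ \<alpha>" using spelled_keys A(1) by metis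
  ultimately have "reaches g (Emit k, \<Phi>, (rev (map Key \<alpha>) @ ls, rs), (Key s # as, []), B, D) c"
    by (intro reaches_step) simp_all
  then show "reaches g (Emit k, \<Phi>, (rev (map Key \<alpha>) @ ls, rs), (rev (map Key \<alpha>) @ rev (map Key \<beta>), []), B, D) c"
    using A(1) by simp
qed

section \<open>The tight-to-loose machine\<close>

text \<open>The starting point is written with \<open>shift Left\<close>, as seen just after a move
  to the left, so that the empty counter, where the head lands on \<open>Start\<close>, is no
  special case. The other loops to the left are stated in the same form.\<close>

lemma level_zeros:
  assumes "reaches g (Level_Count, \<Phi>, R, (K (CHR '':'') # replicate j (K (CHR ''0'')) @ as, []), B,
    ([Start], replicate j Filler @ ds)) c"
  shows "reaches g (Level_Zeros, \<Phi>, R, (as, []), B, shift Left (replicate j Filler @ [Start], ds)) c"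
  using assms
proof (induction j arbitrary: as ds)
  case 0
  then show ?case by (intro reaches_step) (cases R, simp_all)
next
  case (Suc j)
  from Suc.IH[of "K (CHR ''0'') # as" "Filler # ds"] Suc.prems show ?case
    by (intro reaches_step) (cases R, simp_all add: replicate_app_Cons_same)
qed

text \<open>On its way back the counter head adds one filler, since replicating the level increases
  the depth by one.\<close>

lemma level_count:
  assumes "reaches g (Level_Emit, \<Phi>, R, A, B, (Filler # replicate j Filler @ ds, [])) c"
  shows "reaches g (Level_Count, \<Phi>, R, A, B, (ds, replicate j Filler)) c"
  using assms
proof (induction j arbitrary: ds)
  case 0
  then show ?case by (intro reaches_step) (cases R, simp_all)
next
  case (Suc j)
  from Suc.IH[of "Filler # ds"] Suc.prems show ?case
    by (intro reaches_step) (cases R, simp_all add: replicate_app_Cons_same)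
qed

lemma level_return:
  assumes "reaches g (Level_Return b, \<Phi>, R, (rev (map Key s) @ as, []), B, D) c"
  shows "reaches g (Level_Return b, \<Phi>, R, (as, map Key s), B, D) c"
  using assms
proof (induction s arbitrary: as)
  case (Cons x s)
  then show ?case by (intro reaches_step) (cases R, simp_all)
qed simp

text \<open>The binary counter between the prefix and the colon runs through all words, which ends with
  the carry out of its first digit.\<close>

lemma level_sweep:
  assumes "reaches g (Level_Carry, \<Phi> @ map (\<lambda>w. (Top, ''1.'' @ p @ w @ '':'')) (words k),
      (ls, rs @ enc (map (\<lambda>w. (Top, ''1.'' @ p @ w @ '':'')) (words k))),
      shift Left (rev (map Key (''1.'' @ p)), map Key (zeros k @ '':'')), B, D) c"
  shows "reaches g (Level_Emit, \<Phi>, (ls, rs), (rev (map Key (''1.'' @ p @ zeros k @ '':'')), []), B, D) c"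
  using assms
proof (induction k arbitrary: p \<Phi> rs c)
  case 0
  have sp: "spelled (rev (map Key (''1.'' @ p @ '':'')), []) = ''1.'' @ p @ '':''"
    by (rule spelled_keys)
  obtain x xs where x: "rev (map Key (''1.'' @ p)) = x # xs" by (cases "rev (map Key (''1.'' @ p))") auto
  show ?case
    using 0 sp x by (intro reaches_step) (simp_all, intro reaches_step, simp_all)
next
  case (Suc k)
  let ?out = "\<lambda>p. map (\<lambda>w. (Top, ''1.'' @ p @ w @ '':'')) (words k)"
  let ?\<Phi> = "\<Phi> @ ?out (p @ ''0'')" and ?rs = "rs @ enc (?out (p @ ''0''))"
  let ?\<Phi>' = "?\<Phi> @ ?out (p @ ''1'')" and ?rs' = "?rs @ enc (?out (p @ ''1''))"
  have words: "map (\<lambda>w. (Top, ''1.'' @ p @ w @ '':'')) (words (Suc k)) = ?out (p @ ''0'') @ ?out (p @ ''1'')"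
    by (simp add: comp_def)
  \<comment> \<open>This is the end of the second half: the leading digit overflows from 1 to 0 and
    passes the carry on to \<open>p\<close>. The carry out of the first half, further below, turns
    that digit from 0 into 1 and is absorbed.\<close>
  have "reaches g (Level_Carry, ?\<Phi>', (ls, ?rs'),
      (rev (map Key (''1.'' @ p)), map Key (''1'' @ zeros k @ '':'')), B, D) c"
    using Suc.prems unfolding words by (intro reaches_step) simp_all
  then have "reaches g (Level_Emit, ?\<Phi>, (ls, ?rs),
      (rev (map Key (''1.'' @ (p @ ''1'') @ zeros k @ '':'')), []), B, D) c"
    by (intro Suc.IH) simp
  then have "reaches g (Level_Return True, ?\<Phi>, (ls, ?rs),
      (rev (map Key (''1'' @ zeros k @ '':'')) @ rev (map Key (''1.'' @ p)), []), B, D) c"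
    by (intro reaches_step) simp_all
  then have "reaches g (Level_Return True, ?\<Phi>, (ls, ?rs),
      (rev (map Key (''1.'' @ p)), map Key (''1'' @ zeros k @ '':'')), B, D) c"
    by (rule level_return)
  then have "reaches g (Level_Carry, ?\<Phi>, (ls, ?rs),
      (rev (map Key (''1.'' @ p)), map Key (''0'' @ zeros k @ '':'')), B, D) c"
    by (intro reaches_step) simp_all
  then have "reaches g (Level_Emit, \<Phi>, (ls, rs),
      (rev (map Key (''1.'' @ (p @ ''0'') @ zeros k @ '':'')), []), B, D) c"
    by (intro Suc.IH) simp
  then show ?case by simp
qed

abbreviation replicate_moves :: "string list \<Rightarrow> position" where
  "replicate_moves cs \<equiv> map (\<lambda>c. (Top, CHR ''1'' # CHR ''.'' # c @ '':'')) cs"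

lemma level:
  assumes "b \<noteq> CHR ''.''"
    "reaches g (Level, \<Phi> @ replicate_moves (words n), (Key b # ls, rs @ enc (replicate_moves (words n))),
      ([], []), B, (replicate (Suc n) Filler @ [Start], [])) c"
  shows "reaches g (Level, \<Phi>, (ls, Key b # rs), ([], []), B, (replicate n Filler @ [Start], [])) c"
proof -
  let ?\<Phi> = "\<Phi> @ replicate_moves (words n)"
  let ?R = "(ls, Key b # rs @ enc (replicate_moves (words n)))"
  let ?D = "(replicate (Suc n) Filler @ [Start], [])"
  let ?s = "''1.'' @ zeros n @ '':''"
  have "reaches g (Erase Next_Bit, ?\<Phi>, ?R, ([], []), B, ?D) c"
    using assms by (intro reaches_step) simp_all
  then have "reaches g (Erase Next_Bit, ?\<Phi>, ?R, (tl (rev (map Key ?s)), [Key (CHR '':'')]), B, ?D) c"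
    by (intro erase) auto
  then have "reaches g (Level_Return False, ?\<Phi>, ?R, (rev (map Key ?s), []), B, ?D) c"
    by (intro reaches_step) simp_all
  then have "reaches g (Level_Return False, ?\<Phi>, ?R,
      ([Key (CHR ''1'')], map Key (''.'' @ zeros n @ '':'')), B, ?D) c"
    by (intro level_return) simp
  then have "reaches g (Level_Carry, ?\<Phi>, ?R,
      ([Key (CHR ''1'')], map Key (''.'' @ zeros n @ '':'')), B, ?D) c"
    by (intro reaches_step) simp_all
  then have "reaches g (Level_Emit, \<Phi>, (ls, Key b # rs), (rev (map Key (''1.'' @ [] @ zeros n @ '':'')), []), B, ?D) c"
    by (intro level_sweep) simp
  then have "reaches g (Level_Count, \<Phi>, (ls, Key b # rs), (rev (map Key ?s), []), B,
      ([Start], replicate n Filler)) c"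
    by (intro level_count) simp
  then have "reaches g (Level_Zeros, \<Phi>, (ls, Key b # rs), (rev (map Key ''1.''), []), B,
      shift Left (replicate n Filler @ [Start], [])) c"
    by (intro level_zeros) (simp add: rev_map[symmetric])
  then have "reaches g (Level_Zeros0, \<Phi>, (ls, Key b # rs), (rev (map Key ''1.''), []), B,
      (replicate n Filler @ [Start], [])) c"
    by (intro reaches_step) simp_all
  then have "reaches g (Level_Dot, \<Phi>, (ls, Key b # rs), (rev (map Key ''1''), []), B,
      (replicate n Filler @ [Start], [])) c"
    by (intro reaches_step) simp_all
  then have "reaches g (Level_Digit, \<Phi>, (ls, Key b # rs), ([], []), B,
      (replicate n Filler @ [Start], [])) c"
    by (intro reaches_step) simp_all
  then show ?thesis using assms(1) by (intro reaches_step) simp_all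
qed

text \<open>One level is replicated for each bit of \<open>w\<close> read, so \<open>w\<close> on
  the run tape itself counts the levels.\<close>

lemma levels:
  assumes "bitstring w"
    "reaches g (Level, \<Phi> @ replicate_moves (replications n (length w)),
      (rev (map Key w) @ ls, rs @ enc (replicate_moves (replications n (length w)))),
      ([], []), B, (replicate (n + length w) Filler @ [Start], [])) c"
  shows "reaches g (Level, \<Phi>, (ls, map Key w @ rs), ([], []), B, (replicate n Filler @ [Start], [])) c"
  using assms
proof (induction w arbitrary: n \<Phi> ls rs)
  case (Cons b w)
  let ?\<Phi> = "\<Phi> @ replicate_moves (words n)"
  have "reaches g (Level, ?\<Phi>, (Key b # ls, map Key w @ rs @ enc (replicate_moves (words n))),
      ([], []), B, (replicate (Suc n) Filler @ [Start], [])) c"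
    using Cons.prems by (intro Cons.IH) simp_all
  then show ?case using Cons.prems(1) by (auto intro!: level)
qed simp

lemma rewind_level:
  assumes "Label Bot \<notin> set us" "reaches g (Reply_Digit, \<Phi>, (Label Bot # ls, rev us @ rs), A, B, D) c"
  shows "reaches g (Rewind_Level, \<Phi>, shift Left (us @ Label Bot # ls, rs), A, B, D) c"
  using assms
proof (induction us arbitrary: rs)
  case Nil
  then show ?case by (intro reaches_step) simp_all
next
  case (Cons u us)
  then show ?case by (intro reaches_step) auto
qed

lemma not_key_enc: "\<not> is_Key (scan ([], enc \<Phi>))"
  by (cases \<Phi>) auto

lemma tl_copy_reply:
  assumes "m = CHR ''1'' # CHR ''.'' # h"
  shows "reaches True (at_rest Wait \<Phi> [(Bot, m)] tab N)
    (at_rest Permit (\<Phi> @ (Bot, m) # [(Top, CHR ''2'' # CHR ''.'' # h)]) [] tab N)" (is "reaches _ _ ?c")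
proof -
  let ?B = "([Start], encode_table tab)" and ?D = "(replicate N Filler @ [Start], []::symbol list)"
  let ?o = "[(Top, CHR ''2'' # CHR ''.'' # h)]"
  have "reaches True (Skip_Rest, (\<Phi> @ [(Bot, m)]) @ ?o,
     (rev (map Key (CHR ''.'' # h)) @ Key (CHR ''1'') # Label Bot # rev (enc \<Phi>), enc ?o), ([], []), ?B, ?D) ?c"
    by (rule skip_rest) (auto simp: at_rest_def assms intro: reaches.halt)
  then have "reaches True (Erase Finish, (\<Phi> @ [(Bot, m)]) @ ?o,
     (rev (map Key (CHR ''.'' # h)) @ Key (CHR ''1'') # Label Bot # rev (enc \<Phi>), enc ?o), ([], []), ?B, ?D) ?c"
    by (intro reaches_step) simp_all
  then have "reaches True (Copy_Rest Finish, \<Phi> @ [(Bot, m)],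
     (Key (CHR ''1'') # Label Bot # rev (enc \<Phi>), map Key (CHR ''.'' # h) @ []),
     (rev (map Key ''2''), []), ?B, ?D) ?c"
    by (intro reply_rest) simp_all
  then have "reaches True (Read_Digit, \<Phi> @ [(Bot, m)],
     (Label Bot # rev (enc \<Phi>), map Key m), ([], []), ?B, ?D) ?c"
    by (intro reaches_step) (simp_all add: assms)
  then show ?thesis unfolding at_rest_def[of Wait] by (intro reaches_step) simp_all
qed

text \<open>The move is read twice: first its address drives the replications, then it is copied
  from its beginning with the digit 1 in place of 2. By that time the replications stand behind it
  on the run tape, which is where the copying stops.\<close>

lemma tl_deepen_reply:
  assumes w: "bitstring w" and m: "m = CHR ''2'' # CHR ''.'' # w @ CHR ''.'' # \<alpha>"
  shows "reaches True (at_rest Wait \<Phi> [(Bot, m)] tab N)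
    (at_rest Permit (\<Phi> @ (Bot, m) # replicate_moves (replications N (length w)) @
      [(Top, CHR ''1'' # CHR ''.'' # w @ CHR ''.'' # \<alpha>)]) [] tab (N + length w))" (is "reaches _ _ ?c")
proof -
  let ?B = "([Start], encode_table tab)" and ?D = "(replicate (N + length w) Filler @ [Start], []::symbol list)"
  let ?o = "[(Top, CHR ''1'' # CHR ''.'' # w @ CHR ''.'' # \<alpha>)]"
  let ?rep = "replicate_moves (replications N (length w))"
  let ?\<Phi> = "(\<Phi> @ [(Bot, m)]) @ ?rep"
  let ?ls = "Key (CHR ''2'') # Label Bot # rev (enc \<Phi>)"
  let ?rest = "CHR ''.'' # w @ CHR ''.'' # \<alpha>"
  have "Blank \<notin> set (enc (?rep @ ?o))" by (rule enc_no_Blank)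
  then have "reaches True (Skip_Rest, ?\<Phi> @ ?o,
     (rev (map Key ?rest) @ ?ls, enc ?rep @ enc ?o), ([], []), ?B, ?D) ?c"
    by (intro skip_rest) (auto simp: at_rest_def m intro: reaches.halt)
  then have "reaches True (Erase Finish, ?\<Phi> @ ?o,
     (rev (map Key ?rest) @ ?ls, enc ?rep @ enc ?o), ([], []), ?B, ?D) ?c"
    by (intro reaches_step) simp_all
  then have "reaches True (Copy_Rest Finish, ?\<Phi>,
     (?ls, map Key ?rest @ enc ?rep), (rev (map Key ''1''), []), ?B, ?D) ?c"
    by (intro reply_rest not_key_enc) simp_all
  then have "reaches True (Reply_Digit, ?\<Phi>,
     (Label Bot # rev (enc \<Phi>), rev (rev (map Key (''2.'' @ w))) @ map Key (''.'' @ \<alpha>) @ enc ?rep),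
       ([], []), ?B, ?D) ?c"
    by (intro reaches_step) simp_all
  then have "reaches True (Rewind_Level, ?\<Phi>,
     shift Left (rev (map Key (''2.'' @ w)) @ Label Bot # rev (enc \<Phi>), map Key (''.'' @ \<alpha>) @ enc ?rep),
       ([], []), ?B, ?D) ?c"
    by (intro rewind_level) auto
  then have "reaches True (Rewind_Level, ?\<Phi>,
     (rev (map Key (''2.'' @ w)) @ Label Bot # rev (enc \<Phi>), map Key (''.'' @ \<alpha>) @ enc ?rep),
       ([], []), ?B, ?D) ?c"
    by (intro reaches_step) simp_all
  then have "reaches True (Level, ?\<Phi>,
     (rev (map Key w) @ Key (CHR ''.'') # ?ls, (map Key (''.'' @ \<alpha>)) @ enc ?rep), ([], []), ?B, ?D) ?c"
    by (intro reaches_step) simp_all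
  then have "reaches True (Level, \<Phi> @ [(Bot, m)],
     (Key (CHR ''.'') # ?ls, map Key w @ map Key (''.'' @ \<alpha>)), ([], []), ?B,
     (replicate N Filler @ [Start], [])) ?c"
    by (intro levels[OF w]) simp_all
  then have "reaches True (Skip_Dot, \<Phi> @ [(Bot, m)],
     (?ls, map Key (CHR ''.'' # w @ ''.'' @ \<alpha>)), ([], []), ?B,
     (replicate N Filler @ [Start], [])) ?c"
    by (intro reaches_step) simp_all
  then have "reaches True (Read_Digit, \<Phi> @ [(Bot, m)],
     (Label Bot # rev (enc \<Phi>), map Key m), ([], []), ?B, (replicate N Filler @ [Start], [])) ?c"
    by (intro reaches_step) (simp_all add: m)
  then show ?thesis unfolding at_rest_def[of Wait] by (intro reaches_step) simp_all
qed

section \<open>Winning from an invariant of the resting positions\<close>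

lemma illegal_won:
  assumes "limit_closed (Lr (imp_cgame X Y))" "illegal_by Bot (Lr (imp_cgame X Y)) \<Gamma>"
  shows "Wn (imp_cgame X Y) \<Gamma> = Top"
proof -
  obtain L W where L: "imp_cgame X Y = mk_cgame L W"
    unfolding imp_cgame_def pdisj_cgame_def by blast
  have "\<Gamma> \<notin> Lr (imp_cgame X Y)"
    using assms(2) limit_closedD1[OF assms(1), of \<Gamma>] unfolding illegal_by_def by blast
  with assms(2) show ?thesis unfolding L by (simp add: mk_cgame_def)
qed

text \<open>\<open>P\<close> ties the table and the counter to the position at rest. Each machine
  has to supply only the reply to one legal move and the choice of a partner for each
  thread.\<close>

lemma machine_wins:
  fixes P :: "table \<Rightarrow> nat \<Rightarrow> position \<Rightarrow> bool"
  assumes closed: "limit_closed (Lr X)" "limit_closed (Lr Y)"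
    and winner: "branching_winner A X" "branching_winner A Y"
    and init: "P [(True, [])] 0 []"
    and legal: "\<And>tab N \<Phi>. P tab N \<Phi> \<Longrightarrow> Fin \<Phi> \<in> Lr (imp_cgame X Y)"
    and reply: "\<And>tab N \<Phi> m. P tab N \<Phi> \<Longrightarrow> Fin (\<Phi> @ [(Bot, m)]) \<in> Lr (imp_cgame X Y) \<Longrightarrow>
      \<exists>tab' N' \<Phi>'. P tab' N' \<Phi>' \<and> rel tab N tab' N' \<and>
        reaches g (at_rest Wait \<Phi> [(Bot, m)] tab N) (at_rest Permit \<Phi>' [] tab' N')"
    and rel_refl: "\<And>tab N \<Phi>. P tab N \<Phi> \<Longrightarrow> rel tab N tab N"
    and threads: "\<And>F N tab v. (\<And>k. P (tab k) (N k) (F k)) \<Longrightarrow>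
      (\<And>k. rel (tab k) (N k) (tab (Suc k)) (N (Suc k))) \<Longrightarrow>
      \<exists>v'. \<forall>k. thread_pos v' (ante (F k)) = thread_pos v (cons (F k))"
  shows "wins (machine g) e (imp_cgame X Y)"
  unfolding wins_def
proof (intro allI impI)
  fix C \<Gamma> assume C: "computation_branch (machine g) e C \<and> spells C \<Gamma>"
  note closed' = imp_closed[OF closed]
  from conjunct1[OF C] conjunct2[OF C] closed' init legal reply rel_refl
  show "Wn (imp_cgame X Y) \<Gamma> = Top \<and>
    (fair_branch (machine g) C \<or> illegal_by Bot (Lr (imp_cgame X Y)) \<Gamma>)"
  proof (rule play)
    assume "illegal_by Bot (Lr (imp_cgame X Y)) \<Gamma>"
    then show ?thesis using illegal_won[OF closed'] by blast
  next
    fix F N tab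
    assume fair: "fair_branch (machine g) C" and F: "approximates F \<Gamma>"
      and P: "\<And>k. P (tab k) (N k) (F k)" "\<And>k. rel (tab k) (N k) (tab (Suc k)) (N (Suc k))"
    have "Wn (imp_cgame X Y) \<Gamma> = Top"
      by (rule imp_won[OF closed winner F legal[OF P(1)]])
        (rule threads[where F = F and N = N and tab = tab], fact P(1), fact P(2))
    with fair show ?thesis by blast
  qed
qed

lemma tight_implies_loose: "uniformly_valid (Imp (TightRec Atom) (LooseRec Atom))"
  unfolding uniformly_valid_def computes_def
proof (intro exI[of _ "machine True"] conjI allI impI is_epm_machine)
  fix G :: game and e
  assume "static_game G"
  then have A: "constant_game (G e)" by (simp add: static_game_def)
  \<comment> \<open>This machine leaves the table as it was initialized; its only memory is the
    counter.\<close>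
  let ?P = "\<lambda>(tab :: table) N \<Phi>. tab = [(True, [])] \<and> tl_inv (G e) N \<Phi>"
  have "wins (machine True) e (imp_cgame (tight_cgame (G e)) (loose_cgame (G e)))"
  proof (rule machine_wins[where P = ?P and rel = "\<lambda>_ _ _ _. True",
        OF limit_closed_tight limit_closed_loose branching_winner_tight branching_winner_loose])
    fix tab N \<Phi> m
    assume P: "?P tab N \<Phi>"
      and legal: "Fin (\<Phi> @ [(Bot, m)]) \<in> Lr (imp_cgame (tight_cgame (G e)) (loose_cgame (G e)))"
    from A conjunct2[OF P] legal
    show "\<exists>tab' N' \<Phi>'. ?P tab' N' \<Phi>' \<and> True \<and>
        reaches True (at_rest Wait \<Phi> [(Bot, m)] tab N) (at_rest Permit \<Phi>' [] tab' N')"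
    proof (cases rule: tl_step)
      case (copy h)
      then show ?thesis using P tl_copy_reply by blast
    next
      case (deepen w \<alpha>)
      then show ?thesis using P tl_deepen_reply[OF deepen(1,2)] by blast
    qed
  qed (use A tl_inv_init constant_game_limit_closed in \<open>auto simp: tl_inv_def\<close>)
  then show "wins (machine True) e (subst_game G (Imp (TightRec Atom) (LooseRec Atom)) e)"
    by (simp add: imp_cgame_def)
qed

section \<open>The loose-to-tight machine\<close>

abbreviation flag :: "bool \<Rightarrow> symbol" where "flag b \<equiv> (if b then Live else Dead)"

definition hit :: "mode \<Rightarrow> string \<Rightarrow> nat \<Rightarrow> symbol list \<Rightarrow> bool" where
  "hit m w N r = (case m of One \<Rightarrow> prefix w (code_of r @ zeros N) | Two \<Rightarrow> prefix w (leaf_of r)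
     | Spl \<Rightarrow> w = leaf_of r)"

lemma hit_simps [simp]:
  "hit One w N r \<longleftrightarrow> prefix w (code_of r @ zeros N)"
  "hit Two w N r \<longleftrightarrow> prefix w (leaf_of r)"
  "hit Spl w N r \<longleftrightarrow> w = leaf_of r"
  by (simp_all add: hit_def)

lemma terminator_simps [simp]:
  "terminator One = K (CHR ''.'')" "terminator Two = K (CHR ''.'')" "terminator Spl = K (CHR '':'')"
  by (simp_all add: terminator_def)

lemma fail_record:
  assumes "is_record r" "reaches g (Rewind m, \<Phi>, R, A, (flag b # rev r @ bs, bt), D) c"
  shows "reaches g (Fail m, \<Phi>, R, A, (bs, r @ flag b # bt), D) c"
  using assms
proof (induction r arbitrary: bs)
  case Nil
  then show ?case by (intro reaches_step) (cases R, simp_all)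
next
  case (Cons s r)
  then show ?case by (intro reaches_step) (cases R, auto)
qed

lemma flag_record:
  assumes "is_record r"
    "b \<Longrightarrow> reaches g (Match m, \<Phi>, R, A, (rev r @ bs, Live # bt), D) c"
    "\<not> b \<Longrightarrow> reaches g (Rewind m, \<Phi>, R, A, (Dead # rev r @ bs, bt), D) c"
  shows "reaches g (To_Flag m, \<Phi>, R, A, (bs, r @ flag b # bt), D) c"
  using assms
proof (induction r arbitrary: bs)
  case Nil
  have "reaches g (Fail m, \<Phi>, R, A, (bs, Dead # bt), D) c" if "\<not> b"
    using fail_record[of "[]" g m \<Phi> R A False bs bt D c] Nil that by simp
  with Nil show ?case by (intro reaches_step) (cases R, simp_all)
next
  case (Cons s r)
  then show ?case by (intro reaches_step) (cases R, auto)
qed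

lemma prefix_zeros: "length w \<le> N \<Longrightarrow> prefix w (zeros N) \<longleftrightarrow> set w \<subseteq> {CHR ''0''}"
proof (induction w arbitrary: N)
  case (Cons c w)
  then show ?case by (cases N) auto
qed simp

text \<open>Once the record is exhausted, the rest of the address is compared with the padding. The
  counter is not consulted: as the address is no longer than \<open>N\<close>, the padding cannot
  run out first.\<close>

lemma test_zeros:
  assumes "bitstring w"
    "set w \<subseteq> {CHR ''0''} \<Longrightarrow>
      reaches g (Match One, \<Phi>, (rev (map Key w) @ ls, K (CHR ''.'') # rs), A, (bs, Live # bt), D) c"
    "\<And>w1 w2. \<not> set w \<subseteq> {CHR ''0''} \<Longrightarrow> w = w1 @ w2 \<Longrightarrow> reaches g (Rewind One, \<Phi>,
      (rev (map Key w1) @ ls, map Key w2 @ K (CHR ''.'') # rs), A, (Live # bs, bt), D) c"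
  shows "reaches g (Test One, \<Phi>, (ls, map Key w @ K (CHR ''.'') # rs), A, (bs, Live # bt), D) c"
  using assms
proof (induction w arbitrary: ls)
  case Nil
  then show ?case by (intro reaches_step) simp_all
next
  case (Cons x w)
  show ?case
  proof (cases "x = CHR ''0''")
    case True
    have "reaches g (Test One, \<Phi>, (Key x # ls, map Key w @ K (CHR ''.'') # rs), A, (bs, Live # bt), D) c"
    proof (rule Cons.IH)
      fix w1 w2 assume "\<not> set w \<subseteq> {CHR ''0''}" "w = w1 @ w2"
      then show "reaches g (Rewind One, \<Phi>, (rev (map Key w1) @ Key x # ls,
          map Key w2 @ K (CHR ''.'') # rs), A, (Live # bs, bt), D) c"
        using Cons.prems(3)[of "x # w1" w2] by simp
    qed (use Cons.prems(1,2) True in simp_all)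
    with True show ?thesis by (intro reaches_step) simp_all
  next
    case False
    then have "reaches g (Fail One, \<Phi>, (ls, map Key (x # w) @ K (CHR ''.'') # rs), A,
        (bs, [] @ flag True # bt), D) c"
      using Cons.prems(3)[of "[]" "x # w"] by (intro fail_record) simp_all
    with False Cons.prems(1) show ?thesis by (intro reaches_step) simp_all
  qed
qed

text \<open>Only mode \<open>One\<close> compares fillers, as zeros; the others skip them and so
  compare with the leaf. In mode \<open>Spl\<close> the colon must meet the flag, which forces the
  whole leaf to match. A failure leaves the run head at an unspecified point of \<open>w\<close>,
  which the rewinding makes irrelevant.\<close>

lemma test_record:
  assumes "is_record r" "bitstring w" "length w \<le> N"
    "b \<Longrightarrow> hit m w N r \<Longrightarrow> reaches g (Match m, \<Phi>,
      (rev (map Key w) @ ls, terminator m # rs), A, (rev r @ bs, Live # bt), D) c"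
    "\<And>w1 w2. \<not> (b \<and> hit m w N r) \<Longrightarrow> w = w1 @ w2 \<Longrightarrow> reaches g (Rewind m, \<Phi>,
      (rev (map Key w1) @ ls, map Key w2 @ terminator m # rs), A, (flag b # rev r @ bs, bt), D) c"
  shows "reaches g (Test m, \<Phi>, (ls, map Key w @ terminator m # rs), A, (bs, r @ flag b # bt), D) c"
  using assms
proof (induction r arbitrary: w ls bs)
  case Nil
  have fail: "reaches g (Fail m, \<Phi>, (ls, map Key w @ terminator m # rs), A, (bs, flag b # bt), D) c"
    if "\<not> (b \<and> hit m w N [])"
    using fail_record[of "[]" g m \<Phi> _ A b bs bt D c] Nil.prems(5)[OF that, of "[]" w] by simp
  show ?case
  proof (cases b)
    case False
    then show ?thesis using fail by (intro reaches_step) simp_all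
  next
    case b: True
    show ?thesis
    proof (cases "m = One")
      case True
      then show ?thesis
        using Nil.prems b prefix_zeros[OF Nil.prems(3)] by (auto intro!: test_zeros)
    next
      case False
      show ?thesis
      proof (cases w)
        case Nil
        moreover have "hit m [] N []" by (cases m) simp_all
        ultimately show ?thesis using b False Nil.prems(4) by (intro reaches_step) simp_all
      next
        case (Cons x xs)
        then have "K x \<noteq> terminator m" using Nil.prems(2) by (cases m) auto
        moreover have "\<not> hit m (x # xs) N []" using False by (cases m) simp_all
        ultimately show ?thesis using b False fail Cons by (intro reaches_step) simp_all
      qed
    qed
  qed
next
  case (Cons s r)
  let ?R = "\<lambda>w1 w2. (rev (map Key w1) @ ls, map Key w2 @ terminator m # rs)"
  have fail: "reaches g (Fail m, \<Phi>, ?R [] w, A, (bs, (s # r) @ flag b # bt), D) c"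
    if "\<not> hit m w N (s # r)"
    using Cons.prems(5)[of "[]" w] that by (intro fail_record Cons.prems(1)) simp_all
  have to_flag: "reaches g (To_Flag m, \<Phi>, ?R [] w, A, (bs, (s # r) @ flag b # bt), D) c"
    if "hit m w N (s # r)" "w = []"
    using Cons.prems(4) Cons.prems(5)[of "[]" w] that by (intro flag_record Cons.prems(1)) simp_all
  have skip: "reaches g (Test m, \<Phi>, ?R [] w, A, (s # bs, r @ flag b # bt), D) c"
    if eq: "hit m w N (s # r) = hit m w N r"
  proof -
    have "reaches g (Test m, \<Phi>, (ls, map Key w @ terminator m # rs), A, (s # bs, r @ flag b # bt), D) c"
    proof (rule Cons.IH)
      fix w1 w2 assume "\<not> (b \<and> hit m w N r)" "w = w1 @ w2"
      then show "reaches g (Rewind m, \<Phi>, (rev (map Key w1) @ ls,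
          map Key w2 @ terminator m # rs), A, (flag b # rev r @ s # bs, bt), D) c"
        using Cons.prems(5)[of w1 w2] eq by (simp del: hit_simps)
    qed (use Cons.prems(1-4) eq in simp_all)
    then show ?thesis by simp
  qed
  have next_bit: "reaches g (Test m, \<Phi>, ?R [x] w', A, (s # bs, r @ flag b # bt), D) c"
    if w: "w = x # w'" and eq: "hit m w N (s # r) = hit m w' N r" for x w'
  proof -
    have "reaches g (Test m, \<Phi>, (K x # ls, map Key w' @ terminator m # rs), A,
        (s # bs, r @ flag b # bt), D) c"
    proof (rule Cons.IH)
      fix w1 w2 assume "\<not> (b \<and> hit m w' N r)" "w' = w1 @ w2"
      then show "reaches g (Rewind m, \<Phi>, (rev (map Key w1) @ K x # ls,
          map Key w2 @ terminator m # rs), A, (flag b # rev r @ s # bs, bt), D) c"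
        using Cons.prems(5)[of "x # w1" w2] w eq by simp
    qed (use Cons.prems(1-4) w eq in simp_all)
    then show ?thesis by simp
  qed
  consider "s = Filler" | y where "s = K y" "y = CHR ''0'' \<or> y = CHR ''1''"
    using Cons.prems(1) by auto
  then show ?case
  proof cases
    case s: 1
    show ?thesis
    proof (cases "m = One")
      case False
      then have "hit m w N (s # r) = hit m w N r" using s by (cases m) simp_all
      from skip[OF this] False s show ?thesis by (intro reaches_step) simp_all
    next
      case m: True
      show ?thesis
      proof (cases w)
        case Nil
        then show ?thesis using to_flag m s by (intro reaches_step) simp_all
      next
        case (Cons x w')
        show ?thesis
        proof (cases "x = CHR ''0''")
          case True
          then show ?thesis using next_bit[OF Cons] m s Cons by (intro reaches_step) simp_all
        next
          case False
          then show ?thesis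
            using fail Cons m s Cons.prems(2) by (intro reaches_step) (auto simp del: bitstring_Cons simp: bitstring_def)
        qed
      qed
    qed
  next
    case s: (2 y)
    show ?thesis
    proof (cases w)
      case Nil
      then show ?thesis
        using to_flag fail s by (intro reaches_step) (cases m; auto)+
    next
      case w: (Cons x w')
      have x: "x = CHR ''0'' \<or> x = CHR ''1''" using w Cons.prems(2) by simp
      show ?thesis
      proof (cases "x = y")
        case True
        have "hit m w N (s # r) = hit m w' N r" using True s w by (cases m) simp_all
        from next_bit[OF w this] show ?thesis using True s w x by (intro reaches_step) auto
      next
        case False
        have "\<not> hit m w N (s # r)" using False s w by (cases m) simp_all
        from fail[OF this] show ?thesis using False s w x by (intro reaches_step) auto
      qed
    qed
  qed
qed

lemma rewind:
  assumes "Label Bot \<notin> set us" "reaches g (Rewind1 m, \<Phi>, (Label Bot # ls, rev us @ rs), A, B, D) c"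
  shows "reaches g (Rewind m, \<Phi>, shift Left (us @ Label Bot # ls, rs), A, B, D) c"
  using assms
proof (induction us arbitrary: rs)
  case Nil
  then show ?case by (intro reaches_step) simp_all
next
  case (Cons u us)
  then show ?case by (intro reaches_step) auto
qed

abbreviation head_cells :: "char \<Rightarrow> symbol list \<Rightarrow> symbol list" where
  "head_cells d ls \<equiv> K (CHR ''.'') # K d # Label Bot # ls"

text \<open>The hypothesis keeps the loop from stopping where it starts; from there back to the
  label of the current move only keys are passed.\<close>

lemma rewind_test:
  assumes "scan ([], rs) \<noteq> Label Bot"
    "reaches g (Test m, \<Phi>, (head_cells d ls, map Key s @ rs), A, B, D) c"
  shows "reaches g (Rewind m, \<Phi>, (rev (map Key s) @ head_cells d ls, rs), A, B, D) c"
proof -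
  have "reaches g (Rewind2 m, \<Phi>, (K d # Label Bot # ls, K (CHR ''.'') # map Key s @ rs), A, B, D) c"
    using assms(2) by (intro reaches_step) simp_all
  then have "reaches g (Rewind1 m, \<Phi>, (Label Bot # ls, K d # K (CHR ''.'') # map Key s @ rs), A, B, D) c"
    by (intro reaches_step) simp_all
  then have *: "reaches g (Rewind m, \<Phi>,
      shift Left ((rev (map Key s) @ [K (CHR ''.''), K d]) @ Label Bot # ls, rs), A, B, D) c"
    by (intro rewind) auto
  obtain x xs where x: "rev (map Key s) @ head_cells d ls = x # xs"
    by (cases "rev (map Key s) @ head_cells d ls") auto
  have "scan (x # xs, rs) = scan ([], rs)" by (cases rs) auto
  with * assms(1) x show ?thesis by (intro reaches_step) simp_all
qed

section \<open>Writing the output for one record\<close>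

lemma to_front:
  assumes "is_record us" "f \<in> {Live, Dead, Start}"
    "reaches g (Out_Digit m, \<Phi>, R, A, (f # bs, rev us @ bt), D) c"
  shows "reaches g (To_Front m, \<Phi>, R, A, shift Left (us @ f # bs, bt), D) c"
  using assms
proof (induction us arbitrary: bt)
  case Nil
  then show ?case by (intro reaches_step) (cases R, auto)
next
  case (Cons u us)
  then show ?case by (intro reaches_step) (cases R, auto)
qed

fun copied :: "mode \<Rightarrow> symbol list \<Rightarrow> symbol list" where
  "copied One r = map Key (leaf_of r)"
| "copied Two r = map Key (code_of r)"
| "copied Spl r = r"

lemma out_record:
  assumes "is_record r"
    "reaches g (Out_Pad0 m, \<Phi>, R, (rev (copied m r) @ as, []), (rev r @ bs, flag b # bt), D) c"
  shows "reaches g (Out_Record m, \<Phi>, R, (as, []), (bs, r @ flag b # bt), D) c"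
  using assms
proof (induction r arbitrary: as bs)
  case Nil
  then show ?case by (intro reaches_step) (cases R; cases m; simp_all)+
next
  case (Cons s r)
  then show ?case by (intro reaches_step) (cases R; cases m; auto)+
qed

lemma out_pad:
  assumes "reaches g (Out_Pad_Back m, \<Phi>, R,
    (replicate j (if m = Spl then Filler else K (CHR ''0'')) @ as, []), B,
    ([Start], replicate j Filler @ ds)) c"
  shows "reaches g (Out_Pad m, \<Phi>, R, (as, []), B, shift Left (replicate j Filler @ [Start], ds)) c"
  using assms
proof (induction j arbitrary: as ds)
  case 0
  then show ?case by (intro reaches_step) (cases R, simp_all)
next
  case (Suc j)
  from Suc.IH[of "(if m = Spl then Filler else K (CHR ''0'')) # as" "Filler # ds"] Suc.prems show ?case
    by (intro reaches_step) (cases R, simp_all add: replicate_app_Cons_same split: if_splits)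
qed

lemma out_pad_back:
  assumes "reaches g (if m = Spl then Append else Copy_Rest (Next_Record m), \<Phi>, R, A, B,
    (replicate j Filler @ ds, [])) c"
  shows "reaches g (Out_Pad_Back m, \<Phi>, R, A, B, (ds, replicate j Filler)) c"
  using assms
proof (induction j arbitrary: ds)
  case 0
  then show ?case by (intro reaches_step) (cases R, simp_all)
next
  case (Suc j)
  from Suc.IH[of "Filler # ds"] Suc.prems show ?case
    by (intro reaches_step) (cases R, simp_all add: replicate_app_Cons_same)
qed

fun reply :: "mode \<Rightarrow> nat \<Rightarrow> symbol list \<Rightarrow> string \<Rightarrow> move" where
  "reply One N r \<alpha> = CHR ''2'' # CHR ''.'' # leaf_of r @ CHR ''.'' # \<alpha>"
| "reply Two N r \<alpha> = CHR ''1'' # CHR ''.'' # (code_of r @ zeros N) @ CHR ''.'' # \<alpha>"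
| "reply Spl N r \<alpha> = []"

text \<open>The symbol \<open>f\<close> is what precedes the record on the tape, the flag of another
  record or the mark of the first cell. In mode \<open>Spl\<close> the output tape serves as scratch
  space for a new record, so it is begun with \<open>Start\<close> instead of a move prefix.\<close>

lemma match_front:
  assumes r: "is_record r" and f: "f \<in> {Live, Dead, Start}"
    and "reaches g (Out_Record m, \<Phi>, R, (if m = Spl then [Start] else
      [K (CHR ''.''), if m = One then K (CHR ''2'') else K (CHR ''1'')], []),
      (f # bs, r @ flag (m \<noteq> Spl) # bt), D) c"
  shows "reaches g (Match m, \<Phi>, R, ([], []), (rev r @ f # bs, Live # bt), D) c"
proof -
  let ?B = "(f # bs, r @ flag (m \<noteq> Spl) # bt)"
  have "reaches g (Out_Dot m, \<Phi>, R,
      ([case m of One \<Rightarrow> K (CHR ''2'') | Two \<Rightarrow> K (CHR ''1'') | Spl \<Rightarrow> Start], []), ?B, D) c"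
    using assms(3) by (intro reaches_step) (cases R; cases m; simp_all)+
  then have "reaches g (Out_Digit m, \<Phi>, R, ([], []), (f # bs, rev (rev r) @ flag (m \<noteq> Spl) # bt), D) c"
    by (intro reaches_step) (cases R; cases m; simp)+
  then have *: "reaches g (To_Front m, \<Phi>, R, ([], []),
      shift Left (rev r @ f # bs, flag (m \<noteq> Spl) # bt), D) c"
    using r f by (intro to_front) (auto simp: is_record_def)
  show ?thesis
    by (rule reaches_step, simp) (use * in \<open>cases R; cases "m = Spl"; simp\<close>)
qed

lemma answer_record:
  assumes r: "is_record r" and f: "f \<in> {Live, Dead, Start}" and m: "m \<noteq> Spl"
    and X: "\<not> is_Key (scan ([], X))"
    and next_record: "reaches g (Rewind m, \<Phi> @ [(Top, reply m N r \<alpha>)],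
      (rev (map Key (CHR ''.'' # \<alpha>)) @ ls, X @ enc [(Top, reply m N r \<alpha>)]), ([], []),
      (Live # rev r @ f # bs, bt), (replicate N Filler @ [Start], [])) c"
  shows "reaches g (Match m, \<Phi>, (ls, map Key (CHR ''.'' # \<alpha>) @ X), ([], []),
    (rev r @ f # bs, Live # bt), (replicate N Filler @ [Start], [])) c"
proof -
  let ?\<beta> = "(if m = One then ''2.'' @ leaf_of r else ''1.'' @ code_of r @ zeros N)"
  let ?R = "(ls, map Key (CHR ''.'' # \<alpha>) @ X)"
  let ?D = "(replicate N Filler @ [Start], [])" and ?B = "(rev r @ f # bs, flag True # bt)"
  have \<beta>: "?\<beta> @ CHR ''.'' # \<alpha> = reply m N r \<alpha>" using m by (cases m) simp_all
  have "reaches g (Erase (Next_Record m), \<Phi> @ [(Top, reply m N r \<alpha>)],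
      (rev (map Key (CHR ''.'' # \<alpha>)) @ ls, X @ enc [(Top, reply m N r \<alpha>)]), ([], []), ?B, ?D) c"
    using next_record by (intro reaches_step) simp_all
  then have "reaches g (Copy_Rest (Next_Record m), \<Phi>, ?R, (rev (map Key ?\<beta>), []), ?B, ?D) c"
    unfolding \<beta>[symmetric] by (intro reply_rest X) simp_all
  then have "reaches g (Out_Pad0 m, \<Phi>, ?R, (rev (copied m r) @
      [K (CHR ''.''), if m = One then K (CHR ''2'') else K (CHR ''1'')], []), ?B, ?D) c"
  proof (cases m)
    case One
    assume "reaches g (Copy_Rest (Next_Record m), \<Phi>, ?R, (rev (map Key ?\<beta>), []), ?B, ?D) c"
    with One show ?thesis by (intro reaches_step) simp_all
  next
    case Two
    assume "reaches g (Copy_Rest (Next_Record m), \<Phi>, ?R, (rev (map Key ?\<beta>), []), ?B, ?D) c"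
    then have "reaches g (Out_Pad_Back m, \<Phi>, ?R, (rev (map Key ?\<beta>), []), ?B,
        ([Start], replicate N Filler)) c"
      using Two by (intro out_pad_back) simp
    then have "reaches g (Out_Pad m, \<Phi>, ?R, (rev (copied m r) @ [K (CHR ''.''), K (CHR ''1'')], []), ?B,
        shift Left (replicate N Filler @ [Start], [])) c"
      using Two by (intro out_pad) simp
    with Two show ?thesis by (intro reaches_step) simp_all
  qed (use m in simp)
  then have "reaches g (Out_Record m, \<Phi>, ?R, ([K (CHR ''.''), if m = One then K (CHR ''2'') else K (CHR ''1'')], []),
      (f # bs, r @ flag True # bt), ?D) c"
    by (intro out_record r)
  then show ?thesis using m by (intro match_front r f) simp
qed

section \<open>One pass over the table\<close>

lemma encode_table_simps [simp]:
  "encode_table [] = []" "encode_table ((b, r) # tab) = r @ flag b # encode_table tab"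
  "encode_table (t @ t') = encode_table t @ encode_table t'"
  by (simp_all add: encode_table_def)

lemma scan_miss:
  assumes "is_record r" "bitstring w" "length w \<le> N" "\<not> (b \<and> hit m w N r)"
    and t: "terminator m # rs = K t # rs"
    and "reaches g (Test m, \<Phi>, (head_cells d ls, map Key w @ terminator m # rs), A,
      (flag b # rev r @ bs, bt), D) c"
  shows "reaches g (Test m, \<Phi>, (head_cells d ls, map Key w @ terminator m # rs), A,
    (bs, r @ flag b # bt), D) c"
proof (rule test_record[OF assms(1-3)])
  fix w1 w2 assume w: "w = w1 @ w2"
  have "scan ([], map Key w2 @ terminator m # rs) \<noteq> Label Bot" using t by (cases w2) auto
  then show "reaches g (Rewind m, \<Phi>, (rev (map Key w1) @ head_cells d ls,
      map Key w2 @ terminator m # rs), A, (flag b # rev r @ bs, bt), D) c"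
    using assms(6) unfolding w by (intro rewind_test) simp_all
qed (use assms(4) in simp_all)

definition replies :: "mode \<Rightarrow> string \<Rightarrow> nat \<Rightarrow> string \<Rightarrow> table \<Rightarrow> position" where
  "replies m w N \<alpha> tab = map (\<lambda>r. (Top, reply m N r \<alpha>)) (filter (hit m w N) (live tab))"

lemma replies_simps [simp]:
  "replies m w N \<alpha> [] = []"
  "replies m w N \<alpha> ((b, r) # tab) =
    (if b \<and> hit m w N r then [(Top, reply m N r \<alpha>)] else []) @ replies m w N \<alpha> tab"
  by (simp_all add: replies_def)

text \<open>\<open>\<Psi>\<close> collects the replies already standing behind the current move on
  the run tape. Their label \<open>Top\<close> keeps the rewinding, which looks for
  \<open>Label Bot\<close>, from stopping at them.\<close>

lemma scan_table:
  assumes w: "bitstring w" "length w \<le> N" and m: "m \<noteq> Spl"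
    and "\<forall>x \<in> set tab. is_record (snd x)" "f \<in> {Live, Dead, Start}" "\<forall>x \<in> set \<Psi>. fst x = Top"
    and "reaches g (Test m, \<Phi> @ replies m w N \<alpha> tab,
      (head_cells d ls, map Key (w @ CHR ''.'' # \<alpha>) @ enc (\<Psi> @ replies m w N \<alpha> tab)), ([], []),
      (rev (encode_table tab) @ f # bs, []), (replicate N Filler @ [Start], [])) c"
  shows "reaches g (Test m, \<Phi>, (head_cells d ls, map Key (w @ CHR ''.'' # \<alpha>) @ enc \<Psi>), ([], []),
    (f # bs, encode_table tab), (replicate N Filler @ [Start], [])) c"
  using assms(4-)
proof (induction tab arbitrary: \<Phi> \<Psi> f bs)
  case (Cons x tab)
  obtain b r where x: "x = (b, r)" by (cases x)
  have r: "is_record r" using Cons.prems(1) x by simp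
  have t: "terminator m = K (CHR ''.'')" using m by (cases m) simp_all
  let ?D = "(replicate N Filler @ [Start], [])"
  show ?case
  proof (cases "b \<and> hit m w N r")
    case False
    have "reaches g (Test m, \<Phi>, (head_cells d ls, map Key (w @ CHR ''.'' # \<alpha>) @ enc \<Psi>), ([], []),
        (flag b # rev r @ f # bs, encode_table tab), ?D) c"
      using Cons.prems x False by (intro Cons.IH) auto
    then show ?thesis
      using scan_miss[OF r w False, of "map Key \<alpha> @ enc \<Psi>" "CHR ''.''" g \<Phi> d ls "([], [])"
          "f # bs" "encode_table tab" ?D c] t x by simp
  next
    case True
    let ?o = "[(Top, reply m N r \<alpha>)]"
    have "reaches g (Test m, \<Phi> @ ?o, (head_cells d ls, map Key (w @ CHR ''.'' # \<alpha>) @ enc (\<Psi> @ ?o)),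
        ([], []), (Live # rev r @ f # bs, encode_table tab), ?D) c"
      using Cons.prems x True by (intro Cons.IH) auto
    moreover have "scan ([], enc (\<Psi> @ ?o)) \<noteq> Label Bot"
      using Cons.prems(3) by (cases \<Psi>) auto
    ultimately have "reaches g (Rewind m, \<Phi> @ ?o,
        (rev (map Key (w @ CHR ''.'' # \<alpha>)) @ head_cells d ls, enc (\<Psi> @ ?o)),
        ([], []), (Live # rev r @ f # bs, encode_table tab), ?D) c"
      by (intro rewind_test)
    then have *: "reaches g (Match m, \<Phi>, (rev (map Key w) @ head_cells d ls,
        map Key (CHR ''.'' # \<alpha>) @ enc \<Psi>), ([], []),
        (rev r @ f # bs, Live # encode_table tab), ?D) c"
      using Cons.prems(2) by (intro answer_record r m not_key_enc) simp_all
    have "reaches g (Test m, \<Phi>, (head_cells d ls, map Key w @ terminator m # map Key \<alpha> @ enc \<Psi>),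
        ([], []), (f # bs, r @ flag b # encode_table tab), ?D) c"
      using * True t by (intro test_record[OF r w]) simp_all
    then show ?thesis using x t by simp
  qed
qed simp

lemma table_rewind:
  assumes "Start \<notin> set us" "reaches g (Skip_Rest, \<Phi>, R, A, ([Start], rev us @ bt), D) c"
  shows "reaches g (Table_Rewind, \<Phi>, R, A, shift Left (us @ [Start], bt), D) c"
  using assms
proof (induction us arbitrary: bt)
  case Nil
  then show ?case by (intro reaches_step) (cases R, simp_all)
next
  case (Cons u us)
  then show ?case by (intro reaches_step) (cases R, auto)
qed

lemma record_symbols: "is_record r \<Longrightarrow> Start \<notin> set r \<and> Blank \<notin> set r"
  by (auto simp: is_record_def)

lemma table_symbols:
  "\<forall>x \<in> set tab. is_record (snd x) \<Longrightarrow> Start \<notin> set (encode_table tab) \<and> Blank \<notin> set (encode_table tab)"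
  by (induction tab) (auto simp: record_symbols split: if_splits)

lemma finish_round:
  assumes "\<forall>x \<in> set tab. is_record (snd x)" "enc \<Phi> = rev ls @ rs"
  shows "reaches g (Table_End, \<Phi>, (ls, rs), ([], []), (rev (encode_table tab) @ [Start], []),
    (replicate N Filler @ [Start], [])) (at_rest Permit \<Phi> [] tab N)"
proof -
  let ?D = "(replicate N Filler @ [Start], [])"
  have "Blank \<notin> set rs" "rev rs @ ls = rev (enc \<Phi>)" using assms(2) enc_no_Blank[of \<Phi>] by auto
  then have "reaches g (Skip_Rest, \<Phi>, (ls, rs), ([], []), ([Start], rev (rev (encode_table tab)) @ []), ?D)
      (at_rest Permit \<Phi> [] tab N)"
    by (intro skip_rest) (auto simp: at_rest_def intro: reaches.halt)
  then have "reaches g (Table_Rewind, \<Phi>, (ls, rs), ([], []),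
      shift Left (rev (encode_table tab) @ [Start], []), ?D) (at_rest Permit \<Phi> [] tab N)"
    using table_symbols[OF assms(1)] by (intro table_rewind) simp_all
  then show ?thesis by (intro reaches_step) simp_all
qed

text \<open>Each symbol of the address adds a filler, and so does the terminator, whence the
  \<open>Suc\<close>. The terminator is also where a replicative move is recognized and the mode
  becomes \<open>Spl\<close>.\<close>

lemma measure:
  assumes "bitstring w" "t = CHR ''.'' \<or> t = CHR '':''"
    "reaches g (Rewind (if t = CHR ''.'' then m else Spl), \<Phi>, (rev (map Key w) @ ls, Key t # rs), A, B,
      (replicate (Suc (length w)) Filler @ ds, [])) c"
  shows "reaches g (Measure m, \<Phi>, (ls, map Key w @ Key t # rs), A, B, (ds, [])) c"
  using assms
proof (induction w arbitrary: ls ds)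
  case Nil
  then show ?case by (intro reaches_step) auto
next
  case (Cons x w)
  then show ?case by (intro reaches_step) (auto simp: replicate_app_Cons_same)
qed

lemma lt_start:
  assumes w: "bitstring w" and t: "t = CHR ''.'' \<or> t = CHR '':''"
    and msg: "m = d # CHR ''.'' # w @ t # \<alpha>"
    and N': "N' = N + Suc (length w)"
    and "reaches False (Test (if t = CHR ''.'' then if d = CHR ''1'' then One else Two else Spl),
      \<Phi> @ [(Bot, m)], (head_cells d (rev (enc \<Phi>)), map Key w @ Key t # map Key \<alpha>), ([], []),
      ([Start], encode_table tab), (replicate N' Filler @ [Start], [])) c"
  shows "reaches False (at_rest Wait \<Phi> [(Bot, m)] tab N) c"
proof -
  let ?B = "([Start], encode_table tab)"
  let ?m = "if d = CHR ''1'' then One else Two"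
  have D: "replicate N' Filler @ [Start] = replicate (Suc (length w)) Filler @ replicate N Filler @ [Start]"
    by (simp add: N' replicate_add[symmetric] add.commute del: replicate_Suc append_assoc flip: append_assoc)
  have "reaches False (Rewind (if t = CHR ''.'' then ?m else Spl), \<Phi> @ [(Bot, m)],
      (rev (map Key w) @ head_cells d (rev (enc \<Phi>)), Key t # map Key \<alpha>), ([], []), ?B,
      (replicate N' Filler @ [Start], [])) c"
    using assms(5) by (intro rewind_test) simp_all
  then have "reaches False (Measure ?m, \<Phi> @ [(Bot, m)],
      (head_cells d (rev (enc \<Phi>)), map Key w @ Key t # map Key \<alpha>), ([], []), ?B,
      (replicate N Filler @ [Start], [])) c"
    unfolding D by (intro measure w t)
  then have "reaches False (Dot ?m, \<Phi> @ [(Bot, m)],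
      (K d # Label Bot # rev (enc \<Phi>), map Key (CHR ''.'' # w @ t # \<alpha>)), ([], []), ?B,
      (replicate N Filler @ [Start], [])) c"
    by (intro reaches_step) simp_all
  then have "reaches False (Read_Digit, \<Phi> @ [(Bot, m)],
      (Label Bot # rev (enc \<Phi>), map Key m), ([], []), ?B, (replicate N Filler @ [Start], [])) c"
    by (intro reaches_step) (simp_all add: msg)
  then show ?thesis unfolding at_rest_def by (intro reaches_step) simp_all
qed

lemma lt_reply:
  assumes w: "bitstring w" and msg: "m = d # CHR ''.'' # w @ CHR ''.'' # \<alpha>"
    and md: "md = (if d = CHR ''1'' then One else Two)"
    and tab: "\<forall>x \<in> set tab. is_record (snd x)" and N': "N' = N + Suc (length w)"
  shows "reaches False (at_rest Wait \<Phi> [(Bot, m)] tab N)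
    (at_rest Permit (\<Phi> @ (Bot, m) # replies md w N' \<alpha> tab) [] tab N')" (is "reaches _ _ ?c")
proof (rule lt_start[OF w _ msg N'])
  let ?\<Phi> = "(\<Phi> @ [(Bot, m)]) @ replies md w N' \<alpha> tab"
  let ?R = "(head_cells d (rev (enc \<Phi>)), map Key (w @ CHR ''.'' # \<alpha>) @ enc ([] @ replies md w N' \<alpha> tab))"
  let ?B = "(rev (encode_table tab) @ [Start], [])" and ?D = "(replicate N' Filler @ [Start], [])"
  have "reaches False (Table_End, ?\<Phi>, ?R, ([], []), ?B, ?D) (at_rest Permit ?\<Phi> [] tab N')"
    using tab by (intro finish_round) (simp_all add: msg)
  then have "reaches False (Test md, ?\<Phi>, ?R, ([], []), ?B, ?D) ?c"
    by (intro reaches_step) simp_all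
  then have "reaches False (Test md, \<Phi> @ [(Bot, m)],
      (head_cells d (rev (enc \<Phi>)), map Key (w @ CHR ''.'' # \<alpha>) @ enc []), ([], []),
      ([Start], encode_table tab), ?D) ?c"
    using tab by (intro scan_table w) (simp_all add: N' md)
  then show "reaches False (Test (if CHR ''.'' = CHR ''.'' then if d = CHR ''1'' then One else Two else Spl),
      \<Phi> @ [(Bot, m)], (head_cells d (rev (enc \<Phi>)), map Key w @ Key (CHR ''.'') # map Key \<alpha>),
      ([], []), ([Start], encode_table tab), ?D) ?c"
    by (simp add: md)
qed simp

section \<open>Replacing a record by its children\<close>

lemma skip_misses:
  assumes w: "bitstring w" "length w \<le> N"
    and "\<forall>x \<in> set tab. is_record (snd x)" "filter (hit Spl w N) (live tab) = []"
    "reaches g (Test Spl, \<Phi>, (head_cells d ls, map Key w @ K (CHR '':'') # rs), A,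
      (rev (encode_table tab) @ bs, bt), D) c"
  shows "reaches g (Test Spl, \<Phi>, (head_cells d ls, map Key w @ K (CHR '':'') # rs), A,
      (bs, encode_table tab @ bt), D) c"
  using assms(3-)
proof (induction tab arbitrary: bs)
  case (Cons x tab)
  obtain b r where x: "x = (b, r)" by (cases x)
  have r: "is_record r" and miss: "\<not> (b \<and> hit Spl w N r)"
    using Cons.prems(1,2) x by (auto split: if_splits)
  have "reaches g (Test Spl, \<Phi>, (head_cells d ls, map Key w @ K (CHR '':'') # rs), A,
      (flag b # rev r @ bs, encode_table tab @ bt), D) c"
    using Cons.prems x by (intro Cons.IH) (auto split: if_splits)
  then show ?case
    using scan_miss[OF r w miss, of rs "CHR '':''" g \<Phi> d ls A bs "encode_table tab @ bt" D c] x by simp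
qed simp

lemma append:
  assumes "Blank \<notin> set bt" "reaches g (Append_Rewind False, \<Phi>, R, A, (rev bt @ bs, []), D) c"
  shows "reaches g (Append, \<Phi>, R, A, (bs, bt), D) c"
  using assms
proof (induction bt arbitrary: bs)
  case Nil
  then show ?case by (intro reaches_step) (cases R, simp_all)
next
  case (Cons u us)
  then show ?case by (intro reaches_step) (cases R, auto)
qed

lemma append_rewind:
  assumes "Start \<notin> set us" "reaches g (Append_Copy b, \<Phi>, R, ([Start], rev us @ rs), B, D) c"
  shows "reaches g (Append_Rewind b, \<Phi>, R, shift Left (us @ [Start], rs), B, D) c"
  using assms
proof (induction us arbitrary: rs)
  case Nil
  then show ?case by (intro reaches_step) (cases R, simp_all)
next
  case (Cons u us)
  then show ?case by (intro reaches_step) (cases R, auto)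
qed

lemma append_copy:
  assumes "Blank \<notin> set us" "reaches g (Append_Flag b, \<Phi>, R, (rev us @ as, []),
    ((if b then K (CHR ''1'') else K (CHR ''0'')) # rev us @ bs, []), D) c"
  shows "reaches g (Append_Copy b, \<Phi>, R, (as, us), (bs, []), D) c"
  using assms
proof (induction us arbitrary: as bs)
  case Nil
  then show ?case by (intro reaches_step) (cases R, auto)+
next
  case (Cons u us)
  then show ?case by (intro reaches_step) (cases R, auto)+
qed

text \<open>The padded record on the output tape is copied twice to the end of the table, once for
  each final bit. The tape is then erased without being emitted, so splitting adds nothing to the
  run.\<close>

lemma append_children:
  assumes us: "is_record us" and bt: "Blank \<notin> set bt"
    and "reaches g (Table_End, \<Phi>, R, ([], []),
      (rev (us @ [K (CHR ''0''), Live] @ us @ [K (CHR ''1''), Live]) @ rev bt @ bs, []), D) c"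
  shows "reaches g (Append, \<Phi>, R, (rev us @ [Start], []), (bs, bt), D) c"
proof -
  have no: "Blank \<notin> set us" "Start \<notin> set us" using us by (auto simp: is_record_def)
  let ?B1 = "rev (us @ [K (CHR ''0''), Live]) @ rev bt @ bs"
  let ?B2 = "rev (us @ [K (CHR ''1''), Live]) @ ?B1"
  obtain y ys where y: "rev us @ [Start] = y # ys" by (cases "rev us @ [Start]") auto
  have "Blank \<notin> set (rev us @ [Start])" using no by simp
  then have y_no: "y \<noteq> Blank" "Blank \<notin> set ys" unfolding y by auto
  have "reaches g (Erase Rewind_Table, \<Phi>, R, ([], []), (?B2, []), D) c"
    using assms(3) by (intro reaches_step) (cases R, simp_all)
  then have "reaches g (Erase Rewind_Table, \<Phi>, R, (ys, [y]), (?B2, []), D) c"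
    using y_no by (intro erase)
  then have "reaches g (Append_Flag True, \<Phi>, R, (rev us @ [Start], []), (tl ?B2, []), D) c"
    unfolding y by (intro reaches_step) (cases R, simp_all)
  then have "reaches g (Append_Copy True, \<Phi>, R, ([Start], rev (rev us) @ []), (?B1, []), D) c"
    using no by (simp, intro append_copy) simp_all
  then have *: "reaches g (Append_Rewind True, \<Phi>, R, shift Left (rev us @ [Start], []), (?B1, []), D) c"
    using no by (intro append_rewind) simp_all
  have "reaches g (Append_Rewind True, \<Phi>, R, (rev us @ [Start], []), (?B1, []), D) c"
    by (rule reaches_step, simp) (use * in \<open>cases R, simp\<close>)
  then have "reaches g (Append_Flag False, \<Phi>, R, (rev us @ [Start], []), (tl ?B1, []), D) c"
    by (intro reaches_step) (cases R, simp_all)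
  then have "reaches g (Append_Copy False, \<Phi>, R, ([Start], rev (rev us) @ []), (rev bt @ bs, []), D) c"
    using no by (simp, intro append_copy) simp_all
  then have *: "reaches g (Append_Rewind False, \<Phi>, R, shift Left (rev us @ [Start], []), (rev bt @ bs, []), D) c"
    using no by (intro append_rewind) simp_all
  have "reaches g (Append_Rewind False, \<Phi>, R, (rev us @ [Start], []), (rev bt @ bs, []), D) c"
    by (rule reaches_step, simp) (use * in \<open>cases R, simp\<close>)
  then show ?thesis using bt by (intro append)
qed

lemma split_record:
  assumes r: "is_record r" and f: "f \<in> {Live, Dead, Start}" and bt: "Blank \<notin> set bt"
    and "reaches g (Table_End, \<Phi>, R, ([], []),
      (rev (r @ Dead # bt @ r @ replicate N Filler @ [K (CHR ''0''), Live] @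
        r @ replicate N Filler @ [K (CHR ''1''), Live]) @ f # bs, []),
      (replicate N Filler @ [Start], [])) c"
  shows "reaches g (Match Spl, \<Phi>, R, ([], []), (rev r @ f # bs, Live # bt),
    (replicate N Filler @ [Start], [])) c"
proof -
  let ?B = "(rev r @ f # bs, flag False # bt)"
  have "reaches g (Append, \<Phi>, R, (rev (r @ replicate N Filler) @ [Start], []), ?B,
      (replicate N Filler @ [Start], [])) c"
    using assms by (intro append_children) simp_all
  then have "reaches g (Out_Pad_Back Spl, \<Phi>, R, (replicate N Filler @ rev r @ [Start], []), ?B,
      ([Start], replicate N Filler)) c"
    by (intro out_pad_back) simp
  then have "reaches g (Out_Pad Spl, \<Phi>, R, (rev r @ [Start], []), ?B,
      shift Left (replicate N Filler @ [Start], [])) c"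
    by (intro out_pad) simp
  then have "reaches g (Out_Pad0 Spl, \<Phi>, R, (rev (copied Spl r) @ [Start], []), ?B,
      (replicate N Filler @ [Start], [])) c"
    by (intro reaches_step) (cases R, simp_all)
  then have "reaches g (Out_Record Spl, \<Phi>, R, ([Start], []), (f # bs, r @ flag False # bt),
      (replicate N Filler @ [Start], [])) c"
    by (intro out_record r)
  then show ?thesis by (intro match_front r f) simp
qed

lemma kill_absent: "u \<notin> leaf_of ` set (live tab) \<Longrightarrow> kill u tab = tab"
proof (induction tab)
  case (Cons x tab)
  obtain b r where "x = (b, r)" by (cases x)
  with Cons show ?case by (cases b) (auto simp: kill_def)
qed (simp add: kill_def)

text \<open>Live leaves are distinct, so killing by leaf changes a single entry. No live record
  before it has the same leaf, so it is the one at which the machine's search stops.\<close>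

lemma kill_unique:
  assumes "r \<in> set (live tab)" "distinct (map leaf_of (live tab))"
  obtains t1 t2 where "tab = t1 @ (True, r) # t2" "leaf_of r \<notin> leaf_of ` set (live t1)"
    "kill (leaf_of r) tab = t1 @ (False, r) # t2"
proof -
  have "(True, r) \<in> set tab" using assms(1) by (auto simp: live_def)
  then obtain t1 t2 where tab: "tab = t1 @ (True, r) # t2" by (auto dest: split_list)
  have "leaf_of r \<notin> leaf_of ` set (live t1)" "leaf_of r \<notin> leaf_of ` set (live t2)"
    using assms(2) unfolding tab by auto
  moreover from this have "kill (leaf_of r) tab = t1 @ (False, r) # t2"
    using kill_absent[of "leaf_of r" t1] kill_absent[of "leaf_of r" t2] unfolding tab kill_def by simp
  ultimately show thesis using tab that by blast
qed

text \<open>Since only one record can match, the pass over the table is abandoned after the split;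
  in particular the new children are not tested against the move that created them.\<close>

lemma lt_split_reply:
  assumes msg: "m = CHR ''2'' # CHR ''.'' # leaf_of r @ '':''"
    and tab: "\<forall>x \<in> set tab. is_record (snd x)" and N': "N' = N + Suc (length (leaf_of r))"
    and r: "r \<in> set (live tab)" "distinct (map leaf_of (live tab))"
  shows "reaches False (at_rest Wait \<Phi> [(Bot, m)] tab N)
    (at_rest Permit (\<Phi> @ [(Bot, m)]) [] (split_table (leaf_of r) r N' tab) N')" (is "reaches _ _ ?c")
proof -
  obtain t1 t2 where t: "tab = t1 @ (True, r) # t2" "leaf_of r \<notin> leaf_of ` set (live t1)"
    "kill (leaf_of r) tab = t1 @ (False, r) # t2" using kill_unique[OF r] by blast
  let ?u = "leaf_of r" and ?tab = "split_table (leaf_of r) r N' tab"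
  have rec: "is_record r" using tab t(1) by simp
  then have u: "bitstring ?u" "length ?u \<le> N'" by (simp_all add: N')
  let ?ls = "head_cells (CHR ''2'') (rev (enc \<Phi>))" and ?D = "(replicate N' Filler @ [Start], [])"
  let ?end = "(rev (map Key ?u) @ ?ls, K (CHR '':'') # [])"
  have enc_tab: "encode_table ?tab = encode_table t1 @ r @ Dead # encode_table t2 @
      r @ replicate N' Filler @ [K (CHR ''0''), Live] @ r @ replicate N' Filler @ [K (CHR ''1''), Live]"
    by (simp add: split_table_def t(3))
  have records: "\<forall>x \<in> set ?tab. is_record (snd x)"
    using tab rec t by (auto simp: split_table_def)
  have no_blank: "Blank \<notin> set (encode_table t2)" using tab t(1) by (simp add: table_symbols)
  have bs: "\<exists>f bs. f \<in> {Live, Dead, Start} \<and> rev (encode_table t1) @ [Start] = f # bs"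
    by (cases t1 rule: rev_cases) auto
  then obtain f bs where f: "f \<in> {Live, Dead, Start}" "rev (encode_table t1) @ [Start] = f # bs" by blast
  have "reaches False (Table_End, \<Phi> @ [(Bot, m)], ?end, ([], []), (rev (encode_table ?tab) @ [Start], []), ?D) ?c"
    by (intro finish_round records) (simp add: msg)
  then have "reaches False (Match Spl, \<Phi> @ [(Bot, m)], ?end, ([], []),
      (rev r @ f # bs, Live # encode_table t2), ?D) ?c"
    by (intro split_record rec f(1) no_blank) (simp add: enc_tab f(2)[symmetric])
  then have "reaches False (Test Spl, \<Phi> @ [(Bot, m)], (?ls, map Key ?u @ terminator Spl # []), ([], []),
      (rev (encode_table t1) @ [Start], r @ flag True # encode_table t2), ?D) ?c"
    by (intro test_record[OF rec u]) (simp_all add: f(2))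
  then have "reaches False (Test Spl, \<Phi> @ [(Bot, m)], (?ls, map Key ?u @ K (CHR '':'') # []), ([], []),
      ([Start], encode_table t1 @ r @ Live # encode_table t2), ?D) ?c"
    using tab t(1,2) by (intro skip_misses[OF u]) (auto simp: filter_empty_conv image_iff)
  then show ?thesis
    by (intro lt_start[OF u(1) _ _ N', of "CHR '':''" m "CHR ''2''" "[]"]) (simp_all add: msg t(1))
qed

section \<open>The antecedent thread matched in the limit\<close>

lemma chain_limit:
  assumes chain: "\<And>k :: nat. prefix (z k) (z (Suc k))" and bit: "\<And>k. bitstring (z k)"
  shows "\<exists>v. \<forall>k. bit_segment (z k) v"
proof -
  \<comment> \<open>The chain may be bounded, as when the environment makes finitely many moves;
    places that it never reaches get the bit 0.\<close>
  define v where "v i \<longleftrightarrow> (\<exists>k. i < length (z k) \<and> z k ! i = CHR ''1'')" for i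
  have mono: "prefix (z j) (z k)" if "j \<le> k" for j k
    using that by (induction rule: dec_induct) (auto intro: prefix_order.trans chain)
  have same: "z j ! i = z k ! i" if "i < length (z j)" "i < length (z k)" for i j k
  proof (cases "j \<le> k")
    case True
    then show ?thesis using mono[of j k] that by (auto simp: prefix_def nth_append)
  next
    case False
    then show ?thesis using mono[of k j] that by (auto simp: prefix_def nth_append)
  qed
  have "z k = bits v (length (z k))" for k
  proof (rule nth_equalityI)
    fix i assume i: "i < length (z k)"
    have "v i \<longleftrightarrow> z k ! i = CHR ''1''"
    proof
      assume "v i"
      then obtain j where "i < length (z j)" "z j ! i = CHR ''1''" unfolding v_def by blast
      with same[of i j k] i show "z k ! i = CHR ''1''" by simp
    qed (use i v_def in blast)
    moreover have "z k ! i \<in> {CHR ''0'', CHR ''1''}"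
      using bit[of k] nth_mem[OF i] unfolding bitstring_def by blast
    ultimately show "z k ! i = bits v (length (z k)) ! i" using i by (auto simp: bits_def)
  qed simp
  then show ?thesis unfolding bit_segment_iff by blast
qed

lemma refines_weaken: "refines tab N' tab' M \<Longrightarrow> N \<le> N' \<Longrightarrow> refines tab N tab' M"
proof -
  assume *: "refines tab N' tab' M" "N \<le> N'"
  have "prefix (code_of r @ zeros N) (code_of r @ zeros N')" for r
    using *(2) by (auto simp: le_iff_add replicate_add)
  then show ?thesis using *(1) unfolding refines_def by (meson prefix_order.trans)
qed

lemma lt_round:
  assumes A: "constant_game A" and inv: "lt_inv A tab N \<Phi>"
    and legal: "Fin (\<Phi> @ [(Bot, m)]) \<in> Lr (imp_cgame (loose_cgame A) (tight_cgame A))"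
  shows "\<exists>tab' N' \<Phi>'. lt_inv A tab' N' \<Phi>' \<and> refines tab N tab' N' \<and>
    reaches False (at_rest Wait \<Phi> [(Bot, m)] tab N) (at_rest Permit \<Phi>' [] tab' N')"
proof -
  note records = lt_records[OF inv]
  have reply: ?thesis if w: "bitstring w" and msg: "m = d # CHR ''.'' # w @ CHR ''.'' # \<alpha>"
    and md: "md = (if d = CHR ''1'' then One else Two)"
    and inv': "lt_inv A tab (N + Suc (length w)) (\<Phi> @ (Bot, m) # replies md w (N + Suc (length w)) \<alpha> tab)"
    for w d \<alpha> md
    using lt_reply[OF w msg md records refl] inv' refines_mono[OF inv le_add1] by blast
  from imp_move[OF legal] consider h where "m = CHR ''1'' # CHR ''.'' # h"
    | h where "m = CHR ''2'' # CHR ''.'' # h" by blast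
  then show ?thesis
  proof cases
    case (1 h)
    then have "Fin (ante \<Phi> @ [(Top, h)]) \<in> Lr (loose_cgame A)" using legal by (simp add: legal_imp)
    then obtain w \<alpha> where w: "bitstring w" "h = w @ CHR ''.'' # \<alpha>" by (rule legal_loose_snocD)
    \<comment> \<open>The counter is raised before the reply, so that \<open>w\<close> already fits
      into the padding used for it.\<close>
    let ?N = "N + Suc (length w)"
    have msg: "m = CHR ''1'' # CHR ''.'' # w @ CHR ''.'' # \<alpha>" using 1 w(2) by simp
    have "lt_inv A tab ?N (\<Phi> @ (Bot, m) # replies One w ?N \<alpha> tab)"
      using lt_copy[OF lt_mono[OF inv] w(1) _ msg legal, of ?N] by (simp add: replies_def hit_def[abs_def])
    then show ?thesis using reply[OF w(1) msg, of One] by simp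
  next
    case (2 h)
    then have "Fin (cons \<Phi> @ [(Bot, h)]) \<in> Lr (tight_cgame A)" using legal by (simp add: legal_imp)
    then have "tight_legal_move A (cons \<Phi>) Bot h" by (simp add: legal_tight_snoc)
    then consider u where "bitstring u" "h = u @ '':''"
      | u \<alpha> where "bitstring u" "h = u @ CHR ''.'' # \<alpha>"
      by (auto simp: tight_legal_move_def)
    then show ?thesis
    proof cases
      case u: (1 u)
      let ?N = "N + Suc (length u)"
      have msg: "m = CHR ''2'' # CHR ''.'' # u @ '':''" using 2 u(2) by simp
      have inv': "lt_inv A tab ?N \<Phi>" using lt_mono[OF inv] by simp
      obtain r where r: "r \<in> set (live tab)" "leaf_of r = u"
        "lt_inv A (split_table u r ?N tab) ?N (\<Phi> @ [(Bot, m)])"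
        "refines tab ?N (split_table u r ?N tab) ?N"
        by (rule lt_split[OF inv' u(1) msg legal])
      have "refines tab N (split_table u r ?N tab) ?N" using refines_weaken[OF r(4)] by simp
      moreover have "reaches False (at_rest Wait \<Phi> [(Bot, m)] tab N)
          (at_rest Permit (\<Phi> @ [(Bot, m)]) [] (split_table u r ?N tab) ?N)"
        using lt_split_reply[OF _ records _ r(1) lt_distinct[OF inv], of m ?N N \<Phi>] msg
        unfolding r(2) by simp
      ultimately show ?thesis using r(3) by blast
    next
      case u: (2 u \<alpha>)
      let ?N = "N + Suc (length u)"
      have msg: "m = CHR ''2'' # CHR ''.'' # u @ CHR ''.'' # \<alpha>" using 2 u(2) by simp
      have "lt_inv A tab ?N (\<Phi> @ (Bot, m) # replies Two u ?N \<alpha> tab)"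
        using lt_answer[OF lt_mono[OF inv] u(1) msg legal, of ?N] by (simp add: replies_def hit_def[abs_def])
      then show ?thesis using reply[OF u(1) msg, of Two] by simp
    qed
  qed
qed

text \<open>At each stage exactly one live leaf lies on \<open>v\<close>, and by
  \<open>refines\<close> its padded code extends the previous one. A common extension
  \<open>v'\<close> of all these codes satisfies the clause about threads at every stage at
  once.\<close>

lemma lt_threads_limit:
  assumes inv: "\<And>k. lt_inv A (tab k) (N k) (F k)"
    and ref: "\<And>k. refines (tab k) (N k) (tab (Suc k)) (N (Suc k))"
  shows "\<exists>v'. \<forall>k. thread_pos v' (ante (F k)) = thread_pos v (cons (F k))"
proof -
  have "\<exists>r. \<forall>k. r k \<in> set (live (tab k)) \<and> bit_segment (leaf_of (r k)) v"
    using lt_cover[OF inv] by (intro choice) blast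
  then obtain r where r: "\<And>k. r k \<in> set (live (tab k))" "\<And>k. bit_segment (leaf_of (r k)) v" by blast
  have "\<exists>v'. \<forall>k. bit_segment (code_of (r k) @ zeros (N k)) v'"
  proof (rule chain_limit)
    show "prefix (code_of (r k) @ zeros (N k)) (code_of (r (Suc k)) @ zeros (N (Suc k)))" for k
      using ref[of k] r unfolding refines_def by blast
    show "bitstring (code_of (r k) @ zeros (N k))" for k
      using lt_record[OF inv r(1)] by simp
  qed
  then show ?thesis using lt_threads[OF inv r(1) r(2)] by blast
qed

lemma loose_implies_tight: "uniformly_valid (Imp (LooseRec Atom) (TightRec Atom))"
  unfolding uniformly_valid_def computes_def
proof (intro exI[of _ "machine False"] conjI allI impI is_epm_machine)
  fix G :: game and e
  assume "static_game G"
  then have A: "constant_game (G e)" by (simp add: static_game_def)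
  have "wins (machine False) e (imp_cgame (loose_cgame (G e)) (tight_cgame (G e)))"
  proof (rule machine_wins[where P = "lt_inv (G e)" and rel = refines,
        OF limit_closed_loose limit_closed_tight branching_winner_loose branching_winner_tight])
    show "limit_closed (Lr (G e))" by (rule constant_game_limit_closed[OF A])
    show "lt_inv (G e) [(True, [])] 0 []" by (rule lt_inv_init[OF A])
    show "Fin \<Phi> \<in> Lr (imp_cgame (loose_cgame (G e)) (tight_cgame (G e)))"
      if "lt_inv (G e) tab N \<Phi>" for tab N \<Phi>
      using that by (simp add: lt_inv_def)
    show "refines tab N tab N" if "lt_inv (G e) tab N \<Phi>" for tab N \<Phi>
      using refines_mono[OF that] by simp
  qed (rule lt_round[OF A], assumption+, rule lt_threads_limit)
  then show "wins (machine False) e (subst_game G (Imp (LooseRec Atom) (TightRec Atom)) e)"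
    by (simp add: imp_cgame_def)
qed

theorem theorem4p1:
  "uniformly_valid (Imp (TightRec Atom) (LooseRec Atom)) \<and>
   uniformly_valid (Imp (LooseRec Atom) (TightRec Atom))"
  using tight_implies_loose loose_implies_tight by (rule conjI)

end
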